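(* For each $s>0$ there exists a constant $C=C(s)>0$, depending only on $s$, such that the following holds. Let $n\ge1$, let $\lambda=1^{n_1}2^{n_2}\cdots$ be a partition of $n$ (with $n_i$ parts of size $i$), let $\mathcal{C}_\lambda\subseteq S_n$ be the conjugacy class of permutations of cycle type $\lambda$, let $\pi$ be chosen uniformly at random from $\mathcal{C}_\lambda$, and let $\alpha_1=n_1/n$. Then \[ \mathbb{E}\!\left[e^{-s\,p(\pi)/\sqrt n}\right]=\exp\left\{-\frac{1-\alpha_1^3}{3}\,s\sqrt n+\left(\frac1{45}+\frac{\alpha_1^3}{18}-\frac{3\alpha_1^5}{10}+\frac{2\alpha_1^6}{9}\right)s^2+E_{\lambda,s}\right\} \] where $|E_{\lambda,s}|\le C n^{-1/4}$.
   Context: For $\pi\in S_n$ (viewed as the word $\pi(1)\cdots\pi(n)$), $\pi$ has a peak at position $i$, where $1<i<n$, if $\pi(i-1)<\pi(i)>\pi(i+1)$; $p(\pi)$ denotes the number of peaks of $\pi$. *)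

theory Defs
  imports Complex_Main "HOL-Combinatorics.Permutations" "HOL-Combinatorics.Orbits"
begin

text \<open>Permutations of [n] = {1..n} are functions that permute {1..n} (identity elsewhere);
  the word of pi is pi(1) ... pi(n).\<close>

definition peaks :: "nat \<Rightarrow> (nat \<Rightarrow> nat) \<Rightarrow> nat" where
  "peaks n \<pi> = card {i. 1 < i \<and> i < n \<and> \<pi> (i - 1) < \<pi> i \<and> \<pi> i > \<pi> (i + 1)}"

definition num_cycles :: "nat \<Rightarrow> (nat \<Rightarrow> nat) \<Rightarrow> nat \<Rightarrow> nat" where
  "num_cycles n \<pi> k = card {orbit \<pi> x | x. x \<in> {1..n} \<and> card (orbit \<pi> x) = k}"

definition is_partition_mult :: "nat \<Rightarrow> (nat \<Rightarrow> nat) \<Rightarrow> bool" where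
  "is_partition_mult n m \<longleftrightarrow> m 0 = 0 \<and> (\<forall>k>n. m k = 0) \<and> (\<Sum>k=1..n. k * m k) = n"

definition conj_class :: "nat \<Rightarrow> (nat \<Rightarrow> nat) \<Rightarrow> (nat \<Rightarrow> nat) set" where
  "conj_class n m = {\<pi>. \<pi> permutes {1..n} \<and> (\<forall>k\<ge>1. num_cycles n \<pi> k = m k)}"

definition unif_expect :: "'a set \<Rightarrow> ('a \<Rightarrow> real) \<Rightarrow> real" where
  "unif_expect A f = (\<Sum>x\<in>A. f x) / real (card A)"

end

theory Submission
  imports Defs
begin

text \<open>
  Write a uniform element of the class as a conjugate of a fixed \<open>\<pi>0\<close> by a uniform \<open>\<rho>\<close>, and let
  \<open>p\<close> be the number of peaks.  Conjugation by a permutation with bounded support changes \<open>p\<close> by a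
  bounded amount.  Hence fixing the values of \<open>\<pi>\<close> on a bounded set of positions changes
  \<open>M(\<theta>) = E exp(-\<theta> p)\<close> only by a factor \<open>1 + O(\<theta>)\<close>: replace \<open>\<rho>\<close> by a
  permutation of bounded support that agrees with it where it matters.  One more order of this
  expansion gives \<open>E(p exp(-\<theta> p)) = (E p - \<theta> Var p + O(n \<theta>^2)) M(\<theta>)\<close>, and integrating
  \<open>(ln M)'\<close> up to \<open>\<theta> = s / sqrt n\<close> reduces the claim to the mean and the variance of \<open>p\<close>.

  Both moments come from conjugating by the permutations of a block of consecutive positions:
  unless a non-fixed point of the block is mapped into the block (probability \<open>O(1/n)\<close>), exactly
  one of these conjugates is decreasing on the block if it contains at most one fixed point, and
  none otherwise.  Averaging the peak indicator at \<open>i\<close> over the permutations of \<open>{i-1, i, i+1}\<close>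
  therefore leaves \<open>1/3\<close> unless all three points are fixed; so distant peaks are correlated only
  through the number of fixed points, while peaks at distance two are handled by the
  decreasing-run expansion of their joint indicator on a window of five positions.
\<close>

subsection \<open>Averages over random conjugates\<close>

text \<open>The obstacle lies in the variance. There are about \<open>n^2\<close> pairs of distant
  peaks, each with covariance of order \<open>1/n\<close>, so these covariances are needed with
  error \<open>O(1/n^2)\<close>; but the exceptional event at a single block may already have
  probability of order \<open>1/n\<close>. Therefore \<open>pk i\<close> is split into
  \<open>Y i\<close> and a remainder supported on the bad event. The centred part \<open>W i\<close>
  of \<open>Y i\<close> is exactly orthogonal to functions invariant under permutations of the
  block, and the remainders add up to a variable of variance \<open>O(1)\<close>, because bad events
  at disjoint blocks occur together with probability \<open>O(1/n^2)\<close>. Recombining both costs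
  \<open>O(sqrt n)\<close> in the variance, hence \<open>O(1/sqrt n)\<close> in the exponent. In the
  tilting step, the change of \<open>p\<close> under conjugation by \<open>\<tau>\<close> involves
  the positions that \<open>\<pi>\<close> maps into the support of \<open>\<tau>\<close>. This set
  depends on \<open>\<pi>\<close>, so locality is expressed by sets of positions that behave like
  stopping times.\<close>

definition perms :: "nat \<Rightarrow> (nat \<Rightarrow> nat) set" where
  "perms n = {\<rho>. \<rho> permutes {1..n}}"

lemma permsD: "\<rho> \<in> perms n \<Longrightarrow> \<rho> permutes {1..n}"
  by (simp add: perms_def)

definition cj :: "('a \<Rightarrow> 'a) \<Rightarrow> ('a \<Rightarrow> 'a) \<Rightarrow> 'a \<Rightarrow> 'a" where
  "cj \<rho> \<pi> = \<rho> \<circ> \<pi> \<circ> inv \<rho>"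

lemma cj_cj: "bij \<rho> \<Longrightarrow> bij \<sigma> \<Longrightarrow> cj \<rho> (cj \<sigma> \<pi>) = cj (\<rho> \<circ> \<sigma>) \<pi>"
  by (simp add: cj_def o_inv_distrib comp_assoc)

lemma cj_apply: "inj \<rho> \<Longrightarrow> cj \<rho> \<pi> (\<rho> x) = \<rho> (\<pi> x)"
  by (simp add: cj_def)

lemma cj_id: "cj id \<pi> = \<pi>"
  by (simp add: cj_def)

lemma cj_permutes: "\<rho> permutes A \<Longrightarrow> \<pi> permutes A \<Longrightarrow> cj \<rho> \<pi> permutes A"
  unfolding cj_def by (intro permutes_compose permutes_inv)

lemma perms_cj: "\<rho> \<in> perms n \<Longrightarrow> \<pi> \<in> perms n \<Longrightarrow> cj \<rho> \<pi> \<in> perms n"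
  by (simp add: perms_def cj_permutes)

lemma perms_compose: "\<rho> \<in> perms n \<Longrightarrow> \<sigma> \<in> perms n \<Longrightarrow> \<rho> \<circ> \<sigma> \<in> perms n"
  by (simp add: perms_def permutes_compose)

lemma perms_inv: "\<rho> \<in> perms n \<Longrightarrow> inv \<rho> \<in> perms n"
  by (simp add: perms_def permutes_inv)

lemma perms_bij: "\<rho> \<in> perms n \<Longrightarrow> bij \<rho>"
  by (meson permsD permutes_bij)

lemma perms_inverses:
  assumes "\<rho> \<in> perms n"
  shows "\<rho> (inv \<rho> x) = x" "inv \<rho> (\<rho> x) = x"
  using permutes_inverses[OF permsD[OF assms]] by auto

lemma cj_eq_iff: "\<rho> permutes A \<Longrightarrow> cj \<rho> \<pi> x = y \<longleftrightarrow> \<pi> (inv \<rho> x) = inv \<rho> y"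
  unfolding cj_def by (metis comp_apply permutes_inverses)

lemma cj_fixed_iff: "\<rho> permutes A \<Longrightarrow> cj \<rho> \<pi> x = x \<longleftrightarrow> \<pi> (inv \<rho> x) = inv \<rho> x"
  by (rule cj_eq_iff)

lemma cj_inv_cj: "\<rho> permutes A \<Longrightarrow> cj (inv \<rho>) (cj \<rho> \<pi>) = \<pi>"
  by (metis cj_cj cj_id permutes_bij permutes_inv permutes_inv_o(2))

locale random_conjugate =
  fixes n :: nat and \<pi>0 :: "nat \<Rightarrow> nat"
  assumes pi0: "\<pi>0 \<in> perms n" and n_pos: "n \<ge> 1"
begin

definition Cl :: "(nat \<Rightarrow> nat) set" where
  "Cl = (\<lambda>\<rho>. cj \<rho> \<pi>0) ` perms n"

text \<open>Averaging over the conjugator instead of over the image \<open>Cl\<close> makes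
  invariance under conjugation a mere reindexing of the sum.\<close>

definition EE :: "((nat \<Rightarrow> nat) \<Rightarrow> real) \<Rightarrow> real" where
  "EE h = unif_expect (perms n) (\<lambda>\<rho>. h (cj \<rho> \<pi>0))"

lemma finite_perms: "finite (perms n)"
  by (simp add: perms_def finite_permutations)

lemma id_perms: "id \<in> perms n"
  by (simp add: perms_def permutes_id)

lemma card_perms_pos: "real (card (perms n)) > 0"
  using finite_perms id_perms by (metis card_gt_0_iff empty_iff of_nat_0_less_iff)

lemma finite_Cl: "finite Cl"
  unfolding Cl_def using finite_perms by blast

lemma Cl_perms: "\<pi> \<in> Cl \<Longrightarrow> \<pi> \<in> perms n"
  unfolding Cl_def using perms_cj pi0 by blast

lemma EE_alt: "EE h = (\<Sum>\<rho>\<in>perms n. h (cj \<rho> \<pi>0)) / real (card (perms n))"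
  by (simp add: EE_def unif_expect_def)

lemma EE_cong: "(\<And>\<pi>. \<pi> \<in> Cl \<Longrightarrow> f \<pi> = g \<pi>) \<Longrightarrow> EE f = EE g"
  unfolding EE_alt Cl_def by (intro arg_cong2[where f="(/)"] sum.cong) auto

lemma EE_mono: "(\<And>\<pi>. \<pi> \<in> Cl \<Longrightarrow> f \<pi> \<le> g \<pi>) \<Longrightarrow> EE f \<le> EE g"
  unfolding EE_alt Cl_def by (intro divide_right_mono sum_mono) auto

lemma EE_nonneg: "(\<And>\<pi>. \<pi> \<in> Cl \<Longrightarrow> 0 \<le> g \<pi>) \<Longrightarrow> 0 \<le> EE g"
  unfolding EE_alt Cl_def by (intro divide_nonneg_nonneg sum_nonneg) auto

lemma EE_const: "EE (\<lambda>_. c) = c"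
  unfolding EE_alt using card_perms_pos by simp

lemma EE_pos: "(\<And>\<pi>. \<pi> \<in> Cl \<Longrightarrow> 0 < g \<pi>) \<Longrightarrow> 0 < EE g"
  unfolding EE_alt Cl_def using card_perms_pos finite_perms id_perms
  by (intro divide_pos_pos sum_pos) (blast | force)+

lemma EE_add: "EE (\<lambda>\<pi>. f \<pi> + g \<pi>) = EE f + EE g"
  unfolding EE_alt by (simp add: sum.distrib add_divide_distrib)

lemma EE_diff: "EE (\<lambda>\<pi>. f \<pi> - g \<pi>) = EE f - EE g"
  unfolding EE_alt by (simp add: sum_subtractf diff_divide_distrib)

lemma EE_cmult: "EE (\<lambda>\<pi>. c * f \<pi>) = c * EE f"
  unfolding EE_alt by (simp add: sum_distrib_left)

lemma EE_multc: "EE (\<lambda>\<pi>. f \<pi> * c) = EE f * c"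
  unfolding EE_alt by (simp add: sum_distrib_right)

lemma EE_divide: "EE (\<lambda>\<pi>. f \<pi> / c) = EE f / c"
  using EE_multc[of f "1/c"] by simp

lemma EE_sum: "EE (\<lambda>\<pi>. \<Sum>i\<in>I. f i \<pi>) = (\<Sum>i\<in>I. EE (f i))"
  unfolding EE_alt sum_divide_distrib[symmetric] by (subst sum.swap) (rule refl)

lemma EE_abs: "\<bar>EE f\<bar> \<le> EE (\<lambda>\<pi>. \<bar>f \<pi>\<bar>)"
  unfolding EE_alt by (simp add: divide_right_mono)

lemma EE_abs_le: "(\<And>\<pi>. \<pi> \<in> Cl \<Longrightarrow> \<bar>f \<pi>\<bar> \<le> g \<pi>) \<Longrightarrow> \<bar>EE f\<bar> \<le> EE g"
  using EE_abs EE_mono order_trans by metis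

lemma EE_cj:
  assumes "\<tau> \<in> perms n"
  shows "EE (\<lambda>\<pi>. h (cj \<tau> \<pi>)) = EE h"
proof -
  have "(\<Sum>\<rho>\<in>perms n. h (cj \<tau> (cj \<rho> \<pi>0))) = (\<Sum>\<rho>\<in>perms n. h (cj (\<tau> \<circ> \<rho>) \<pi>0))"
    using assms by (intro sum.cong) (auto simp: cj_cj perms_bij)
  also have "\<dots> = (\<Sum>\<rho>\<in>perms n. h (cj \<rho> \<pi>0))"
    by (rule sum.reindex_bij_witness[of _ "\<lambda>\<rho>. inv \<tau> \<circ> \<rho>" "\<lambda>\<rho>. \<tau> \<circ> \<rho>"])
      (use assms in \<open>auto intro!: perms_compose perms_inv simp: fun_eq_iff perms_inverses\<close>)
  finally show ?thesis by (simp add: EE_alt)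
qed

text \<open>Right translation on the group of conjugators, where \<open>EE_cj\<close> is left
  translation: the average does not depend on the starting point in the class.\<close>

lemma mean_cj:
  assumes "\<pi> \<in> Cl"
  shows "unif_expect (perms n) (\<lambda>\<rho>. h (cj \<rho> \<pi>)) = EE h"
proof -
  obtain \<sigma> where \<sigma>: "\<sigma> \<in> perms n" "\<pi> = cj \<sigma> \<pi>0" using assms by (auto simp: Cl_def)
  have "(\<Sum>\<rho>\<in>perms n. h (cj \<rho> \<pi>)) = (\<Sum>\<rho>\<in>perms n. h (cj (\<rho> \<circ> \<sigma>) \<pi>0))"
    using \<sigma> by (intro sum.cong) (auto simp: cj_cj perms_bij)
  also have "\<dots> = (\<Sum>\<rho>\<in>perms n. h (cj \<rho> \<pi>0))"
    by (rule sum.reindex_bij_witness[of _ "\<lambda>\<rho>. \<rho> \<circ> inv \<sigma>" "\<lambda>\<rho>. \<rho> \<circ> \<sigma>"])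
      (use \<sigma> in \<open>auto intro!: perms_compose perms_inv simp: fun_eq_iff perms_inverses\<close>)
  finally show ?thesis by (simp add: EE_alt unif_expect_def)
qed

end

subsection \<open>Exponential tilting\<close>

text \<open>The restriction of \<open>\<rho>\<close> to \<open>L\<close> is a partial injection. It
  is completed to a permutation of the union of \<open>L\<close> and its image by any bijection from
  the image minus \<open>L\<close> onto \<open>L\<close> minus the image, two sets of equal
  size.\<close>

lemma small_support_extension:
  assumes \<rho>: "\<rho> permutes A" and L: "finite L"
  obtains \<tau> where "\<tau> permutes A" "\<And>x. x \<in> L \<Longrightarrow> \<tau> x = \<rho> x" "finite {x. \<tau> x \<noteq> x}"
    "card {x. \<tau> x \<noteq> x} \<le> 2 * card L"
proof -
  have inj: "inj \<rho>" using \<rho> permutes_inj by blast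
  have cl: "card (\<rho> ` L) = card L" using inj by (simp add: card_image inj_on_subset)
  have "card (\<rho> ` L - L) = card (L - \<rho> ` L)"
    using L cl by (simp add: card_Diff_subset_Int Int_commute)
  then obtain g where g: "bij_betw g (\<rho> ` L - L) (L - \<rho> ` L)"
    using L by (metis finite_Diff finite_imageI finite_same_card_bij)
  define \<tau> where "\<tau> x = (if x \<in> L then \<rho> x else if x \<in> \<rho> ` L then g x else x)" for x
  have b1: "bij_betw \<tau> L (\<rho> ` L)"
    by (rule bij_betw_cong[THEN iffD1, of _ \<rho>])
      (use inj in \<open>auto simp: \<tau>_def bij_betw_def intro: inj_on_subset\<close>)
  have b2: "bij_betw \<tau> (\<rho> ` L - L) (L - \<rho> ` L)"
    by (rule bij_betw_cong[THEN iffD1, OF _ g]) (auto simp: \<tau>_def)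
  have "bij_betw \<tau> (L \<union> (\<rho> ` L - L)) (\<rho> ` L \<union> (L - \<rho> ` L))"
    by (rule bij_betw_combine[OF b1 b2]) auto
  hence "bij_betw \<tau> (L \<union> \<rho> ` L) (L \<union> \<rho> ` L)"
    by (simp add: Un_commute)
  hence p: "\<tau> permutes (L \<union> \<rho> ` L)"
    by (rule bij_imp_permutes) (auto simp: \<tau>_def)
  have supp: "{x. \<tau> x \<noteq> x} \<subseteq> L \<union> \<rho> ` L" by (auto simp: \<tau>_def split: if_splits)
  \<comment> \<open>Points outside \<open>A\<close> are fixed by \<open>\<rho>\<close>, so such a
    point lies in the image of \<open>L\<close> only if it lies in \<open>L\<close>; in both cases
    \<open>\<tau>\<close> fixes it.\<close>
  have idA: "\<tau> x = x" if "x \<notin> A" for x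
  proof (cases "x \<in> L")
    case True thus ?thesis using that \<rho> by (simp add: \<tau>_def permutes_not_in)
  next
    case False
    have "x \<notin> \<rho> ` L"
      using False that \<rho> by (metis imageE permutes_in_image permutes_not_in)
    thus ?thesis using False by (simp add: \<tau>_def)
  qed
  have pA: "\<tau> permutes A"
    using p idA unfolding permutes_def by blast
  have "card {x. \<tau> x \<noteq> x} \<le> card (L \<union> \<rho> ` L)" using supp L by (intro card_mono) auto
  also have "\<dots> \<le> 2 * card L" using card_Un_le[of L "\<rho> ` L"] cl by simp
  finally have c: "card {x. \<tau> x \<noteq> x} \<le> 2 * card L" .
  have f: "finite {x. \<tau> x \<noteq> x}" using supp L by (meson finite_UnI finite_imageI finite_subset)
  show ?thesis by (rule that[OF pA _ f c]) (simp add: \<tau>_def)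
qed

text \<open>By \<open>cj_eq_iff\<close>, whether the conjugate by \<open>\<rho>\<close> takes the
  value \<open>y\<close> at \<open>x\<close> depends on \<open>\<rho>\<close> only through
  \<open>inv \<rho>\<close> at \<open>x\<close> and \<open>y\<close>. Hence the agreement is asked
  of the inverses.\<close>

lemma small_support_conjugator:
  assumes \<rho>: "\<rho> permutes A" and L: "finite L"
  obtains \<tau> where "\<tau> permutes A" "\<And>x. x \<in> L \<Longrightarrow> inv \<tau> x = inv \<rho> x" "finite {x. \<tau> x \<noteq> x}"
    "card {x. \<tau> x \<noteq> x} \<le> 2 * card L"
proof -
  obtain \<sigma> where \<sigma>: "\<sigma> permutes A" "\<And>x. x \<in> L \<Longrightarrow> \<sigma> x = inv \<rho> x" "finite {x. \<sigma> x \<noteq> x}"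
    "card {x. \<sigma> x \<noteq> x} \<le> 2 * card L"
    by (rule small_support_extension[OF permutes_inv[OF \<rho>] L]) blast
  have "{x. inv \<sigma> x \<noteq> x} = {x. \<sigma> x \<noteq> x}"
    using permutes_inverses[OF \<sigma>(1)] by (metis (no_types))
  thus ?thesis using that[of "inv \<sigma>"] \<sigma> by (simp add: permutes_inv permutes_inv_inv)
qed

section \<open>Change of the number of peaks under conjugation\<close>

definition pk :: "nat \<Rightarrow> (nat \<Rightarrow> nat) \<Rightarrow> real" where
  "pk i \<pi> = of_bool (\<pi> (i - 1) < \<pi> i \<and> \<pi> (i + 1) < \<pi> i)"

lemma pk_bounds: "0 \<le> pk i \<pi>" "pk i \<pi> \<le> 1" "\<bar>pk i \<pi> - pk i \<pi>'\<bar> \<le> 1"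
  by (auto simp: pk_def)

lemma pk_cong: "\<pi> (i - 1) = \<pi>' (i - 1) \<Longrightarrow> \<pi> i = \<pi>' i \<Longrightarrow> \<pi> (i + 1) = \<pi>' (i + 1)
  \<Longrightarrow> pk i \<pi> = pk i \<pi>'"
  by (simp add: pk_def)

lemma peaks_eq_sum: "real (peaks n \<pi>) = (\<Sum>i\<in>{2..<n}. pk i \<pi>)"
proof -
  have "{i. 1 < i \<and> i < n \<and> \<pi> (i - 1) < \<pi> i \<and> \<pi> i > \<pi> (i + 1)}
      = {i \<in> {2..<n}. \<pi> (i - 1) < \<pi> i \<and> \<pi> (i + 1) < \<pi> i}" by auto
  thus ?thesis unfolding peaks_def pk_def by (simp add: sum.If_cases of_bool_def Int_def)
qed

lemma peaks_le: "real (peaks n \<pi>) \<le> real n"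
proof -
  have "(\<Sum>i\<in>{2..<n}. pk i \<pi>) \<le> (\<Sum>i\<in>{2..<n}. 1)" by (intro sum_mono pk_bounds)
  also have "\<dots> \<le> real n" by simp
  finally show ?thesis by (simp add: peaks_eq_sum)
qed

text \<open>A value at \<open>x\<close> enters only the triples centred at \<open>x - 1\<close>,
  \<open>x\<close> and \<open>x + 1\<close>.\<close>

lemma peaks_diff_le:
  assumes D: "finite D" and eq: "\<And>x. x \<notin> D \<Longrightarrow> \<pi> x = \<pi>' x"
  shows "\<bar>real (peaks n \<pi>) - real (peaks n \<pi>')\<bar> \<le> 3 * real (card D)"
proof -
  define N where "N = D \<union> (+) 1 ` D \<union> (\<lambda>x. x - 1) ` D"
  have fN: "finite N" using D by (simp add: N_def)
  have "card N \<le> card D + card ((+) 1 ` D) + card ((\<lambda>x. x - 1) ` D)"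
    unfolding N_def by (meson add_le_mono1 card_Un_le le_trans)
  also have "\<dots> \<le> 3 * card D"
    using card_image_le[OF D, of "(+) 1"] card_image_le[OF D, of "\<lambda>x. x - 1"] by linarith
  finally have cN: "card N \<le> 3 * card D" .
  have 0: "pk i \<pi> - pk i \<pi>' = 0" if "i \<in> {2..<n} - N" for i
  proof -
    have "i \<notin> D" using that by (simp add: N_def)
    moreover have "i + 1 \<notin> D" using that imageI[of "i + 1" D "\<lambda>x. x - 1"] by (auto simp: N_def)
    moreover have "i - 1 \<notin> D" using that imageI[of "i - 1" D "(+) 1"] by (auto simp: N_def)
    ultimately show ?thesis using eq pk_cong[of \<pi> i \<pi>'] by simp
  qed
  have "\<bar>real (peaks n \<pi>) - real (peaks n \<pi>')\<bar> = \<bar>\<Sum>i\<in>{2..<n}. pk i \<pi> - pk i \<pi>'\<bar>"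
    by (simp add: peaks_eq_sum sum_subtractf)
  also have "(\<Sum>i\<in>{2..<n}. pk i \<pi> - pk i \<pi>') = (\<Sum>i\<in>{2..<n} \<inter> N. pk i \<pi> - pk i \<pi>')"
    using 0 by (intro sum.mono_neutral_right) auto
  also have "\<bar>\<dots>\<bar> \<le> (\<Sum>i\<in>{2..<n} \<inter> N. \<bar>pk i \<pi> - pk i \<pi>'\<bar>)" by (rule sum_abs)
  also have "\<dots> \<le> (\<Sum>i\<in>{2..<n} \<inter> N. 1)" by (intro sum_mono pk_bounds)
  also have "\<dots> = real (card ({2..<n} \<inter> N))" by simp
  also have "\<dots> \<le> real (card N)" using fN by (simp add: card_mono)
  also have "\<dots> \<le> 3 * real (card D)" using cN by linarith
  finally show ?thesis .
qed

lemma cj_eq_outside: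
  assumes "\<tau> permutes A" "\<pi> permutes B"
    and "x \<notin> {y. \<tau> y \<noteq> y} \<union> inv \<pi> ` {y. \<tau> y \<noteq> y}"
  shows "cj \<tau> \<pi> x = \<pi> x"
proof -
  have "inv \<tau> x = x" using assms(1,3) by (metis (mono_tags) UnI1 mem_Collect_eq permutes_inverses(2))
  moreover have "\<tau> (\<pi> x) = \<pi> x"
    using assms(2,3) by (metis (mono_tags) UnI2 image_eqI mem_Collect_eq permutes_inverses(2))
  ultimately show ?thesis by (simp add: cj_def)
qed

text \<open>Values can change only on the support of \<open>\<tau>\<close> and on its preimage under
  \<open>\<pi>\<close>; each changed value affects three peak indicators.\<close>

lemma peaks_cj_diff_le:
  assumes "\<tau> permutes A" "\<pi> permutes B" "finite {x. \<tau> x \<noteq> x}"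
  shows "\<bar>real (peaks n (cj \<tau> \<pi>)) - real (peaks n \<pi>)\<bar> \<le> 6 * real (card {x. \<tau> x \<noteq> x})"
proof -
  let ?S = "{x. \<tau> x \<noteq> x}"
  have "\<bar>real (peaks n (cj \<tau> \<pi>)) - real (peaks n \<pi>)\<bar> \<le> 3 * real (card (?S \<union> inv \<pi> ` ?S))"
    using assms by (intro peaks_diff_le cj_eq_outside) auto
  also have "card (?S \<union> inv \<pi> ` ?S) \<le> 2 * card ?S"
    using card_Un_le[of ?S "inv \<pi> ` ?S"] card_image_le[OF assms(3), of "inv \<pi>"] by linarith
  finally show ?thesis by simp
qed

definition agree :: "nat set \<Rightarrow> (nat \<Rightarrow> nat) \<Rightarrow> (nat \<Rightarrow> nat) \<Rightarrow> real" where
  "agree J w \<pi> = of_bool (\<forall>x\<in>J. \<pi> x = w x)"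

lemma agree_bounds: "0 \<le> agree J w \<pi>" "agree J w \<pi> \<le> 1"
  by (auto simp: agree_def)

context random_conjugate
begin

abbreviation pks :: "(nat \<Rightarrow> nat) \<Rightarrow> real" where
  "pks \<pi> \<equiv> real (peaks n \<pi>)"

text \<open>Fubini: for fixed \<open>\<pi>\<close> the inner average over \<open>\<rho>\<close> is
  the constant \<open>EE h\<close>. An independent conjugation thus decouples \<open>h\<close> from
  \<open>g\<close>, and the tilted expectations below are compared with this product.\<close>

lemma mean_EE_cj:
  "unif_expect (perms n) (\<lambda>\<rho>. EE (\<lambda>\<pi>. h (cj \<rho> \<pi>) * g \<pi>)) = EE h * EE g"
proof -
  have "unif_expect (perms n) (\<lambda>\<rho>. EE (\<lambda>\<pi>. h (cj \<rho> \<pi>) * g \<pi>))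
    = EE (\<lambda>\<pi>. unif_expect (perms n) (\<lambda>\<rho>. h (cj \<rho> \<pi>)) * g \<pi>)"
    by (simp add: unif_expect_def EE_sum EE_divide sum_distrib_right)
  also have "\<dots> = EE (\<lambda>\<pi>. EE h * g \<pi>)" by (intro EE_cong) (simp add: mean_cj)
  finally show ?thesis by (simp add: EE_cmult)
qed

lemma mean_perms_mono:
  "(\<And>\<rho>. \<rho> \<in> perms n \<Longrightarrow> f \<rho> \<le> g \<rho>) \<Longrightarrow> unif_expect (perms n) f \<le> unif_expect (perms n) g"
  unfolding unif_expect_def by (intro divide_right_mono sum_mono) auto

lemma mean_perms_const: "unif_expect (perms n) (\<lambda>_. c) = c"
  unfolding unif_expect_def using card_perms_pos by simp

lemma mean_perms_abs: "\<bar>unif_expect (perms n) f\<bar> \<le> unif_expect (perms n) (\<lambda>\<rho>. \<bar>f \<rho>\<bar>)"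
  unfolding unif_expect_def by (simp add: divide_right_mono)

text \<open>Agreement with \<open>w\<close> on \<open>J\<close> involves \<open>inv \<rho>\<close>
  only on \<open>J\<close> and on the prescribed values, at most \<open>2 * card J\<close> points.
  The extension doubles this to a support of \<open>4 * card J\<close>, and
  \<open>peaks_cj_diff_le\<close> contributes the factor 6 in 24.\<close>

lemma agree_conjugator:
  assumes \<rho>: "\<rho> \<in> perms n" and J: "finite J"
  obtains \<tau> where "\<tau> \<in> perms n" "finite {x. \<tau> x \<noteq> x}" "card {x. \<tau> x \<noteq> x} \<le> 4 * card J"
    "\<And>\<pi>. agree J w (cj \<tau> \<pi>) = agree J w (cj \<rho> \<pi>)"
    "\<And>\<pi>. \<pi> \<in> Cl \<Longrightarrow> \<bar>pks (cj \<tau> \<pi>) - pks \<pi>\<bar> \<le> 24 * real (card J)"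
proof -
  define L where "L = J \<union> w ` J"
  have L: "finite L" "card L \<le> 2 * card J"
    using J card_Un_le[of J "w ` J"] card_image_le[OF J, of w] by (auto simp: L_def)
  obtain \<tau> where \<tau>: "\<tau> \<in> perms n" "\<And>x. x \<in> L \<Longrightarrow> inv \<tau> x = inv \<rho> x"
    "finite {x. \<tau> x \<noteq> x}" "card {x. \<tau> x \<noteq> x} \<le> 2 * card L"
    by (rule small_support_conjugator[OF permsD[OF \<rho>] L(1)]) (auto simp: perms_def)
  have c: "card {x. \<tau> x \<noteq> x} \<le> 4 * card J" using \<tau>(4) L(2) by linarith
  have "agree J w (cj \<tau> \<pi>) = agree J w (cj \<rho> \<pi>)" for \<pi>
    using \<tau>(2) by (auto simp: agree_def cj_eq_iff[OF permsD[OF \<tau>(1)]] cj_eq_iff[OF permsD[OF \<rho>]] L_def)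
  moreover have "\<bar>pks (cj \<tau> \<pi>) - pks \<pi>\<bar> \<le> 24 * real (card J)" if "\<pi> \<in> Cl" for \<pi>
    using peaks_cj_diff_le[OF permsD[OF \<tau>(1)] permsD[OF Cl_perms[OF that]] \<tau>(3), of n] c by linarith
  ultimately show ?thesis using that \<tau> c by blast
qed

definition tilt :: "real \<Rightarrow> (nat \<Rightarrow> nat) \<Rightarrow> real" where
  "tilt t \<pi> = exp (- t * pks \<pi>)"

lemma tilt_pos: "tilt t \<pi> > 0"
  by (simp add: tilt_def)

lemma EE_tilt_pos: "EE (tilt t) > 0"
  by (intro EE_pos tilt_pos)

lemma tilt_cj_eq: "tilt t (cj \<tau> \<pi>) = tilt t \<pi> * exp (- t * (pks (cj \<tau> \<pi>) - pks \<pi>))"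
  by (simp add: tilt_def flip: exp_add) (simp add: algebra_simps)

text \<open>For each \<open>\<rho>\<close>, invariance under the bounded conjugator
  \<open>\<tau>\<close> lets the expectation be computed at \<open>cj \<tau> \<pi>\<close>. There
  the event may be read at \<open>cj \<rho> \<pi>\<close>, while the tilt changes by a factor of at
  most \<open>exp (24 * card J * t)\<close> in either direction. Averaging over
  \<open>\<rho>\<close> decouples event and tilt.\<close>

lemma agree_tilt:
  assumes J: "finite J" and t: "(t :: real) \<ge> 0"
  shows "EE (\<lambda>\<pi>. agree J w \<pi> * tilt t \<pi>) \<le> exp (24 * real (card J) * t) * (EE (agree J w) * EE (tilt t))"
    and "exp (- 24 * real (card J) * t) * (EE (agree J w) * EE (tilt t)) \<le> EE (\<lambda>\<pi>. agree J w \<pi> * tilt t \<pi>)"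
proof -
  let ?k = "24 * real (card J)"
  let ?T = "EE (\<lambda>\<pi>. agree J w \<pi> * tilt t \<pi>)"
  let ?S = "\<lambda>\<rho>. EE (\<lambda>\<pi>. agree J w (cj \<rho> \<pi>) * tilt t \<pi>)"
  have main: "?T \<le> exp (?k * t) * ?S \<rho> \<and> exp (- ?k * t) * ?S \<rho> \<le> ?T"
    if \<rho>: "\<rho> \<in> perms n" for \<rho>
  proof -
    obtain \<tau> where \<tau>: "\<tau> \<in> perms n"
      "\<And>\<pi>. agree J w (cj \<tau> \<pi>) = agree J w (cj \<rho> \<pi>)"
      "\<And>\<pi>. \<pi> \<in> Cl \<Longrightarrow> \<bar>pks (cj \<tau> \<pi>) - pks \<pi>\<bar> \<le> ?k"
      by (rule agree_conjugator[OF \<rho> J, of w]) blast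
    have T: "?T = EE (\<lambda>\<pi>. agree J w (cj \<rho> \<pi>) * tilt t \<pi> * exp (- t * (pks (cj \<tau> \<pi>) - pks \<pi>)))"
      unfolding EE_cj[OF \<tau>(1), of "\<lambda>\<pi>. agree J w \<pi> * tilt t \<pi>", symmetric]
      by (simp add: \<tau>(2) tilt_cj_eq mult.assoc)
    have b: "- t * (pks (cj \<tau> \<pi>) - pks \<pi>) \<le> ?k * t \<and> - ?k * t \<le> - t * (pks (cj \<tau> \<pi>) - pks \<pi>)"
      if "\<pi> \<in> Cl" for \<pi>
    proof -
      have "\<bar>t * (pks (cj \<tau> \<pi>) - pks \<pi>)\<bar> \<le> t * ?k"
        unfolding abs_mult using t \<tau>(3)[OF that] by (simp add: mult_left_mono)
      thus ?thesis by (simp add: abs_le_iff algebra_simps)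
    qed
    have "?T \<le> EE (\<lambda>\<pi>. agree J w (cj \<rho> \<pi>) * tilt t \<pi> * exp (?k * t))"
      unfolding T using b agree_bounds tilt_pos
      by (intro EE_mono mult_left_mono) (auto intro!: mult_nonneg_nonneg less_imp_le[OF tilt_pos])
    moreover have "EE (\<lambda>\<pi>. agree J w (cj \<rho> \<pi>) * tilt t \<pi> * exp (- ?k * t)) \<le> ?T"
      unfolding T using b agree_bounds tilt_pos
      by (intro EE_mono mult_left_mono) (auto intro!: mult_nonneg_nonneg less_imp_le[OF tilt_pos])
    ultimately show ?thesis by (simp add: EE_multc mult.commute)
  qed
  have s: "unif_expect (perms n) (\<lambda>\<rho>. c * ?S \<rho>) = c * (EE (agree J w) * EE (tilt t))" for c
    using mean_EE_cj[of "agree J w" "tilt t"]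
    by (simp add: unif_expect_def sum_distrib_left[symmetric] times_divide_eq_right[symmetric] del: times_divide_eq_right)
  show "?T \<le> exp (?k * t) * (EE (agree J w) * EE (tilt t))"
    using mean_perms_mono[of "\<lambda>_. ?T" "\<lambda>\<rho>. exp (?k * t) * ?S \<rho>"] main
    by (simp add: mean_perms_const s)
  show "exp (- 24 * real (card J) * t) * (EE (agree J w) * EE (tilt t)) \<le> ?T"
    using mean_perms_mono[of "\<lambda>\<rho>. exp (- ?k * t) * ?S \<rho>" "\<lambda>_. ?T"] main
    by (simp add: mean_perms_const s)
qed

lemma agree_tilt_diff:
  assumes J: "finite J" and t: "(t :: real) \<ge> 0" and K: "real (card J) \<le> K"
  shows "\<bar>EE (\<lambda>\<pi>. agree J w \<pi> * tilt t \<pi>) - EE (agree J w) * EE (tilt t)\<bar>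
    \<le> (exp (24 * K * t) - 1) * (EE (agree J w) * EE (tilt t))"
proof -
  let ?P = "EE (agree J w) * EE (tilt t)"
  have P: "?P \<ge> 0" using EE_tilt_pos agree_bounds by (intro mult_nonneg_nonneg EE_nonneg) (auto intro: less_imp_le[OF tilt_pos])
  have e: "exp (24 * real (card J) * t) \<le> exp (24 * K * t)" using K t by (simp add: mult_right_mono)
  \<comment> \<open>Gives \<open>2 - exp x \<le> exp (- x)\<close>, which puts the lower bound into
    the same form as the upper one.\<close>
  have "exp x + exp (-x) \<ge> 2" for x :: real
    using exp_ge_add_one_self[of x] exp_ge_add_one_self[of "-x"] by linarith
  hence "2 - exp (24 * real (card J) * t) \<le> exp (- 24 * real (card J) * t)"
    by (smt (verit, best) minus_mult_left)
  hence "(2 - exp (24 * K * t)) * ?P \<le> exp (- 24 * real (card J) * t) * ?P"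
    using e P by (intro mult_right_mono) linarith+
  moreover have "exp (24 * real (card J) * t) * ?P \<le> exp (24 * K * t) * ?P"
    using e P by (intro mult_right_mono)
  ultimately show ?thesis using agree_tilt[OF J t, of w] by (simp add: algebra_simps abs_le_iff)
qed

end

lemma exp_remainder_bound:
  fixes y c :: real
  assumes "\<bar>y\<bar> \<le> c"
  shows "\<bar>exp y - 1 - y\<bar> \<le> c^2 * exp c"
proof (cases "y = 0")
  case True thus ?thesis by simp
next
  case False
  obtain z where z: "\<bar>z\<bar> \<le> \<bar>y\<bar>" "exp y = (\<Sum>m<2. y ^ m / fact m) + exp z / fact 2 * y ^ 2"
    using Maclaurin_exp_le[of y 2] by blast
  have "exp y - 1 - y = exp z / 2 * y^2" using z(2) by (simp add: numeral_2_eq_2)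
  moreover have "exp z / 2 * y^2 \<ge> 0" by simp
  ultimately have "\<bar>exp y - 1 - y\<bar> = exp z / 2 * y^2" by linarith
  also have "\<dots> \<le> exp c * c^2"
  proof (intro mult_mono)
    have "exp z \<le> exp c" using z(1) assms by simp
    thus "exp z / 2 \<le> exp c" using exp_gt_zero[of z] by linarith
    show "y^2 \<le> c^2" using assms by (metis abs_ge_zero order_trans power2_abs power_mono)
  qed auto
  finally show ?thesis by (simp add: mult.commute)
qed

lemma exp_minus_one_bound: "exp x - 1 \<le> x * exp x" for x :: real
proof -
  have "1 - x \<le> exp (-x)" using exp_ge_add_one_self[of "-x"] by simp
  hence "(1 - x) * exp x \<le> exp (-x) * exp x" by (intro mult_right_mono) auto
  thus ?thesis by (simp add: algebra_simps flip: exp_add)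
qed

section \<open>Functions determined by the values on a random set of positions\<close>

context random_conjugate
begin

text \<open>Analogue of a stopping time: the values of \<open>\<pi>\<close> on
  \<open>B \<pi>\<close> already reveal the set \<open>B \<pi>\<close>. In the same spirit,
  \<open>measurable_wrt\<close> says that they reveal \<open>k \<pi>\<close>.\<close>

definition stopping :: "((nat \<Rightarrow> nat) \<Rightarrow> nat set) \<Rightarrow> bool" where
  "stopping B \<longleftrightarrow> (\<forall>\<pi>\<in>Cl. \<forall>\<pi>'\<in>Cl. (\<forall>x\<in>B \<pi>. \<pi>' x = \<pi> x) \<longrightarrow> B \<pi>' = B \<pi>)"

definition measurable_wrt :: "((nat \<Rightarrow> nat) \<Rightarrow> nat set) \<Rightarrow> ((nat \<Rightarrow> nat) \<Rightarrow> real) \<Rightarrow> bool" where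
  "measurable_wrt B k \<longleftrightarrow> (\<forall>\<pi>\<in>Cl. \<forall>\<pi>'\<in>Cl. (\<forall>x\<in>B \<pi>. \<pi>' x = \<pi> x) \<longrightarrow> k \<pi>' = k \<pi>)"

text \<open>The stopping property makes "agrees with \<open>\<pi>\<close> on \<open>B \<pi>\<close>"
  an equivalence relation on \<open>Cl\<close>. \<open>R\<close> holds one representative of each
  class, so exactly one summand survives.\<close>

lemma stopping_decomposition:
  assumes B: "stopping B"
  obtains R where "finite R" "R \<subseteq> Cl"
    "\<And>k \<pi>. measurable_wrt B k \<Longrightarrow> \<pi> \<in> Cl \<Longrightarrow> (\<Sum>r\<in>R. k r * agree (B r) r \<pi>) = k \<pi>"
proof -
  define cls where "cls \<pi> = {\<pi>'\<in>Cl. \<forall>x\<in>B \<pi>. \<pi>' x = \<pi> x}" for \<pi>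
  define rep where "rep c = (SOME r. r \<in> Cl \<and> cls r = c)" for c
  define R where "R = rep ` cls ` Cl"
  have rep: "rep (cls \<pi>) \<in> Cl \<and> cls (rep (cls \<pi>)) = cls \<pi>" if "\<pi> \<in> Cl" for \<pi>
    unfolding rep_def by (rule someI[where x = \<pi>]) (use that in auto)
  have cls_eq: "cls \<pi>' = cls \<pi>" if "\<pi> \<in> Cl" "\<pi>' \<in> Cl" "\<pi>' \<in> cls \<pi>" for \<pi> \<pi>'
  proof -
    have "B \<pi>' = B \<pi>" using B that unfolding stopping_def cls_def by blast
    thus ?thesis using that unfolding cls_def by auto
  qed
  have self: "\<pi> \<in> cls \<pi>" if "\<pi> \<in> Cl" for \<pi> using that by (simp add: cls_def)
  have R: "finite R" "R \<subseteq> Cl" using finite_Cl rep by (auto simp: R_def)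
  have dec: "(\<Sum>r\<in>R. k r * agree (B r) r \<pi>) = k \<pi>" if k: "measurable_wrt B k" and \<pi>: "\<pi> \<in> Cl" for k \<pi>
  proof -
    let ?r = "rep (cls \<pi>)"
    have r: "?r \<in> R" "?r \<in> Cl" "cls ?r = cls \<pi>" using rep \<pi> by (auto simp: R_def)
    have in_r: "\<pi> \<in> cls ?r" using r self[OF \<pi>] by simp
    have "agree (B r) r \<pi> = 0" if rR: "r \<in> R - {?r}" for r
    proof -
      obtain \<sigma> where \<sigma>: "\<sigma> \<in> Cl" "r = rep (cls \<sigma>)" using rR by (auto simp: R_def)
      have rC: "r \<in> Cl" "cls r = cls \<sigma>" using rep \<sigma> by auto
      have "\<pi> \<notin> cls r"
      proof
        assume "\<pi> \<in> cls r"
        hence "cls \<pi> = cls r" using cls_eq rC \<pi> by blast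
        thus False using rR \<sigma> rC by auto
      qed
      thus ?thesis using \<pi> by (auto simp: cls_def agree_def)
    qed
    hence "(\<Sum>r\<in>R. k r * agree (B r) r \<pi>) = (\<Sum>r\<in>{?r}. k r * agree (B r) r \<pi>)"
      using R r by (intro sum.mono_neutral_right) auto
    also have "\<dots> = k ?r" using in_r by (simp add: cls_def agree_def)
    also have "\<dots> = k \<pi>"
    proof -
      have "\<forall>x\<in>B ?r. \<pi> x = ?r x" using in_r by (simp add: cls_def)
      thus ?thesis using k r(2) \<pi> unfolding measurable_wrt_def by metis
    qed
    finally show ?thesis .
  qed
  show ?thesis by (rule that[OF R dec])
qed

text \<open>The bound of \<open>agree_tilt_diff\<close> is proportional to the probability of the
  event. Summed over the atoms of the stopping decomposition, with weights given by the absolute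
  value of \<open>k\<close>, these probabilities reassemble to the mean of that absolute
  value.\<close>

lemma local_tilt:
  assumes B: "stopping B" and k: "measurable_wrt B k"
    and K: "\<And>\<pi>. \<pi> \<in> Cl \<Longrightarrow> finite (B \<pi>) \<and> real (card (B \<pi>)) \<le> K" and t: "(t::real) \<ge> 0"
  shows "\<bar>EE (\<lambda>\<pi>. k \<pi> * tilt t \<pi>) - EE k * EE (tilt t)\<bar>
    \<le> (exp (24 * K * t) - 1) * (EE (\<lambda>\<pi>. \<bar>k \<pi>\<bar>) * EE (tilt t))"
proof -
  obtain R where R: "finite R" "R \<subseteq> Cl"
    "\<And>k \<pi>. measurable_wrt B k \<Longrightarrow> \<pi> \<in> Cl \<Longrightarrow> (\<Sum>r\<in>R. k r * agree (B r) r \<pi>) = k \<pi>"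
    by (rule stopping_decomposition[OF B]) blast
  have dec: "EE (\<lambda>\<pi>. f \<pi> * g \<pi>) = (\<Sum>r\<in>R. f r * EE (\<lambda>\<pi>. agree (B r) r \<pi> * g \<pi>))"
    if "measurable_wrt B f" for f g
  proof -
    have "EE (\<lambda>\<pi>. f \<pi> * g \<pi>) = EE (\<lambda>\<pi>. \<Sum>r\<in>R. f r * (agree (B r) r \<pi> * g \<pi>))"
    proof (rule EE_cong)
      fix \<pi> assume "\<pi> \<in> Cl"
      thus "f \<pi> * g \<pi> = (\<Sum>r\<in>R. f r * (agree (B r) r \<pi> * g \<pi>))"
        by (subst R(3)[OF that, symmetric]) (simp_all add: sum_distrib_right mult.assoc)
    qed
    thus ?thesis by (simp add: EE_sum EE_cmult)
  qed
  have ka: "measurable_wrt B (\<lambda>\<pi>. \<bar>k \<pi>\<bar>)" using k unfolding measurable_wrt_def by metis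
  let ?M = "EE (tilt t)"
  have d1: "EE f = (\<Sum>r\<in>R. f r * EE (agree (B r) r))" if "measurable_wrt B f" for f
    using dec[OF that, of "\<lambda>_. 1"] by simp
  have eq: "EE (\<lambda>\<pi>. k \<pi> * tilt t \<pi>) - EE k * ?M
      = (\<Sum>r\<in>R. k r * (EE (\<lambda>\<pi>. agree (B r) r \<pi> * tilt t \<pi>) - EE (agree (B r) r) * ?M))"
    unfolding dec[OF k] d1[OF k] 
    by (simp only: sum_distrib_right sum_subtractf[symmetric] right_diff_distrib mult.assoc)
  have "\<bar>EE (\<lambda>\<pi>. k \<pi> * tilt t \<pi>) - EE k * ?M\<bar> \<le> (\<Sum>r\<in>R. \<bar>k r * (EE (\<lambda>\<pi>. agree (B r) r \<pi> * tilt t \<pi>) - EE (agree (B r) r) * ?M)\<bar>)"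
    unfolding eq by (rule sum_abs)
  also have "\<dots> \<le> (\<Sum>r\<in>R. \<bar>k r\<bar> * ((exp (24 * K * t) - 1) * (EE (agree (B r) r) * ?M)))"
  proof (rule sum_mono)
    fix r assume "r \<in> R"
    hence r: "finite (B r)" "real (card (B r)) \<le> K" using K R(2) by auto
    show "\<bar>k r * (EE (\<lambda>\<pi>. agree (B r) r \<pi> * tilt t \<pi>) - EE (agree (B r) r) * ?M)\<bar>
      \<le> \<bar>k r\<bar> * ((exp (24 * K * t) - 1) * (EE (agree (B r) r) * ?M))"
      unfolding abs_mult by (rule mult_left_mono[OF agree_tilt_diff[OF r(1) t r(2)] abs_ge_zero])
  qed
  also have "\<dots> = (exp (24 * K * t) - 1) * (EE (\<lambda>\<pi>. \<bar>k \<pi>\<bar>) * ?M)"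
    unfolding d1[OF ka] by (simp add: sum_distrib_left sum_distrib_right mult_ac)
  finally show ?thesis .
qed

lemma agree_cj_cong:
  assumes \<tau>: "\<tau> \<in> perms n" and eq: "\<And>x. x \<in> J \<union> {y. \<tau> y \<noteq> y} \<Longrightarrow> \<pi>' x = \<pi> x" and x: "x \<in> J"
  shows "cj \<tau> \<pi>' x = cj \<tau> \<pi> x"
proof -
  have "inv \<tau> x \<in> J \<union> {y. \<tau> y \<noteq> y}"
    using x perms_inverses[OF \<tau>] by (metis (mono_tags) UnI1 UnI2 mem_Collect_eq)
  thus ?thesis using eq by (simp add: cj_def)
qed

text \<open>Positions whose values determine how conjugation by \<open>\<tau>\<close> changes the number of peaks.\<close>

definition reach :: "(nat \<Rightarrow> nat) \<Rightarrow> nat set \<Rightarrow> (nat \<Rightarrow> nat) \<Rightarrow> nat set" where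
  "reach \<tau> J \<pi> = (\<Union>x\<in>J \<union> {y. \<tau> y \<noteq> y} \<union> inv \<pi> ` {y. \<tau> y \<noteq> y}. {x - 2..x + 2})"

text \<open>The centres are \<open>J\<close>, the support of \<open>\<tau>\<close> and its preimage
  under \<open>\<pi>\<close>, together at most \<open>9 * card J\<close> points; each is thickened
  to at most five positions, whence 45. The thickening ensures that a triple meeting the support or
  its preimage lies inside \<open>reach\<close>.\<close>

lemma
  assumes J: "finite J" and \<tau>: "\<tau> \<in> perms n" and S: "finite {y. \<tau> y \<noteq> y}" "card {y. \<tau> y \<noteq> y} \<le> 4 * card J"
  shows reach_stopping: "stopping (reach \<tau> J)"
    and reach_card: "finite (reach \<tau> J \<pi>) \<and> real (card (reach \<tau> J \<pi>)) \<le> 45 * card J"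
    and reach_measurable: "measurable_wrt (reach \<tau> J)
      (\<lambda>\<pi>. agree J w (cj \<tau> \<pi>) * (pks (cj \<tau> \<pi>) - pks \<pi>))"
proof -
  let ?S = "{y. \<tau> y \<noteq> y}"
  have sub: "J \<union> ?S \<union> inv \<pi> ` ?S \<subseteq> reach \<tau> J \<pi>" for \<pi>
    unfolding reach_def by (intro subsetI UN_I) auto
  \<comment> \<open>The preimages of the support belong to \<open>reach\<close>, so agreement there
    forces \<open>\<pi>'\<close> to have the same preimages; this is what makes \<open>reach\<close>
    a stopping set.\<close>
  have invS: "inv \<pi>' ` ?S = inv \<pi> ` ?S"
    if "\<pi> \<in> Cl" "\<pi>' \<in> Cl" "\<forall>x\<in>reach \<tau> J \<pi>. \<pi>' x = \<pi> x" for \<pi> \<pi>'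
  proof (rule image_cong[OF refl])
    fix y assume y: "y \<in> ?S"
    hence "\<pi>' (inv \<pi> y) = \<pi> (inv \<pi> y)" using that(3) sub[of \<pi>] by blast
    hence "\<pi>' (inv \<pi> y) = y" using perms_inverses[OF Cl_perms[OF that(1)]] by simp
    thus "inv \<pi>' y = inv \<pi> y" using perms_inverses(2)[OF Cl_perms[OF that(2)], of "inv \<pi> y"] by simp
  qed
  show "stopping (reach \<tau> J)"
    unfolding stopping_def
  proof (intro ballI impI)
    fix \<pi> \<pi>' assume a: "\<pi> \<in> Cl" "\<pi>' \<in> Cl" "\<forall>x\<in>reach \<tau> J \<pi>. \<pi>' x = \<pi> x"
    show "reach \<tau> J \<pi>' = reach \<tau> J \<pi>" unfolding reach_def invS[OF a] ..
  qed
  show "finite (reach \<tau> J \<pi>) \<and> real (card (reach \<tau> J \<pi>)) \<le> 45 * card J"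
  proof -
    let ?D = "J \<union> ?S \<union> inv \<pi> ` ?S"
    have fD: "finite ?D" using J S by simp
    have "card ?D \<le> card J + card ?S + card (inv \<pi> ` ?S)"
      by (meson add_le_mono1 card_Un_le le_trans)
    hence "card ?D \<le> 9 * card J" using S card_image_le[OF S(1), of "inv \<pi>"] by linarith
    have "card (reach \<tau> J \<pi>) \<le> (\<Sum>x\<in>?D. card {x - 2..x + 2})"
      unfolding reach_def by (rule card_UN_le[OF fD])
    also have "\<dots> \<le> (\<Sum>x\<in>?D. 5)" by (intro sum_mono) simp
    also have "\<dots> \<le> 45 * card J" using \<open>card ?D \<le> 9 * card J\<close> by simp
    finally have "card (reach \<tau> J \<pi>) \<le> 45 * card J" .
    moreover have "finite (reach \<tau> J \<pi>)" unfolding reach_def using fD by simp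
    ultimately show ?thesis by simp
  qed
  show "measurable_wrt (reach \<tau> J) (\<lambda>\<pi>. agree J w (cj \<tau> \<pi>) * (pks (cj \<tau> \<pi>) - pks \<pi>))"
    unfolding measurable_wrt_def
  proof (intro ballI impI)
    fix \<pi> \<pi>' assume \<pi>: "\<pi> \<in> Cl" "\<pi>' \<in> Cl" and eq: "\<forall>x\<in>reach \<tau> J \<pi>. \<pi>' x = \<pi> x"
    have 1: "agree J w (cj \<tau> \<pi>') = agree J w (cj \<tau> \<pi>)"
    proof -
      have "cj \<tau> \<pi>' x = cj \<tau> \<pi> x" if "x \<in> J" for x
        by (rule agree_cj_cong[OF \<tau> _ that]) (use eq sub[of \<pi>] in blast)
      thus ?thesis by (simp add: agree_def)
    qed
    \<comment> \<open>A triple that avoids the support and its preimage contributes 0 to both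
      differences; any other triple is contained in \<open>reach\<close>.\<close>
    have "pk i (cj \<tau> \<pi>') - pk i \<pi>' = pk i (cj \<tau> \<pi>) - pk i \<pi>" if i: "i \<in> {2..<n}" for i
    proof (cases "{i - 1, i, i + 1} \<inter> (?S \<union> inv \<pi> ` ?S) = {}")
      case True
      have a: "cj \<tau> \<pi> x = \<pi> x" "cj \<tau> \<pi>' x = \<pi>' x" if "x \<in> {i - 1, i, i + 1}" for x
      proof -
        have x: "x \<notin> ?S \<union> inv \<pi> ` ?S" using True that by blast
        show "cj \<tau> \<pi> x = \<pi> x"
          by (rule cj_eq_outside[OF permsD[OF \<tau>] permsD[OF Cl_perms[OF \<pi>(1)]] x])
        show "cj \<tau> \<pi>' x = \<pi>' x"
          by (rule cj_eq_outside[OF permsD[OF \<tau>] permsD[OF Cl_perms[OF \<pi>(2)]]])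
            (use x invS[OF \<pi> eq] in simp)
      qed
      show ?thesis
        using pk_cong[of "cj \<tau> \<pi>" i \<pi>] pk_cong[of "cj \<tau> \<pi>'" i \<pi>'] a by simp
    next
      case False
      then obtain x where x: "x \<in> ?S \<union> inv \<pi> ` ?S" "x \<in> {i - 1, i, i + 1}" by blast
      have "{i - 1, i, i + 1} \<subseteq> {x - 2..x + 2}" using x(2) by auto
      hence T: "{i - 1, i, i + 1} \<subseteq> reach \<tau> J \<pi>" unfolding reach_def using x(1) by blast
      have "cj \<tau> \<pi>' y = cj \<tau> \<pi> y" if "y \<in> {i - 1, i, i + 1}" for y
        by (rule agree_cj_cong[OF \<tau> _ that]) (use eq sub[of \<pi>] T in blast)
      moreover have "\<pi>' y = \<pi> y" if "y \<in> {i - 1, i, i + 1}" for y using eq T that by blast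
      ultimately show ?thesis
        using pk_cong[of "cj \<tau> \<pi>'" i "cj \<tau> \<pi>"] pk_cong[of \<pi>' i \<pi>] by simp
    qed
    hence "pks (cj \<tau> \<pi>') - pks \<pi>' = pks (cj \<tau> \<pi>) - pks \<pi>"
      by (simp add: peaks_eq_sum sum_subtractf[symmetric])
    thus "agree J w (cj \<tau> \<pi>') * (pks (cj \<tau> \<pi>') - pks \<pi>') = agree J w (cj \<tau> \<pi>) * (pks (cj \<tau> \<pi>) - pks \<pi>)"
      using 1 by simp
  qed
qed

end

text \<open>The bound of \<open>agree_tilt_expansion\<close> for sets of at most three positions.\<close>

definition tilt_const :: "real \<Rightarrow> real" where
  "tilt_const t = 5184 * exp (72 * t) + 233280 * exp (3240 * t)"

section \<open>Second-order expansion of tilted expectations\<close>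

context random_conjugate
begin

lemma mean_perms_add:
  "unif_expect (perms n) (\<lambda>\<rho>. f \<rho> + g \<rho>) = unif_expect (perms n) f + unif_expect (perms n) g"
  by (simp add: unif_expect_def sum.distrib add_divide_distrib)

lemma mean_perms_cmult: "unif_expect (perms n) (\<lambda>\<rho>. c * f \<rho>) = c * unif_expect (perms n) f"
  by (simp add: unif_expect_def sum_distrib_left)

text \<open>As in \<open>agree_tilt\<close>, but with \<open>exp (- t * \<Delta> \<pi>)\<close>
  expanded to first order, where \<open>\<Delta>\<close> is the change of the number of peaks under
  \<open>\<tau>\<close>. The first-order term is determined by \<open>reach\<close>, so
  \<open>local_tilt\<close> pulls the tilt out of it at relative cost \<open>O(t)\<close>. What
  remains, the mean of event times \<open>\<Delta>\<close>, is exactly the difference of two means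
  of event times \<open>pks\<close>, and averaging over \<open>\<rho>\<close> turns it into the
  covariance of \<open>agree J w\<close> with \<open>pks\<close>.\<close>

lemma agree_tilt_expansion:
  fixes t :: real
  assumes J: "finite J" and t: "t \<ge> 0"
  defines "c \<equiv> 24 * real (card J)" and "K \<equiv> 45 * real (card J)"
  shows "\<bar>EE (\<lambda>\<pi>. agree J w \<pi> * tilt t \<pi>) - EE (agree J w) * EE (tilt t)
      + t * (EE (\<lambda>\<pi>. agree J w \<pi> * pks \<pi>) - EE (agree J w) * EE pks) * EE (tilt t)\<bar>
    \<le> (c^2 * exp (c * t) + 24 * K * c * exp (24 * K * t)) * t^2 * (EE (agree J w) * EE (tilt t))"
proof -
  let ?M = "EE (tilt t)"
  let ?P = "\<lambda>\<rho> \<pi>. agree J w (cj \<rho> \<pi>)"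
  let ?A = "EE (\<lambda>\<pi>. agree J w \<pi> * tilt t \<pi>)"
  let ?B = "EE (\<lambda>\<pi>. agree J w \<pi> * pks \<pi>)"
  \<comment> \<open>Averaged over \<open>\<rho>\<close>, \<open>a\<close> becomes the expression to
    be bounded and \<open>b\<close> its bound. For a single \<open>\<rho>\<close> the inequality can
    use the \<open>\<tau>\<close> belonging to it.\<close>
  define a where "a \<rho> = (?A + t * ?M * ?B) + (- 1) * EE (\<lambda>\<pi>. ?P \<rho> \<pi> * tilt t \<pi>)
    + (- t * ?M) * EE (\<lambda>\<pi>. ?P \<rho> \<pi> * pks \<pi>)" for \<rho>
  define b where "b \<rho> = (c^2 * exp (c * t) * t^2) * EE (\<lambda>\<pi>. ?P \<rho> \<pi> * tilt t \<pi>)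
    + (24 * K * c * exp (24 * K * t) * t^2 * ?M) * EE (\<lambda>\<pi>. ?P \<rho> \<pi> * 1)" for \<rho>
  have cK: "c \<ge> 0" "K \<ge> 0" by (auto simp: c_def K_def)
  have ab: "\<bar>a \<rho>\<bar> \<le> b \<rho>" if \<rho>: "\<rho> \<in> perms n" for \<rho>
  proof -
    obtain \<tau> where \<tau>: "\<tau> \<in> perms n" "finite {x. \<tau> x \<noteq> x}" "card {x. \<tau> x \<noteq> x} \<le> 4 * card J"
      "\<And>\<pi>. agree J w (cj \<tau> \<pi>) = agree J w (cj \<rho> \<pi>)"
      "\<And>\<pi>. \<pi> \<in> Cl \<Longrightarrow> \<bar>pks (cj \<tau> \<pi>) - pks \<pi>\<bar> \<le> c"
      unfolding c_def by (rule agree_conjugator[OF \<rho> J, of w]) blast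
    define \<Delta> where "\<Delta> \<pi> = pks (cj \<tau> \<pi>) - pks \<pi>" for \<pi>
    have \<Delta>: "\<bar>\<Delta> \<pi>\<bar> \<le> c" if "\<pi> \<in> Cl" for \<pi> using \<tau>(5)[OF that] by (simp add: \<Delta>_def)
    have A: "?A = EE (\<lambda>\<pi>. ?P \<rho> \<pi> * tilt t \<pi> * exp (- t * \<Delta> \<pi>))"
      unfolding EE_cj[OF \<tau>(1), of "\<lambda>\<pi>. agree J w \<pi> * tilt t \<pi>", symmetric]
      by (simp add: \<tau>(4) tilt_cj_eq mult.assoc \<Delta>_def)
    have B: "?B = EE (\<lambda>\<pi>. ?P \<rho> \<pi> * pks \<pi>) + EE (\<lambda>\<pi>. ?P \<rho> \<pi> * \<Delta> \<pi>)"
      unfolding EE_cj[OF \<tau>(1), of "\<lambda>\<pi>. agree J w \<pi> * pks \<pi>", symmetric] EE_add[symmetric]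
      by (simp add: \<tau>(4) \<Delta>_def algebra_simps)
    have "a \<rho> = (?A - EE (\<lambda>\<pi>. ?P \<rho> \<pi> * tilt t \<pi>)) + t * ?M * EE (\<lambda>\<pi>. ?P \<rho> \<pi> * \<Delta> \<pi>)"
      unfolding a_def B by (simp add: algebra_simps)
    also have "?A - EE (\<lambda>\<pi>. ?P \<rho> \<pi> * tilt t \<pi>)
      = EE (\<lambda>\<pi>. ?P \<rho> \<pi> * tilt t \<pi> * (exp (- t * \<Delta> \<pi>) - 1 - (- t * \<Delta> \<pi>)))
        + (- t) * EE (\<lambda>\<pi>. ?P \<rho> \<pi> * \<Delta> \<pi> * tilt t \<pi>)"
      unfolding A EE_diff[symmetric] EE_cmult[symmetric] EE_add[symmetric]
      by (intro EE_cong) (simp add: algebra_simps)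
    finally have a: "a \<rho> = EE (\<lambda>\<pi>. ?P \<rho> \<pi> * tilt t \<pi> * (exp (- t * \<Delta> \<pi>) - 1 - (- t * \<Delta> \<pi>)))
        - t * (EE (\<lambda>\<pi>. ?P \<rho> \<pi> * \<Delta> \<pi> * tilt t \<pi>) - EE (\<lambda>\<pi>. ?P \<rho> \<pi> * \<Delta> \<pi>) * ?M)"
      by (simp add: algebra_simps)
    have 1: "\<bar>EE (\<lambda>\<pi>. ?P \<rho> \<pi> * tilt t \<pi> * (exp (- t * \<Delta> \<pi>) - 1 - (- t * \<Delta> \<pi>)))\<bar>
      \<le> EE (\<lambda>\<pi>. (c^2 * exp (c * t) * t^2) * (?P \<rho> \<pi> * tilt t \<pi>))"
    proof (rule EE_abs_le)
      fix \<pi> assume "\<pi> \<in> Cl"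
      hence "\<bar>- t * \<Delta> \<pi>\<bar> \<le> c * t" 
        using mult_left_mono[OF \<Delta> t, of \<pi>] t by (simp add: abs_mult mult.commute)
      hence "\<bar>exp (- t * \<Delta> \<pi>) - 1 - (- t * \<Delta> \<pi>)\<bar> \<le> (c * t)^2 * exp (c * t)"
        by (rule exp_remainder_bound)
      moreover have "?P \<rho> \<pi> * tilt t \<pi> \<ge> 0"
        using agree_bounds tilt_pos by (simp add: less_imp_le)
      ultimately have "(?P \<rho> \<pi> * tilt t \<pi>) * \<bar>exp (- t * \<Delta> \<pi>) - 1 - (- t * \<Delta> \<pi>)\<bar>
        \<le> (?P \<rho> \<pi> * tilt t \<pi>) * ((c * t)^2 * exp (c * t))" by (rule mult_left_mono)
      thus "\<bar>?P \<rho> \<pi> * tilt t \<pi> * (exp (- t * \<Delta> \<pi>) - 1 - (- t * \<Delta> \<pi>))\<bar>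
        \<le> (c^2 * exp (c * t) * t^2) * (?P \<rho> \<pi> * tilt t \<pi>)"
        unfolding abs_mult[of "?P \<rho> \<pi> * tilt t \<pi>"] abs_of_nonneg[OF \<open>?P \<rho> \<pi> * tilt t \<pi> \<ge> 0\<close>]
        by (simp add: power_mult_distrib mult_ac)
    qed
    have m: "measurable_wrt (reach \<tau> J) (\<lambda>\<pi>. ?P \<rho> \<pi> * \<Delta> \<pi>)"
      using reach_measurable[OF J \<tau>(1-3), of w] by (simp add: \<tau>(4) \<Delta>_def)
    have "\<bar>EE (\<lambda>\<pi>. ?P \<rho> \<pi> * \<Delta> \<pi> * tilt t \<pi>) - EE (\<lambda>\<pi>. ?P \<rho> \<pi> * \<Delta> \<pi>) * ?M\<bar>
      \<le> (exp (24 * K * t) - 1) * (EE (\<lambda>\<pi>. \<bar>?P \<rho> \<pi> * \<Delta> \<pi>\<bar>) * ?M)"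
      by (rule local_tilt[OF reach_stopping[OF J \<tau>(1-3)] m _ t])
        (use reach_card[OF J \<tau>(1-3)] in \<open>simp add: K_def\<close>)
    also have "\<dots> \<le> (24 * K * t * exp (24 * K * t)) * (EE (\<lambda>\<pi>. c * (?P \<rho> \<pi> * 1)) * ?M)"
    proof (intro mult_mono)
      show "exp (24 * K * t) - 1 \<le> 24 * K * t * exp (24 * K * t)" by (rule exp_minus_one_bound)
      show "EE (\<lambda>\<pi>. \<bar>?P \<rho> \<pi> * \<Delta> \<pi>\<bar>) \<le> EE (\<lambda>\<pi>. c * (?P \<rho> \<pi> * 1))"
        by (rule EE_mono) (use \<Delta> agree_bounds in \<open>simp add: abs_mult mult.commute[of c] mult_left_mono\<close>)
    qed (use cK t EE_tilt_pos[of t] in \<open>auto intro!: mult_nonneg_nonneg EE_nonneg agree_bounds less_imp_le[OF tilt_pos]\<close>)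
    finally have 2: "\<bar>EE (\<lambda>\<pi>. ?P \<rho> \<pi> * \<Delta> \<pi> * tilt t \<pi>) - EE (\<lambda>\<pi>. ?P \<rho> \<pi> * \<Delta> \<pi>) * ?M\<bar>
      \<le> (24 * K * t * exp (24 * K * t)) * (c * EE (\<lambda>\<pi>. ?P \<rho> \<pi> * 1) * ?M)"
      unfolding EE_cmult .
    have 3: "\<bar>u - t * v\<bar> \<le> U + t * V" if "\<bar>u\<bar> \<le> U" "\<bar>v\<bar> \<le> V" for u v U V :: real
    proof -
      have "\<bar>t * v\<bar> \<le> t * V" using that(2) t by (simp add: abs_mult mult_left_mono)
      thus ?thesis using that(1) abs_triangle_ineq4[of u "t * v"] by linarith
    qed
    show ?thesis unfolding a b_def using 3[OF 1[unfolded EE_cmult] 2]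
      by (simp add: power2_eq_square mult_ac)
  qed
  have "\<bar>unif_expect (perms n) a\<bar> \<le> unif_expect (perms n) b"
    by (rule order_trans[OF mean_perms_abs mean_perms_mono[OF ab]])
  moreover have "unif_expect (perms n) a = (?A + t * ?M * ?B) + (- 1) * (EE (agree J w) * ?M)
    + (- t * ?M) * (EE (agree J w) * EE pks)"
    unfolding a_def mean_perms_add mean_perms_cmult mean_EE_cj[of "agree J w" "tilt t"]
      mean_EE_cj[of "agree J w" pks] mean_perms_const ..
  moreover have "unif_expect (perms n) b = (c^2 * exp (c * t) * t^2) * (EE (agree J w) * ?M)
    + (24 * K * c * exp (24 * K * t) * t^2 * ?M) * (EE (agree J w) * EE (\<lambda>_. 1))"
    unfolding b_def mean_perms_add mean_perms_cmult mean_EE_cj[of "agree J w" "tilt t"]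
      mean_EE_cj[of "agree J w" "\<lambda>_. 1"] ..
  ultimately show ?thesis by (simp add: EE_const algebra_simps)
qed

lemma pk_tilt_expansion:
  fixes t :: real
  assumes t: "t \<ge> 0"
  shows "\<bar>EE (\<lambda>\<pi>. pk i \<pi> * tilt t \<pi>) - EE (pk i) * EE (tilt t)
      + t * (EE (\<lambda>\<pi>. pk i \<pi> * pks \<pi>) - EE (pk i) * EE pks) * EE (tilt t)\<bar>
    \<le> tilt_const t * t^2 * EE (tilt t)"
proof -
  let ?M = "EE (tilt t)"
  let ?T = "{i - 1, i, i + 1}"
  have st: "stopping (\<lambda>_. ?T)" by (simp add: stopping_def)
  have me: "measurable_wrt (\<lambda>_. ?T) (pk i)" unfolding measurable_wrt_def
    by (intro ballI impI pk_cong) auto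
  obtain R where R: "finite R" "R \<subseteq> Cl"
    "\<And>k \<pi>. measurable_wrt (\<lambda>_. ?T) k \<Longrightarrow> \<pi> \<in> Cl \<Longrightarrow> (\<Sum>r\<in>R. k r * agree ?T r \<pi>) = k \<pi>"
    by (rule stopping_decomposition[OF st]) blast
  have dec: "EE (\<lambda>\<pi>. pk i \<pi> * g \<pi>) = (\<Sum>r\<in>R. pk i r * EE (\<lambda>\<pi>. agree ?T r \<pi> * g \<pi>))" for g
  proof -
    have "EE (\<lambda>\<pi>. pk i \<pi> * g \<pi>) = EE (\<lambda>\<pi>. \<Sum>r\<in>R. pk i r * (agree ?T r \<pi> * g \<pi>))"
    proof (rule EE_cong)
      fix \<pi> assume "\<pi> \<in> Cl"
      thus "pk i \<pi> * g \<pi> = (\<Sum>r\<in>R. pk i r * (agree ?T r \<pi> * g \<pi>))"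
        by (subst R(3)[OF me, symmetric]) (simp_all add: sum_distrib_right mult.assoc)
    qed
    thus ?thesis by (simp add: EE_sum EE_cmult)
  qed
  have dec1: "EE (pk i) = (\<Sum>r\<in>R. pk i r * EE (agree ?T r))" using dec[of "\<lambda>_. 1"] by simp
  define e where "e r = EE (\<lambda>\<pi>. agree ?T r \<pi> * tilt t \<pi>) - EE (agree ?T r) * ?M
      + t * (EE (\<lambda>\<pi>. agree ?T r \<pi> * pks \<pi>) - EE (agree ?T r) * EE pks) * ?M" for r
  have T3: "card ?T \<le> 3" by (simp add: card_insert_if)
  have eb: "\<bar>e r\<bar> \<le> tilt_const t * t^2 * (EE (agree ?T r) * ?M)" for r
  proof -
    have "\<bar>e r\<bar> \<le> ((24 * real (card ?T))^2 * exp (24 * real (card ?T) * t)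
      + 24 * (45 * real (card ?T)) * (24 * real (card ?T)) * exp (24 * (45 * real (card ?T)) * t))
      * t^2 * (EE (agree ?T r) * ?M)"
      unfolding e_def by (rule agree_tilt_expansion) (use t in auto)
    also have "\<dots> \<le> tilt_const t * t^2 * (EE (agree ?T r) * ?M)"
    proof (intro mult_right_mono)
      \<comment> \<open>For three positions \<open>c = 72\<close> and \<open>24 * K = 3240\<close>;
        \<open>72^2 = 5184\<close> and \<open>3240 * 72 = 233280\<close> give the coefficients of
        \<open>tilt_const\<close>.\<close>
      have r: "24 * real (card ?T) \<le> 72" "24 * (45 * real (card ?T)) \<le> 3240" "real (card ?T) \<ge> 0"
        using T3 by linarith+
      have "(24 * real (card ?T))^2 \<le> 72^2" using r by (intro power_mono) auto
      moreover have "24 * (45 * real (card ?T)) * (24 * real (card ?T)) \<le> 3240 * 72"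
        using r by (intro mult_mono) auto
      ultimately show "(24 * real (card ?T))^2 * exp (24 * real (card ?T) * t)
        + 24 * (45 * real (card ?T)) * (24 * real (card ?T)) * exp (24 * (45 * real (card ?T)) * t)
        \<le> tilt_const t"
        unfolding tilt_const_def using mult_right_mono[OF r(1) t] mult_right_mono[OF r(2) t]
        by (intro add_mono mult_mono) auto
    qed (use EE_tilt_pos[of t] in \<open>auto intro!: mult_nonneg_nonneg EE_nonneg agree_bounds less_imp_le[OF tilt_pos]\<close>)
    finally show ?thesis .
  qed
  have "EE (\<lambda>\<pi>. pk i \<pi> * tilt t \<pi>) - EE (pk i) * EE (tilt t)
      + t * (EE (\<lambda>\<pi>. pk i \<pi> * pks \<pi>) - EE (pk i) * EE pks) * EE (tilt t) = (\<Sum>r\<in>R. pk i r * e r)"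
    unfolding dec dec1 e_def
    by (simp add: sum.distrib sum_subtractf sum_distrib_left sum_distrib_right algebra_simps)
  moreover have "\<bar>\<Sum>r\<in>R. pk i r * e r\<bar> \<le> tilt_const t * t^2 * (EE (pk i) * ?M)"
  proof -
    have "\<bar>\<Sum>r\<in>R. pk i r * e r\<bar> \<le> (\<Sum>r\<in>R. pk i r * (tilt_const t * t^2 * (EE (agree ?T r) * ?M)))"
      by (rule order_trans[OF sum_abs sum_mono])
        (use eb pk_bounds in \<open>simp add: abs_mult mult_left_mono\<close>)
    thus ?thesis unfolding dec1 by (simp add: sum_distrib_left sum_distrib_right mult_ac)
  qed
  moreover have "tilt_const t * t^2 * (EE (pk i) * ?M) \<le> tilt_const t * t^2 * (1 * ?M)"
  proof (intro mult_left_mono mult_right_mono)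
    show "EE (pk i) \<le> 1" using EE_mono[of "pk i" "\<lambda>_. 1"] pk_bounds EE_const[of 1] by simp
  qed (use EE_tilt_pos[of t] in \<open>auto simp: tilt_const_def\<close>)
  ultimately show ?thesis by simp
qed

definition pvar :: real where
  "pvar = EE (\<lambda>\<pi>. pks \<pi> * pks \<pi>) - EE pks * EE pks"

text \<open>Summed over \<open>i\<close>, the covariances of \<open>pk i\<close> with
  \<open>pks\<close> add up to \<open>pvar\<close>.\<close>

lemma pks_tilt_expansion:
  fixes t :: real
  assumes t: "t \<ge> 0"
  shows "\<bar>EE (\<lambda>\<pi>. pks \<pi> * tilt t \<pi>) - EE pks * EE (tilt t) + t * pvar * EE (tilt t)\<bar>
    \<le> real n * tilt_const t * t^2 * EE (tilt t)"
proof -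
  let ?M = "EE (tilt t)"
  define e where "e i = EE (\<lambda>\<pi>. pk i \<pi> * tilt t \<pi>) - EE (pk i) * ?M
      + t * (EE (\<lambda>\<pi>. pk i \<pi> * pks \<pi>) - EE (pk i) * EE pks) * ?M" for i
  have d: "EE (\<lambda>\<pi>. pks \<pi> * g \<pi>) = (\<Sum>i\<in>{2..<n}. EE (\<lambda>\<pi>. pk i \<pi> * g \<pi>))" for g
    unfolding EE_sum[symmetric] by (intro EE_cong) (simp add: peaks_eq_sum sum_distrib_right)
  have d1: "EE pks = (\<Sum>i\<in>{2..<n}. EE (pk i))" using d[of "\<lambda>_. 1"] by simp
  have s: "(\<Sum>i\<in>I. A i - B i * m + t * (C i - B i * q) * m)
    = (\<Sum>i\<in>I. A i) - (\<Sum>i\<in>I. B i) * m + t * ((\<Sum>i\<in>I. C i) - (\<Sum>i\<in>I. B i) * q) * m"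
    for A B C :: "nat \<Rightarrow> real" and m q I
    by (simp add: sum.distrib sum_subtractf sum_distrib_left sum_distrib_right algebra_simps)
  have eq: "EE (\<lambda>\<pi>. pks \<pi> * tilt t \<pi>) - EE pks * ?M + t * pvar * ?M = (\<Sum>i\<in>{2..<n}. e i)"
    unfolding e_def s pvar_def d[symmetric] d1[symmetric] ..
  have "\<bar>\<Sum>i\<in>{2..<n}. e i\<bar> \<le> (\<Sum>i\<in>{2..<n}. tilt_const t * t^2 * ?M)"
    by (rule order_trans[OF sum_abs sum_mono]) (use pk_tilt_expansion[OF t] in \<open>simp add: e_def\<close>)
  also have "\<dots> \<le> real n * (tilt_const t * t^2 * ?M)"
    unfolding sum_constant using EE_tilt_pos[of t] by (intro mult_right_mono) (auto simp: tilt_const_def)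
  finally show ?thesis using eq by (simp add: mult.assoc)
qed

lemma EE_tilt_0: "EE (tilt 0) = 1"
  using EE_const[of 1] by (simp add: tilt_def[abs_def])

text \<open>The derivative of the left-hand expression is the error of
  \<open>pks_tilt_expansion\<close> divided by the positive \<open>EE (tilt u)\<close>, and the
  expression vanishes at 0. At \<open>t = s / sqrt n\<close> the bound \<open>n * t^3\<close> is of
  order \<open>1 / sqrt n\<close>.\<close>

lemma log_laplace_peaks:
  fixes s t :: real
  assumes t: "0 \<le> t" "t \<le> s"
  shows "\<bar>ln (EE (tilt t)) + t * EE pks - t^2 * pvar / 2\<bar> \<le> real n * tilt_const s * t^3"
proof (cases "t = 0")
  case True thus ?thesis by (simp add: EE_tilt_0)
next
  case False
  hence t0: "0 < t" using t by simp
  define f where "f u = ln (EE (tilt u)) + u * EE pks - u^2 * pvar / 2" for u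
  define f' where "f' u = - EE (\<lambda>\<pi>. pks \<pi> * tilt u \<pi>) / EE (tilt u) + EE pks - u * pvar" for u
  have dM: "((\<lambda>u. EE (tilt u)) has_real_derivative - EE (\<lambda>\<pi>. pks \<pi> * tilt u \<pi>)) (at u)" for u
    unfolding EE_alt tilt_def minus_divide_left sum_negf[symmetric]
    by (intro DERIV_cdivide DERIV_sum) (auto intro!: derivative_eq_intros)
  have df: "(f has_real_derivative f' u) (at u)" for u
    unfolding f_def f'_def
    by (auto intro!: derivative_eq_intros dM EE_tilt_pos simp: field_simps)
  have f'b: "\<bar>f' u\<bar> \<le> real n * tilt_const s * t^2" if u: "0 \<le> u" "u \<le> t" for u
  proof -
    have M: "EE (tilt u) > 0" by (rule EE_tilt_pos)
    have "f' u * EE (tilt u) = - (EE (\<lambda>\<pi>. pks \<pi> * tilt u \<pi>) - EE pks * EE (tilt u) + u * pvar * EE (tilt u))"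
      unfolding f'_def using M by (simp add: field_simps)
    hence "\<bar>f' u * EE (tilt u)\<bar> \<le> real n * tilt_const u * u^2 * EE (tilt u)"
      using pks_tilt_expansion[OF u(1)] by simp
    hence "\<bar>f' u\<bar> * EE (tilt u) \<le> real n * tilt_const u * u^2 * EE (tilt u)"
      using M by (simp add: abs_mult)
    hence "\<bar>f' u\<bar> \<le> real n * tilt_const u * u^2" using M by simp
    also have "\<dots> \<le> real n * tilt_const s * t^2"
      using u t unfolding tilt_const_def by (intro mult_mono add_mono power_mono) auto
    finally show ?thesis .
  qed
  obtain z where z: "z > 0" "z < t" "f t - f 0 = (t - 0) * f' z"
    using MVT2[of 0 t f f'] t0 df by blast
  have f0: "f 0 = 0" by (simp add: f_def EE_tilt_0)
  have "\<bar>f t\<bar> = t * \<bar>f' z\<bar>" using z(3) t0 f0 by (simp add: abs_mult)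
  also have "\<dots> \<le> t * (real n * tilt_const s * t^2)" using f'b[of z] z t0 by (intro mult_left_mono) auto
  finally show ?thesis by (simp add: f_def power2_eq_square power3_eq_cube mult_ac)
qed

end

subsection \<open>Fixed points and single values\<close>

declare One_nat_def [simp del]

definition fxs :: "nat set \<Rightarrow> (nat \<Rightarrow> nat) \<Rightarrow> real" where
  "fxs A \<pi> = of_bool (\<forall>a\<in>A. \<pi> a = a)"

lemma fxs_bounds: "0 \<le> fxs A \<pi>" "fxs A \<pi> \<le> 1"
  by (auto simp: fxs_def)

lemma fxs_cj: "\<rho> permutes A \<Longrightarrow> fxs S (cj \<rho> \<pi>) = fxs (inv \<rho> ` S) \<pi>"
  by (simp add: fxs_def cj_fixed_iff)

context random_conjugate
begin

definition nfix :: nat where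
  "nfix = card {x \<in> {1..n}. \<pi>0 x = x}"

lemma nfix_Cl:
  assumes "\<pi> \<in> Cl" shows "card {x \<in> {1..n}. \<pi> x = x} = nfix"
proof -
  obtain \<rho> where \<rho>: "\<rho> \<in> perms n" "\<pi> = cj \<rho> \<pi>0" using assms by (auto simp: Cl_def)
  have "bij_betw \<rho> {x \<in> {1..n}. \<pi>0 x = x} {x \<in> {1..n}. \<pi> x = x}"
  proof (rule bij_betw_byWitness[where f' = "inv \<rho>"])
    show "\<rho> ` {x \<in> {1..n}. \<pi>0 x = x} \<subseteq> {x \<in> {1..n}. \<pi> x = x}"
    proof (intro image_subsetI CollectI conjI)
      fix x assume x: "x \<in> {x \<in> {1..n}. \<pi>0 x = x}"
      show "\<rho> x \<in> {1..n}" using x permutes_in_image[OF permsD[OF \<rho>(1)]] by blast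
      show "\<pi> (\<rho> x) = \<rho> x"
        unfolding \<rho>(2) using x cj_apply[of \<rho> \<pi>0 x] bij_is_inj[OF perms_bij[OF \<rho>(1)]] by simp
    qed
    show "inv \<rho> ` {x \<in> {1..n}. \<pi> x = x} \<subseteq> {x \<in> {1..n}. \<pi>0 x = x}"
    proof (intro image_subsetI CollectI conjI)
      fix x assume x: "x \<in> {x \<in> {1..n}. \<pi> x = x}"
      show "inv \<rho> x \<in> {1..n}" using x permutes_in_image[OF permsD[OF perms_inv[OF \<rho>(1)]]] by blast
      show "\<pi>0 (inv \<rho> x) = inv \<rho> x"
        using x cj_fixed_iff[OF permsD[OF \<rho>(1)], of \<pi>0 x] \<rho>(2) by blast
    qed
  qed (simp_all only: perms_inverses[OF \<rho>(1)] ball_simps simp_thms)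
  from bij_betw_same_card[OF this] show ?thesis unfolding nfix_def by (rule sym)
qed

lemma nfix_le: "nfix \<le> n"
proof -
  have "nfix \<le> card {1..n}" unfolding nfix_def by (rule card_mono) auto
  thus ?thesis by simp
qed

lemma transpose_perms: "a \<in> {1..n} \<Longrightarrow> b \<in> {1..n} \<Longrightarrow> transpose a b \<in> perms n"
  by (simp add: perms_def permutes_swap_id)

lemma inv_transpose_eq: "inv (transpose a b) = transpose a b"
  by (rule inv_unique_comp) (simp_all add: transpose_comp_involutory)

lemma EE_transpose:
  assumes "a \<in> {1..n}" "b \<in> {1..n}"
  shows "EE (\<lambda>\<pi>. h (cj (transpose a b) \<pi>)) = EE h"
  by (rule EE_cj[OF transpose_perms[OF assms]])

text \<open>Quotient of falling factorials of \<open>nfix\<close> and \<open>n\<close>: the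
  probability that \<open>k\<close> given positions are all fixed, see
  \<open>EE_fxs\<close>.\<close>

definition q :: "nat \<Rightarrow> real" where
  "q k = (\<Prod>j<k. (real nfix - real j) / (real n - real j))"

text \<open>Transpositions show that every position outside \<open>A\<close> is equally likely to be
  fixed together with \<open>A\<close>. When \<open>A\<close> is fixed, exactly
  \<open>nfix - card A\<close> of these positions are fixed.\<close>

lemma EE_fxs:
  assumes "A \<subseteq> {1..n}"
  shows "EE (fxs A) = q (card A)"
proof -
  have "finite A" using assms finite_subset by blast
  thus ?thesis using assms
  proof (induction A)
    case empty
    show ?case using EE_const[of 1] by (simp add: fxs_def[abs_def] q_def)
  next
    case (insert a A)
    let ?k = "card A"
    have a: "a \<in> {1..n}" "A \<subseteq> {1..n}" using insert.prems by auto
    have kn: "?k < n"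
    proof -
      have "card (insert a A) \<le> card {1..n}" by (rule card_mono) (use insert.prems in auto)
      thus ?thesis using insert.hyps by simp
    qed
    have eq: "EE (fxs (insert b A)) = EE (fxs (insert a A))" if b: "b \<in> {1..n} - A" for b
    proof -
      have "inv (transpose a b) ` insert b A = insert a A"
        using b insert.hyps(2) unfolding inv_transpose_eq by (force simp: transpose_def image_iff)
      hence "fxs (insert b A) (cj (transpose a b) \<pi>) = fxs (insert a A) \<pi>" for \<pi>
        using fxs_cj[OF permsD[OF transpose_perms], of a b "insert b A"] a b by simp
      thus ?thesis using EE_transpose[of a b "fxs (insert b A)"] a b by simp
    qed
    have pt: "(\<Sum>b\<in>{1..n} - A. fxs (insert b A) \<pi>) = (real nfix - real ?k) * fxs A \<pi>" if \<pi>: "\<pi> \<in> Cl" for \<pi>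
    proof (cases "\<forall>x\<in>A. \<pi> x = x")
      case True
      have "(\<Sum>b\<in>{1..n} - A. fxs (insert b A) \<pi>) = (\<Sum>b\<in>{1..n} - A. of_bool (\<pi> b = b))"
        using True by (intro sum.cong) (auto simp: fxs_def)
      also have "\<dots> = real (card ({x \<in> {1..n}. \<pi> x = x} - A))"
        by (simp add: sum.If_cases of_bool_def Int_def set_diff_eq conj_ac)
      also have "\<dots> = real nfix - real ?k"
      proof -
        have sub: "A \<subseteq> {x \<in> {1..n}. \<pi> x = x}" using True a by auto
        have "card ({x \<in> {1..n}. \<pi> x = x} - A) = nfix - ?k"
          using card_Diff_subset[OF insert.hyps(1) sub] nfix_Cl[OF \<pi>] by simp
        moreover have "?k \<le> nfix" using card_mono[OF _ sub] nfix_Cl[OF \<pi>] by simp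
        ultimately show ?thesis by simp
      qed
      finally show ?thesis using True by (simp add: fxs_def)
    next
      case False thus ?thesis by (auto simp: fxs_def)
    qed
    have "(\<Sum>b\<in>{1..n} - A. EE (fxs (insert b A))) = (real nfix - real ?k) * EE (fxs A)"
      unfolding EE_sum[symmetric] EE_cmult[symmetric] by (rule EE_cong) (rule pt)
    moreover have "(\<Sum>b\<in>{1..n} - A. EE (fxs (insert b A))) = (real n - real ?k) * EE (fxs (insert a A))"
      using eq a kn by (simp add: card_Diff_subset[OF insert.hyps(1)] of_nat_diff)
    ultimately have "EE (fxs (insert a A)) = (real nfix - real ?k) / (real n - real ?k) * EE (fxs A)"
      using kn by (simp add: field_simps)
    thus ?case using insert.IH[OF a(2)] insert.hyps by (simp add: q_def mult.commute)
  qed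
qed

text \<open>Conjugation by transpositions makes the \<open>n - 1\<close> values other than
  \<open>a\<close> equally likely, and \<open>n - 1 \<ge> n / 2\<close>.\<close>

lemma EE_value_le:
  assumes ab: "a \<in> {1..n}" "b \<in> {1..n}" "a \<noteq> b"
  shows "EE (\<lambda>\<pi>. of_bool (\<pi> a = b)) \<le> 2 / real n"
proof -
  have n2: "n \<ge> 2" using ab by auto
  have eq: "EE (\<lambda>\<pi>. of_bool (\<pi> a = b')) = EE (\<lambda>\<pi>. of_bool (\<pi> a = b))" if b': "b' \<in> {1..n} - {a}" for b'
  proof -
    have "cj (transpose b b') \<pi> a = b' \<longleftrightarrow> \<pi> a = b" for \<pi>
      using cj_eq_iff[OF permsD[OF transpose_perms], of b b' \<pi> a b'] ab b'
      by (simp add: inv_transpose_eq transpose_apply_other)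
    thus ?thesis using EE_transpose[of b b' "\<lambda>\<pi>. of_bool (\<pi> a = b')"] ab b' by simp
  qed
  have "(\<Sum>b'\<in>{1..n} - {a}. EE (\<lambda>\<pi>. of_bool (\<pi> a = b'))) = (\<Sum>b'\<in>{1..n} - {a}. EE (\<lambda>\<pi>. of_bool (\<pi> a = b)))"
    by (rule sum.cong[OF refl eq])
  hence "real (n - 1) * EE (\<lambda>\<pi>. of_bool (\<pi> a = b)) = (\<Sum>b'\<in>{1..n} - {a}. EE (\<lambda>\<pi>. of_bool (\<pi> a = b')))"
    using ab by simp
  also have "\<dots> = EE (\<lambda>\<pi>. \<Sum>b'\<in>{1..n} - {a}. of_bool (\<pi> a = b'))" by (rule EE_sum[symmetric])
  also have "\<dots> \<le> EE (\<lambda>_. 1)" by (intro EE_mono) (simp add: sum.If_cases of_bool_def)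
  finally have "real (n - 1) * EE (\<lambda>\<pi>. of_bool (\<pi> a = b)) \<le> 1" by (simp add: EE_const)
  moreover have "real n / 2 \<le> real (n - 1)" using n2 by linarith
  moreover have "0 \<le> EE (\<lambda>\<pi>. of_bool (\<pi> a = b))" by (rule EE_nonneg) simp
  ultimately have "real n / 2 * EE (\<lambda>\<pi>. of_bool (\<pi> a = b)) \<le> 1"
    by (meson mult_right_mono order_trans)
  thus ?thesis using n_pos by (simp add: field_simps)
qed

text \<open>Transpositions move \<open>b\<close> to any value other than \<open>a\<close>,
  \<open>c\<close>, \<open>d\<close>. This gives \<open>n - 3\<close> equally likely disjoint parts
  of the event \<open>\<pi> c = d\<close>, and \<open>n - 3 \<ge> n / 2\<close> once
  \<open>n \<ge> 6\<close>.\<close>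

lemma EE_two_values_le:
  assumes ab: "{a, b, c, d} \<subseteq> {1..n}" "distinct [a, b, c, d]" and n6: "n \<ge> 6"
  shows "EE (\<lambda>\<pi>. of_bool (\<pi> a = b \<and> \<pi> c = d)) \<le> 4 / real n ^ 2"
proof -
  let ?h = "\<lambda>b' \<pi>. of_bool (\<pi> a = b' \<and> \<pi> c = d) :: real"
  have eq: "EE (?h b') = EE (?h b)" if b': "b' \<in> {1..n} - {a, c, d}" for b'
  proof -
    have *: "cj (transpose b b') \<pi> a = b' \<longleftrightarrow> \<pi> a = b" "cj (transpose b b') \<pi> c = d \<longleftrightarrow> \<pi> c = d" for \<pi>
      using cj_eq_iff[OF permsD[OF transpose_perms], of b b' \<pi> a b'] 
        cj_eq_iff[OF permsD[OF transpose_perms], of b b' \<pi> c d] ab b'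
      by (auto simp add: inv_transpose_eq transpose_apply_other)
    show ?thesis using EE_transpose[of b b' "?h b'"] ab b' by (simp add: *)
  qed
  have c3: "card ({1..n} - {a, c, d}) = n - 3"
    using ab by (subst card_Diff_subset) auto
  have "(\<Sum>b'\<in>{1..n} - {a, c, d}. EE (?h b')) = (\<Sum>b'\<in>{1..n} - {a, c, d}. EE (?h b))"
    by (rule sum.cong[OF refl eq])
  hence "real (n - 3) * EE (?h b) = (\<Sum>b'\<in>{1..n} - {a, c, d}. EE (?h b'))"
    using c3 by simp
  also have "\<dots> = EE (\<lambda>\<pi>. \<Sum>b'\<in>{1..n} - {a, c, d}. ?h b' \<pi>)" by (rule EE_sum[symmetric])
  also have "\<dots> \<le> EE (\<lambda>\<pi>. of_bool (\<pi> c = d))"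
  proof (intro EE_mono)
    fix \<pi>
    have "(\<Sum>b'\<in>{1..n} - {a, c, d}. ?h b' \<pi>) = (\<Sum>b'\<in>{1..n} - {a, c, d}. of_bool (\<pi> a = b') * of_bool (\<pi> c = d))"
      by (intro sum.cong) auto
    also have "\<dots> = (\<Sum>b'\<in>{1..n} - {a, c, d}. of_bool (\<pi> a = b')) * of_bool (\<pi> c = d)"
      by (simp add: sum_distrib_right)
    also have "\<dots> \<le> 1 * of_bool (\<pi> c = d)"
      by (intro mult_right_mono) (simp_all add: sum.If_cases of_bool_def)
    finally show "(\<Sum>b'\<in>{1..n} - {a, c, d}. ?h b' \<pi>) \<le> of_bool (\<pi> c = d)" by simp
  qed
  also have "\<dots> \<le> 2 / real n" using EE_value_le[of c d] ab by auto
  finally have "real (n - 3) * EE (?h b) \<le> 2 / real n" .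
  moreover have "real n / 2 \<le> real (n - 3)" using n6 by linarith
  moreover have "0 \<le> EE (?h b)" by (rule EE_nonneg) simp
  ultimately have "real n / 2 * EE (?h b) \<le> 2 / real n"
    by (meson mult_right_mono order_trans)
  thus ?thesis using n_pos by (simp add: field_simps power2_eq_square)
qed

end

subsection \<open>Symmetrization over a block\<close>

lemma rank_bij:
  fixes B :: "nat set" and key :: "nat \<Rightarrow> nat"
  assumes B: "finite B" and inj: "inj_on key B"
  shows "bij_betw (\<lambda>x. card {y \<in> B. key y < key x}) B {..<card B}"
proof -
  let ?r = "\<lambda>x. card {y \<in> B. key y < key x}"
  have lt: "?r x < ?r y" if "x \<in> B" "key x < key y" for x y
    by (rule psubset_card_mono) (use that B in \<open>auto intro: less_trans\<close>)
  have i: "inj_on ?r B"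
  proof (rule inj_onI, rule ccontr)
    fix x y assume a: "x \<in> B" "y \<in> B" "?r x = ?r y" "x \<noteq> y"
    hence "key x < key y \<or> key y < key x" using inj by (meson inj_on_contraD linorder_neqE_nat)
    thus False using lt[of x y] lt[of y x] a by auto
  qed
  have "?r ` B \<subseteq> {..<card B}"
  proof
    fix k assume "k \<in> ?r ` B"
    then obtain x where "x \<in> B" "k = ?r x" by auto
    moreover have "?r x < card B" by (rule psubset_card_mono) (use \<open>x \<in> B\<close> B in auto)
    ultimately show "k \<in> {..<card B}" by simp
  qed
  moreover have "card (?r ` B) = card {..<card B}" using i by (simp add: card_image)
  ultimately have "?r ` B = {..<card B}" by (intro card_subset_eq) auto
  thus ?thesis using i by (simp add: bij_betw_def)
qed

text \<open>Sorting forces the rank of \<open>key (\<sigma> x)\<close> among the keys to equal the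
  rank of \<open>x\<close> in \<open>B\<close>, and both rank functions are bijections onto the same
  initial segment.\<close>

lemma unique_sorting_permutation:
  fixes B :: "nat set" and key :: "nat \<Rightarrow> nat"
  assumes B: "finite B" and inj: "inj_on key B"
  shows "\<exists>!\<sigma>. \<sigma> permutes B \<and> (\<forall>x\<in>B. \<forall>y\<in>B. x < y \<longrightarrow> key (\<sigma> x) < key (\<sigma> y))"
proof -
  define r where "r x = card {y \<in> B. y < x}" for x
  define s where "s x = card {y \<in> B. key y < key x}" for x
  have r: "bij_betw r B {..<card B}"
    unfolding r_def using rank_bij[OF B, of "\<lambda>x. x"] by simp
  have s: "bij_betw s B {..<card B}" unfolding s_def by (rule rank_bij[OF B inj])
  define g where "g = inv_into B s"
  have g: "bij_betw g {..<card B} B" unfolding g_def by (rule bij_betw_inv_into[OF s])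
  define \<sigma> where "\<sigma> x = (if x \<in> B then g (r x) else x)" for x
  have "bij_betw (g \<circ> r) B B" by (rule bij_betw_trans[OF r g])
  hence "bij_betw \<sigma> B B" by (rule bij_betw_cong[THEN iffD1, rotated]) (simp add: \<sigma>_def)
  hence p: "\<sigma> permutes B" by (rule bij_imp_permutes) (simp add: \<sigma>_def)
  have s\<sigma>: "s (\<sigma> x) = r x" if x: "x \<in> B" for x
  proof -
    have "r x \<in> s ` B" using x r s unfolding bij_betw_def by blast
    thus ?thesis using x by (simp add: \<sigma>_def g_def f_inv_into_f)
  qed
  have mono: "key (\<sigma> x) < key (\<sigma> y)" if "x \<in> B" "y \<in> B" "x < y" for x y
  proof (rule ccontr)
    assume "\<not> key (\<sigma> x) < key (\<sigma> y)"
    hence "s (\<sigma> y) \<le> s (\<sigma> x)" unfolding s_def by (intro card_mono) (use B in auto)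
    moreover have "r x < r y" unfolding r_def
      by (rule psubset_card_mono) (use that B in \<open>auto intro: less_trans\<close>)
    ultimately show False using s\<sigma> that by simp
  qed
  have uniq: "\<sigma>' = \<sigma>" if p': "\<sigma>' permutes B"
    and m': "\<forall>x\<in>B. \<forall>y\<in>B. x < y \<longrightarrow> key (\<sigma>' x) < key (\<sigma>' y)" for \<sigma>'
  proof
    fix x
    show "\<sigma>' x = \<sigma> x"
    proof (cases "x \<in> B")
      case False thus ?thesis using p' p by (simp add: permutes_not_in)
    next
      case True
      have iff: "key (\<sigma>' z) < key (\<sigma>' x) \<longleftrightarrow> z < x" if "z \<in> B" for z
        using m' True that by (metis less_irrefl linorder_neqE_nat order_less_trans)
      have "{y \<in> B. key y < key (\<sigma>' x)} = \<sigma>' ` {z \<in> B. z < x}"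
      proof (intro equalityI subsetI)
        fix y assume y: "y \<in> {y \<in> B. key y < key (\<sigma>' x)}"
        then obtain z where z: "z \<in> B" "y = \<sigma>' z" using permutes_image[OF p'] by blast
        thus "y \<in> \<sigma>' ` {z \<in> B. z < x}" using iff y by blast
      next
        fix y assume "y \<in> \<sigma>' ` {z \<in> B. z < x}"
        then obtain z where z: "z \<in> B" "z < x" "y = \<sigma>' z" by blast
        thus "y \<in> {y \<in> B. key y < key (\<sigma>' x)}" using iff permutes_in_image[OF p'] by blast
      qed
      hence "s (\<sigma>' x) = r x" unfolding s_def r_def
        using permutes_inj_on[OF p'] by (simp add: card_image)
      hence "s (\<sigma>' x) = s (\<sigma> x)" using s\<sigma> True by simp
      thus ?thesis using s True permutes_in_image[OF p'] permutes_in_image[OF p]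
        unfolding bij_betw_def inj_on_def by blast
    qed
  qed
  show ?thesis
  proof (rule ex1I[where a = \<sigma>])
    show "\<sigma> permutes B \<and> (\<forall>x\<in>B. \<forall>y\<in>B. x < y \<longrightarrow> key (\<sigma> x) < key (\<sigma> y))" using p mono by blast
  qed (use uniq in blast)
qed

text \<open>Order convexity, put as: no outside point separates two elements of \<open>B\<close>.
  Permuting \<open>B\<close> therefore preserves comparisons with outside values.\<close>

definition interval_like :: "nat set \<Rightarrow> bool" where
  "interval_like B \<longleftrightarrow> (\<forall>v. v \<notin> B \<longrightarrow> (\<forall>x\<in>B. \<forall>y\<in>B. v < x \<longleftrightarrow> v < y))"

text \<open>Fixed points are exempted because their probability need not tend to 0. On the good
  event each value on the block is either its own position or a point outside the block.\<close>

definition good :: "nat set \<Rightarrow> (nat \<Rightarrow> nat) \<Rightarrow> bool" where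
  "good B \<pi> \<longleftrightarrow> (\<forall>x\<in>B. \<pi> x \<in> B \<longrightarrow> \<pi> x = x)"

definition decr :: "nat set \<Rightarrow> (nat \<Rightarrow> nat) \<Rightarrow> bool" where
  "decr B \<pi> \<longleftrightarrow> (\<forall>x\<in>B. \<forall>y\<in>B. x < y \<longrightarrow> \<pi> y < \<pi> x)"

text \<open>Two fixed points of the block remain fixed under conjugation by a permutation of
  \<open>B\<close> and form an increasing pair, so no such conjugate is decreasing.\<close>

definition few :: "nat set \<Rightarrow> (nat \<Rightarrow> nat) \<Rightarrow> bool" where
  "few B \<pi> \<longleftrightarrow> (\<forall>x\<in>B. \<forall>y\<in>B. \<pi> x = x \<and> \<pi> y = y \<longrightarrow> x = y)"

lemma interval_like_atLeastAtMost: "interval_like {a..b}"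
  by (auto simp: interval_like_def)

lemma good_subset: "good B \<pi> \<Longrightarrow> A \<subseteq> B \<Longrightarrow> good A \<pi>"
  by (auto simp: good_def)

text \<open>On a good block the conjugation permutes the non-fixed values, which lie outside
  \<open>B\<close>, and carries fixed points along. Hence the conjugate is decreasing precisely if
  \<open>inv \<rho>\<close> sorts suitable keys in decreasing order, and the keys are distinct
  precisely if at most one fixed point is present.\<close>

lemma card_decr_conjugates:
  assumes B: "finite B" "interval_like B" and inj: "inj \<pi>" and g: "good B \<pi>"
  shows "card {\<rho>. \<rho> permutes B \<and> decr B (cj \<rho> \<pi>)} = (if few B \<pi> then 1 else 0)"
proof (cases "B = {}")
  case True
  hence "{\<rho>. \<rho> permutes B \<and> decr B (cj \<rho> \<pi>)} = {id}" by (auto simp: decr_def)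
  thus ?thesis using True by (simp add: few_def)
next
  case False
  then obtain m where m: "m \<in> B" by blast
  \<comment> \<open>The value at a fixed point moves with it through \<open>B\<close>. Compared with
    values outside \<open>B\<close>, any single element \<open>m\<close> of the block can stand for
    it.\<close>
  define key where "key z = (if \<pi> z = z then m else \<pi> z)" for z
  have iff: "decr B (cj \<rho> \<pi>) \<longleftrightarrow> (\<forall>x\<in>B. \<forall>y\<in>B. x < y \<longrightarrow> key (inv \<rho> y) < key (inv \<rho> x))"
    if \<rho>: "\<rho> permutes B" for \<rho>
  proof -
    have val: "cj \<rho> \<pi> x = (if \<pi> (inv \<rho> x) = inv \<rho> x then x else \<pi> (inv \<rho> x))"
      and out: "\<pi> (inv \<rho> x) \<noteq> inv \<rho> x \<Longrightarrow> \<pi> (inv \<rho> x) \<notin> B" if "x \<in> B" for x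
    proof -
      have z: "inv \<rho> x \<in> B" using that permutes_in_image[OF permutes_inv[OF \<rho>]] by blast
      thus o: "\<pi> (inv \<rho> x) \<noteq> inv \<rho> x \<Longrightarrow> \<pi> (inv \<rho> x) \<notin> B" using g unfolding good_def by blast
      show "cj \<rho> \<pi> x = (if \<pi> (inv \<rho> x) = inv \<rho> x then x else \<pi> (inv \<rho> x))"
        using o permutes_not_in[OF \<rho>] permutes_inverses[OF \<rho>] by (simp add: cj_def)
    qed
    have "cj \<rho> \<pi> y < cj \<rho> \<pi> x \<longleftrightarrow> key (inv \<rho> y) < key (inv \<rho> x)"
      if xy: "x \<in> B" "y \<in> B" "x < y" for x y
    proof -
      have il: "v < x \<longleftrightarrow> v < m" "v < y \<longleftrightarrow> v < m" if "v \<notin> B" for v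
        using B(2) xy m that unfolding interval_like_def by blast+
      consider "\<pi> (inv \<rho> x) = inv \<rho> x" "\<pi> (inv \<rho> y) = inv \<rho> y"
        | "\<pi> (inv \<rho> x) = inv \<rho> x" "\<pi> (inv \<rho> y) \<noteq> inv \<rho> y"
        | "\<pi> (inv \<rho> x) \<noteq> inv \<rho> x" "\<pi> (inv \<rho> y) = inv \<rho> y"
        | "\<pi> (inv \<rho> x) \<noteq> inv \<rho> x" "\<pi> (inv \<rho> y) \<noteq> inv \<rho> y" by blast
      thus ?thesis
      proof cases
        case 1 thus ?thesis using val xy by (simp add: key_def)
      next
        case 2 thus ?thesis using val xy il out by (simp add: key_def)
      next
        case 3
        have o: "\<pi> (inv \<rho> x) \<notin> B" using out xy 3 by blast
        hence ne: "\<pi> (inv \<rho> x) \<noteq> y" "\<pi> (inv \<rho> x) \<noteq> m" using xy m by auto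
        have "y < \<pi> (inv \<rho> x) \<longleftrightarrow> \<not> \<pi> (inv \<rho> x) < y" using ne by auto
        also have "\<dots> \<longleftrightarrow> \<not> \<pi> (inv \<rho> x) < m" using il(2)[OF o] by simp
        also have "\<dots> \<longleftrightarrow> m < \<pi> (inv \<rho> x)" using ne by auto
        finally show ?thesis using val xy 3 by (simp add: key_def)
      next
        case 4 thus ?thesis using val xy by (simp add: key_def)
      qed
    qed
    thus ?thesis unfolding decr_def by blast
  qed
  show ?thesis
  proof (cases "few B \<pi>")
    case True
    have ik: "inj_on key B"
    proof (rule inj_onI)
      fix x y assume xy: "x \<in> B" "y \<in> B" "key x = key y"
      have o: "\<pi> z \<noteq> m" if "z \<in> B" "\<pi> z \<noteq> z" for z
      proof
        assume "\<pi> z = m"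
        hence "\<pi> z \<in> B" using m by simp
        thus False using g that unfolding good_def by blast
      qed
      show "x = y"
      proof (cases "\<pi> x = x"; cases "\<pi> y = y")
        assume "\<pi> x = x" "\<pi> y = y"
        thus ?thesis using True xy unfolding few_def by blast
      next
        assume "\<pi> x = x" "\<pi> y \<noteq> y"
        thus ?thesis using o[of y] xy by (simp add: key_def)
      next
        assume "\<pi> x \<noteq> x" "\<pi> y = y"
        thus ?thesis using o[of x] xy by (simp add: key_def)
      next
        assume "\<pi> x \<noteq> x" "\<pi> y \<noteq> y"
        hence "\<pi> x = \<pi> y" using xy by (simp add: key_def)
        thus ?thesis by (rule injD[OF inj])
      qed
    qed
    define M where "M = Max (key ` B)"
    have kM: "key x \<le> M" if "x \<in> B" for x unfolding M_def using B that by simp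
    \<comment> \<open>Reverses the order so that the increasing sorting lemma applies; as
      \<open>M\<close> is the maximum, the subtraction is never truncated.\<close>
    define key' where "key' x = M - key x" for x
    have k': "key' x < key' y \<longleftrightarrow> key y < key x" if "x \<in> B" "y \<in> B" for x y
      using kM[OF that(1)] kM[OF that(2)] unfolding key'_def by linarith
    have ik': "inj_on key' B"
    proof (rule inj_onI)
      fix x y assume a: "x \<in> B" "y \<in> B" "key' x = key' y"
      hence "key x = key y" using kM[of x] kM[of y] unfolding key'_def by linarith
      thus "x = y" using ik a by (meson inj_onD)
    qed
    obtain \<sigma> where \<sigma>: "\<sigma> permutes B" "\<forall>x\<in>B. \<forall>y\<in>B. x < y \<longrightarrow> key' (\<sigma> x) < key' (\<sigma> y)"
      and un: "\<And>\<sigma>'. \<sigma>' permutes B \<Longrightarrow> (\<forall>x\<in>B. \<forall>y\<in>B. x < y \<longrightarrow> key' (\<sigma>' x) < key' (\<sigma>' y)) \<Longrightarrow> \<sigma>' = \<sigma>"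
      by (rule ex1E[OF unique_sorting_permutation[OF B(1) ik']]) blast
    have keq: "(\<forall>x\<in>B. \<forall>y\<in>B. x < y \<longrightarrow> key (\<sigma>' y) < key (\<sigma>' x))
      \<longleftrightarrow> (\<forall>x\<in>B. \<forall>y\<in>B. x < y \<longrightarrow> key' (\<sigma>' x) < key' (\<sigma>' y))" if "\<sigma>' permutes B" for \<sigma>'
      using k' permutes_in_image[OF that] by simp
    have "{\<rho>. \<rho> permutes B \<and> decr B (cj \<rho> \<pi>)} = {inv \<sigma>}"
    proof (intro equalityI subsetI)
      fix \<rho> assume "\<rho> \<in> {\<rho>. \<rho> permutes B \<and> decr B (cj \<rho> \<pi>)}"
      hence \<rho>: "\<rho> permutes B" "decr B (cj \<rho> \<pi>)" by auto
      have "inv \<rho> = \<sigma>"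
        by (rule un[OF permutes_inv[OF \<rho>(1)]])
          (use iff[OF \<rho>(1)] \<rho>(2) keq[OF permutes_inv[OF \<rho>(1)]] in simp)
      thus "\<rho> \<in> {inv \<sigma>}" using permutes_inv_inv[OF \<rho>(1)] by simp
    next
      fix \<rho> assume "\<rho> \<in> {inv \<sigma>}"
      hence e: "\<rho> = inv \<sigma>" by simp
      have i: "inv (inv \<sigma>) = \<sigma>" by (rule permutes_inv_inv[OF \<sigma>(1)])
      have "decr B (cj (inv \<sigma>) \<pi>)"
        using iff[OF permutes_inv[OF \<sigma>(1)]] keq[OF \<sigma>(1)] \<sigma>(2) unfolding i by blast
      thus "\<rho> \<in> {\<rho>. \<rho> permutes B \<and> decr B (cj \<rho> \<pi>)}" unfolding e using permutes_inv[OF \<sigma>(1)] by blast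
    qed
    thus ?thesis using True by simp
  next
    case F: False
    then obtain x y where xy: "x \<in> B" "y \<in> B" "\<pi> x = x" "\<pi> y = y" "x \<noteq> y"
      unfolding few_def by blast
    have "\<not> decr B (cj \<rho> \<pi>)" if \<rho>: "\<rho> permutes B" for \<rho>
    proof
      assume d: "decr B (cj \<rho> \<pi>)"
      have "\<rho> x \<in> B" "\<rho> y \<in> B" using xy permutes_in_image[OF \<rho>] by auto
      moreover have "cj \<rho> \<pi> (\<rho> x) = \<rho> x" "cj \<rho> \<pi> (\<rho> y) = \<rho> y"
        using xy permutes_inverses[OF \<rho>] by (auto simp: cj_def)
      moreover have "\<rho> x \<noteq> \<rho> y" using xy(5) permutes_inverses(2)[OF \<rho>] by metis
      ultimately show False using d unfolding decr_def by (metis linorder_neqE_nat order_less_asym)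
    qed
    hence "{\<rho>. \<rho> permutes B \<and> decr B (cj \<rho> \<pi>)} = {}" by blast
    hence "card {\<rho>. \<rho> permutes B \<and> decr B (cj \<rho> \<pi>)} = 0" by (simp only: card.empty)
    thus ?thesis using F by simp
  qed
qed

lemma good_cj:
  assumes \<rho>: "\<rho> permutes A" and B: "\<And>x. \<rho> x \<in> B \<longleftrightarrow> x \<in> B"
  shows "good B (cj \<rho> \<pi>) \<longleftrightarrow> good B \<pi>"
proof -
  have B': "inv \<rho> x \<in> B \<longleftrightarrow> x \<in> B" for x using B[of "inv \<rho> x"] permutes_inverses[OF \<rho>] by simp
  have e: "cj \<rho> \<pi> (\<rho> x) = \<rho> (\<pi> x)" for x using permutes_inverses[OF \<rho>] by (simp add: cj_def)
  have "good B (cj \<rho> \<pi>) \<longleftrightarrow> (\<forall>x. \<rho> x \<in> B \<longrightarrow> cj \<rho> \<pi> (\<rho> x) \<in> B \<longrightarrow> cj \<rho> \<pi> (\<rho> x) = \<rho> x)"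
    unfolding good_def using permutes_inverses[OF \<rho>] by metis
  also have "\<dots> \<longleftrightarrow> good B \<pi>"
    unfolding e good_def B using permutes_inverses(2)[OF \<rho>] by metis
  finally show ?thesis .
qed

lemma permutes_mem_iff_subset: "\<rho> permutes A \<Longrightarrow> A \<subseteq> B \<Longrightarrow> \<rho> x \<in> B \<longleftrightarrow> x \<in> B"
  by (metis permutes_in_image permutes_subset)

lemma permutes_mem_iff_disjoint: "\<rho> permutes A \<Longrightarrow> A \<inter> B = {} \<Longrightarrow> \<rho> x \<in> B \<longleftrightarrow> x \<in> B"
  by (metis IntI empty_iff permutes_in_image permutes_not_in)

context random_conjugate
begin

text \<open>All permutations of \<open>B\<close> leave \<open>h\<close> unchanged, so the
  expectation may be averaged over these \<open>fact (card B)\<close> conjugations. Where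
  \<open>h\<close> does not vanish the block is good, and one or none of the conjugates is
  decreasing on it.\<close>

lemma symmetrize_decr:
  assumes B: "B \<subseteq> {1..n}" "interval_like B"
    and inv: "\<And>\<rho> \<pi>. \<rho> permutes B \<Longrightarrow> \<pi> \<in> Cl \<Longrightarrow> h (cj \<rho> \<pi>) = h \<pi>"
    and sup: "\<And>\<pi>. \<pi> \<in> Cl \<Longrightarrow> h \<pi> \<noteq> 0 \<Longrightarrow> good B \<pi>"
  shows "fact (card B) * EE (\<lambda>\<pi>. of_bool (decr B \<pi>) * h \<pi>) = EE (\<lambda>\<pi>. of_bool (few B \<pi>) * h \<pi>)"
proof -
  have fB: "finite B" using B(1) finite_subset by blast
  let ?P = "{\<rho>. \<rho> permutes B}"
  have fP: "finite ?P" by (rule finite_permutations[OF fB])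
  have per: "EE (\<lambda>\<pi>. of_bool (decr B \<pi>) * h \<pi>) = EE (\<lambda>\<pi>. of_bool (decr B (cj \<rho> \<pi>)) * h \<pi>)"
    if \<rho>: "\<rho> \<in> ?P" for \<rho>
  proof -
    have "\<rho> \<in> perms n" using \<rho> permutes_subset[OF _ B(1)] unfolding perms_def by blast
    hence "EE (\<lambda>\<pi>. of_bool (decr B \<pi>) * h \<pi>)
      = EE (\<lambda>\<pi>. of_bool (decr B (cj \<rho> \<pi>)) * h (cj \<rho> \<pi>))"
      using EE_cj[of \<rho> "\<lambda>\<pi>. of_bool (decr B \<pi>) * h \<pi>"] by simp
    also have "\<dots> = EE (\<lambda>\<pi>. of_bool (decr B (cj \<rho> \<pi>)) * h \<pi>)"
      by (rule EE_cong) (use inv \<rho> in simp)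
    finally show ?thesis .
  qed
  have "fact (card B) * EE (\<lambda>\<pi>. of_bool (decr B \<pi>) * h \<pi>)
    = (\<Sum>\<rho>\<in>?P. EE (\<lambda>\<pi>. of_bool (decr B \<pi>) * h \<pi>))"
    using card_permutations[OF refl fB] by simp
  also have "\<dots> = (\<Sum>\<rho>\<in>?P. EE (\<lambda>\<pi>. of_bool (decr B (cj \<rho> \<pi>)) * h \<pi>))"
    by (rule sum.cong[OF refl per])
  also have "\<dots> = EE (\<lambda>\<pi>. \<Sum>\<rho>\<in>?P. of_bool (decr B (cj \<rho> \<pi>)) * h \<pi>)" by (rule EE_sum[symmetric])
  also have "\<dots> = EE (\<lambda>\<pi>. of_bool (few B \<pi>) * h \<pi>)"
  proof (rule EE_cong)
    fix \<pi> assume \<pi>: "\<pi> \<in> Cl"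
    show "(\<Sum>\<rho>\<in>?P. of_bool (decr B (cj \<rho> \<pi>)) * h \<pi>) = of_bool (few B \<pi>) * h \<pi>"
    proof (cases "h \<pi> = 0")
      case False
      have "inj \<pi>" using perms_bij[OF Cl_perms[OF \<pi>]] bij_is_inj by blast
      hence c: "card {\<rho>. \<rho> permutes B \<and> decr B (cj \<rho> \<pi>)} = (if few B \<pi> then 1 else 0)"
        using card_decr_conjugates[OF fB B(2)] sup[OF \<pi> False] by blast
      have "(\<Sum>\<rho>\<in>?P. of_bool (decr B (cj \<rho> \<pi>)) * h \<pi>) = (\<Sum>\<rho>\<in>?P. of_bool (decr B (cj \<rho> \<pi>))) * h \<pi>"
        by (simp only: sum_distrib_right)
      also have "(\<Sum>\<rho>\<in>?P. of_bool (decr B (cj \<rho> \<pi>)) :: real) = real (card {\<rho>. \<rho> permutes B \<and> decr B (cj \<rho> \<pi>)})"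
        using fP by (simp add: sum.If_cases of_bool_def Int_def)
      finally show ?thesis using c by simp
    qed simp
  qed
  finally show ?thesis .
qed

end

subsection \<open>Decoupling of distant peaks\<close>

lemma interval3: "{p..p + 2} = {p, p + 1, p + (2::nat)}" and interval2: "{p..p + 1} = {p, p + (1::nat)}"
  by auto

lemma decr2: "decr {p..p + 1} \<pi> \<longleftrightarrow> \<pi> (p + 1) < \<pi> p"
  unfolding interval2 by (auto simp: decr_def)

lemma decr3: "decr {p..p + 2} \<pi> \<longleftrightarrow> \<pi> (p + 1) < \<pi> p \<and> \<pi> (p + 2) < \<pi> (p + 1)"
  unfolding interval3 by (auto simp: decr_def)

lemma few2: "of_bool (few {p..p + 1} \<pi>) = 1 - fxs {p, p + 1} \<pi>"
  unfolding interval2 by (auto simp: few_def fxs_def)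

text \<open>Inclusion-exclusion for having at most one fixed point: a set of \<open>j\<close> fixed
  points gets the coefficient \<open>(-1)^(j-1) * (j-1)\<close>. The versions for four and five
  positions follow the same pattern.\<close>

lemma few3: "of_bool (few {p..p + 2} \<pi>)
  = 1 - fxs {p, p + 1} \<pi> - fxs {p, p + 2} \<pi> - fxs {p + 1, p + 2} \<pi> + 2 * fxs {p, p + 1, p + 2} \<pi>"
  unfolding interval3
  by (cases "\<pi> p = p"; cases "\<pi> (p + 1) = p + 1"; cases "\<pi> (p + 2) = p + 2")
    (simp_all add: few_def fxs_def)

text \<open>By injectivity an ascent is the negation of a descent. A peak is therefore a descent
  starting at \<open>p + 1\<close> that does not extend to a decreasing run from \<open>p\<close>,
  and decreasing runs are what the block symmetrization evaluates.\<close>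

lemma pk_decr:
  assumes "inj \<pi>"
  shows "pk (p + 1) \<pi> = of_bool (decr {p + 1..p + 1 + 1} \<pi>) - of_bool (decr {p..p + 2} \<pi>)"
proof -
  have "\<pi> p \<noteq> \<pi> (p + 1)" using injD[OF assms, of p "p + 1"] by auto
  moreover have e: "p + 1 + 1 = p + 2" "p + 1 - 1 = p" by simp_all
  moreover have d: "decr {p + 1..p + 1 + 1} \<pi> \<longleftrightarrow> \<pi> (p + 2) < \<pi> (p + 1)"
    using decr2[of "p + 1" \<pi>] unfolding e .
  ultimately show ?thesis unfolding pk_def d decr3 unfolding e
    by (cases "\<pi> p < \<pi> (p + 1)"; cases "\<pi> (p + 2) < \<pi> (p + 1)") (auto simp: not_less)
qed

definition Tr :: "nat \<Rightarrow> nat set" where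
  "Tr i = {i - 1..i + 1}"

lemma Tr_finite: "finite (Tr i)" and Tr_card: "card (Tr i) \<le> 3" and Tr_interval: "interval_like (Tr i)"
  by (auto simp: Tr_def interval_like_atLeastAtMost)

lemma interval_like_permutes_less:
  assumes \<rho>: "\<rho> permutes B" and B: "interval_like B" and uv: "\<not> (u \<in> B \<and> v \<in> B)"
  shows "\<rho> u < \<rho> v \<longleftrightarrow> u < v"
proof (cases "u \<in> B")
  case True
  hence v: "v \<notin> B" using uv by simp
  hence "v < \<rho> u \<longleftrightarrow> v < u" using B True permutes_in_image[OF \<rho>] unfolding interval_like_def by blast
  moreover have "v \<noteq> u" "v \<noteq> \<rho> u" using v True permutes_in_image[OF \<rho>, of u] by auto
  ultimately show ?thesis using permutes_not_in[OF \<rho> v] by auto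
next
  case u: False
  show ?thesis
  proof (cases "v \<in> B")
    case True
    thus ?thesis using B u permutes_in_image[OF \<rho>, of v] permutes_not_in[OF \<rho> u]
      unfolding interval_like_def by metis
  next
    case False thus ?thesis using u permutes_not_in[OF \<rho>] by simp
  qed
qed

text \<open>Conjugating by a permutation of \<open>Tr i\<close> moves the values on
  \<open>Tr j\<close> that lie in \<open>Tr i\<close>. With at most one such value the relative
  order on \<open>Tr j\<close> survives, see \<open>pk_cj_disjoint\<close>.\<close>

definition hits_once :: "nat \<Rightarrow> nat \<Rightarrow> (nat \<Rightarrow> nat) \<Rightarrow> bool" where
  "hits_once i j \<pi> \<longleftrightarrow> (\<forall>b\<in>Tr j. \<forall>b'\<in>Tr j. \<pi> b \<in> Tr i \<and> \<pi> b' \<in> Tr i \<longrightarrow> b = b')"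

context
  fixes i j :: nat and \<rho> :: "nat \<Rightarrow> nat"
  assumes \<rho>: "\<rho> permutes Tr i" and disj: "Tr i \<inter> Tr j = {}"
begin

lemma inv_on_Tr: "b \<in> Tr j \<Longrightarrow> inv \<rho> b = b"
  using permutes_not_in[OF permutes_inv[OF \<rho>]] disj by blast

lemma cj_on_Tr: "b \<in> Tr j \<Longrightarrow> cj \<rho> \<pi> b = \<rho> (\<pi> b)"
  by (simp add: cj_def inv_on_Tr)

lemma fxs_cj_disjoint: "fxs (Tr j) (cj \<rho> \<pi>) = fxs (Tr j) \<pi>"
proof -
  have "inv \<rho> ` Tr j = Tr j" using inv_on_Tr by force
  thus ?thesis by (simp add: fxs_cj[OF \<rho>])
qed

lemma good_cj_disjoint: "good (Tr j) (cj \<rho> \<pi>) \<longleftrightarrow> good (Tr j) \<pi>"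
  by (rule good_cj[OF \<rho> permutes_mem_iff_disjoint[OF \<rho> disj]])

lemma hits_once_cj: "hits_once i j (cj \<rho> \<pi>) \<longleftrightarrow> hits_once i j \<pi>"
  unfolding hits_once_def using cj_on_Tr permutes_in_image[OF \<rho>] by simp

lemma pk_cj_disjoint:
  assumes h: "hits_once i j \<pi>" and j: "j \<ge> 1"
  shows "pk j (cj \<rho> \<pi>) = pk j \<pi>"
proof -
  have T: "j - 1 \<in> Tr j" "j \<in> Tr j" "j + 1 \<in> Tr j" by (auto simp: Tr_def)
  have "\<rho> (\<pi> b) < \<rho> (\<pi> b') \<longleftrightarrow> \<pi> b < \<pi> b'" if "b \<in> Tr j" "b' \<in> Tr j" "b \<noteq> b'" for b b'
    by (rule interval_like_permutes_less[OF \<rho> Tr_interval]) (use h that in \<open>auto simp: hits_once_def\<close>)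
  thus ?thesis using T j by (auto simp: pk_def cj_on_Tr)
qed

end

definition offdiag :: "nat set \<Rightarrow> (nat \<times> nat) set" where
  "offdiag B = {(a, b) \<in> B \<times> B. a \<noteq> b}"

context random_conjugate
begin

lemma Tr_subset: "i \<in> {2..<n} \<Longrightarrow> Tr i \<subseteq> {1..n}"
  by (auto simp: Tr_def)

text \<open>Let \<open>a\<close> and \<open>b\<close> be the weights of two and of three fixed
  points in the triple, relative to \<open>h\<close>; by symmetry all pairs have the same weight.
  The runs of length two and three contribute \<open>(EE h - a) / 2\<close> and
  \<open>(EE h - 3 * a + 2 * b) / 6\<close>. In the difference the pair terms cancel, leaving
  \<open>(EE h - b) / 3\<close>.\<close>

lemma peak_symmetrize:
  assumes i: "i \<in> {2..<n}"
    and inv: "\<And>\<rho> \<pi>. \<rho> permutes Tr i \<Longrightarrow> \<pi> \<in> Cl \<Longrightarrow> h (cj \<rho> \<pi>) = h \<pi>"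
    and sup: "\<And>\<pi>. \<pi> \<in> Cl \<Longrightarrow> h \<pi> \<noteq> 0 \<Longrightarrow> good (Tr i) \<pi>"
  shows "EE (\<lambda>\<pi>. pk i \<pi> * h \<pi>) = EE (\<lambda>\<pi>. (1 - fxs (Tr i) \<pi>) / 3 * h \<pi>)"
proof -
  define p where "p = i - 1"
  have ip: "i = p + 1" "p \<ge> 1" using i by (auto simp: p_def)
  have T: "Tr i = {p..p + 2}" by (simp add: Tr_def ip)
  have Tn: "{p..p + 2} \<subseteq> {1..n}" using Tr_subset[OF i] T by simp
  let ?D2 = "{p + 1..p + 1 + 1}" and ?D3 = "{p..p + 2}"
  have s2: "?D2 \<subseteq> ?D3" by auto
  have e2: "2 * EE (\<lambda>\<pi>. of_bool (decr ?D2 \<pi>) * h \<pi>) = EE (\<lambda>\<pi>. of_bool (few ?D2 \<pi>) * h \<pi>)"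
  proof -
    have "fact (card ?D2) * EE (\<lambda>\<pi>. of_bool (decr ?D2 \<pi>) * h \<pi>) = EE (\<lambda>\<pi>. of_bool (few ?D2 \<pi>) * h \<pi>)"
    proof (rule symmetrize_decr)
      show "?D2 \<subseteq> {1..n}" using s2 Tn by (rule subset_trans)
      show "h (cj \<rho> \<pi>) = h \<pi>" if "\<rho> permutes ?D2" "\<pi> \<in> Cl" for \<rho> \<pi>
        using inv that permutes_subset[OF that(1) s2] T by simp
      show "good ?D2 \<pi>" if "\<pi> \<in> Cl" "h \<pi> \<noteq> 0" for \<pi>
        using good_subset[OF _ s2] sup[OF that] T by simp
    qed (rule interval_like_atLeastAtMost)
    moreover have "card ?D2 = 2" by simp
    ultimately show ?thesis by (simp only: fact_2)
  qed
  have e3: "6 * EE (\<lambda>\<pi>. of_bool (decr ?D3 \<pi>) * h \<pi>) = EE (\<lambda>\<pi>. of_bool (few ?D3 \<pi>) * h \<pi>)"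
  proof -
    have "fact (card ?D3) * EE (\<lambda>\<pi>. of_bool (decr ?D3 \<pi>) * h \<pi>) = EE (\<lambda>\<pi>. of_bool (few ?D3 \<pi>) * h \<pi>)"
      by (rule symmetrize_decr[OF Tn interval_like_atLeastAtMost]) (use inv sup T in auto)
    moreover have "card ?D3 = 3" by simp
    moreover have "fact 3 = (6 :: real)" by (simp add: fact_numeral)
    ultimately show ?thesis by (simp only:)
  qed
  have sw: "EE (\<lambda>\<pi>. fxs A \<pi> * h \<pi>) = EE (\<lambda>\<pi>. fxs (transpose a b ` A) \<pi> * h \<pi>)"
    if ab: "a \<in> Tr i" "b \<in> Tr i" for a b A
  proof -
    have tp: "transpose a b permutes Tr i" using ab by (rule permutes_swap_id)
    have "EE (\<lambda>\<pi>. fxs A \<pi> * h \<pi>) = EE (\<lambda>\<pi>. fxs A (cj (transpose a b) \<pi>) * h (cj (transpose a b) \<pi>))"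
      by (rule EE_transpose[symmetric]) (use ab Tr_subset[OF i] in blast)+
    also have "\<dots> = EE (\<lambda>\<pi>. fxs (transpose a b ` A) \<pi> * h \<pi>)"
      by (rule EE_cong) (use inv[OF tp] in \<open>simp add: fxs_cj[OF tp] inv_transpose_eq\<close>)
    finally show ?thesis .
  qed
  let ?a = "EE (\<lambda>\<pi>. fxs {p + 1, p + 2} \<pi> * h \<pi>)" and ?b = "EE (\<lambda>\<pi>. fxs {p, p + 1, p + 2} \<pi> * h \<pi>)"
  have "transpose p (p + 2) ` {p, p + 1} = {p + 1, p + 2}"
    by (auto simp: transpose_def)
  hence a1: "EE (\<lambda>\<pi>. fxs {p, p + 1} \<pi> * h \<pi>) = ?a"
    using sw[of p "p + 2" "{p, p + 1}"] T by auto
  have "transpose p (p + 1) ` {p, p + 2} = {p + 1, p + 2}"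
    by (auto simp: transpose_def)
  hence a2: "EE (\<lambda>\<pi>. fxs {p, p + 2} \<pi> * h \<pi>) = ?a"
    using sw[of p "p + 1" "{p, p + 2}"] T by auto
  have p2: "p + 1 + 1 = p + 2" by simp
  have fw: "of_bool (few ?D2 \<pi>) = 1 - fxs {p + 1, p + 2} \<pi>" for \<pi>
    using few2[of "p + 1" \<pi>] unfolding p2 .
  have f2: "EE (\<lambda>\<pi>. of_bool (few ?D2 \<pi>) * h \<pi>) = EE h - ?a"
    unfolding fw by (simp only: left_diff_distrib EE_diff mult_1_left)
  have f3: "EE (\<lambda>\<pi>. of_bool (few ?D3 \<pi>) * h \<pi>) = EE h - 3 * ?a + 2 * ?b"
    unfolding few3 by (simp only: left_diff_distrib distrib_right EE_diff EE_add EE_cmult mult.assoc a1 a2 mult_1_left)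
  have "EE (\<lambda>\<pi>. pk i \<pi> * h \<pi>) = EE (\<lambda>\<pi>. of_bool (decr ?D2 \<pi>) * h \<pi>) - EE (\<lambda>\<pi>. of_bool (decr ?D3 \<pi>) * h \<pi>)"
    unfolding EE_diff[symmetric] ip(1)
  proof (rule EE_cong)
    fix \<pi> assume "\<pi> \<in> Cl"
    hence "inj \<pi>" using perms_bij[OF Cl_perms] bij_is_inj by blast
    thus "pk (p + 1) \<pi> * h \<pi> = of_bool (decr ?D2 \<pi>) * h \<pi> - of_bool (decr ?D3 \<pi>) * h \<pi>"
      by (simp only: pk_decr left_diff_distrib)
  qed
  also have "\<dots> = (EE h - ?a) / 2 - (EE h - 3 * ?a + 2 * ?b) / 6"
  proof -
    have "x - y = (e - a) / 2 - (e - 3 * a + 2 * b) / 6"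
      if "2 * x = u" "6 * y = v" "u = e - a" "v = e - 3 * a + 2 * b" for x y u v e a b :: real
      using that by (simp add: field_simps)
    from this[OF e2 e3 f2 f3] show ?thesis .
  qed
  also have "\<dots> = (EE h - ?b) / 3" by (simp add: field_simps)
  also have "\<dots> = EE (\<lambda>\<pi>. (1 - fxs (Tr i) \<pi>) / 3 * h \<pi>)"
    unfolding T interval3 by (simp add: left_diff_distrib EE_diff EE_divide)
  finally show ?thesis .
qed

text \<open>Peak indicator minus its average over the permutations of the triple. The factor for the
  good event makes the orthogonality in \<open>W_orthogonal\<close> exact.\<close>

definition W :: "nat \<Rightarrow> (nat \<Rightarrow> nat) \<Rightarrow> real" where
  "W i \<pi> = (pk i \<pi> - (1 - fxs (Tr i) \<pi>) / 3) * of_bool (good (Tr i) \<pi>)"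

lemma W_bound: "\<bar>W i \<pi>\<bar> \<le> 1"
proof -
  have "\<bar>pk i \<pi> - (1 - fxs (Tr i) \<pi>) / 3\<bar> \<le> 1"
    using pk_bounds(1,2)[of i \<pi>] fxs_bounds[of "Tr i" \<pi>] by (auto simp: abs_le_iff field_simps)
  thus ?thesis by (cases "good (Tr i) \<pi>") (simp_all add: W_def)
qed

lemma W_orthogonal:
  assumes i: "i \<in> {2..<n}"
    and inv: "\<And>\<rho> \<pi>. \<rho> permutes Tr i \<Longrightarrow> \<pi> \<in> Cl \<Longrightarrow> h (cj \<rho> \<pi>) = h \<pi>"
  shows "EE (\<lambda>\<pi>. W i \<pi> * h \<pi>) = 0"
proof -
  let ?h = "\<lambda>\<pi>. of_bool (good (Tr i) \<pi>) * h \<pi>"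
  have "EE (\<lambda>\<pi>. pk i \<pi> * ?h \<pi>) = EE (\<lambda>\<pi>. (1 - fxs (Tr i) \<pi>) / 3 * ?h \<pi>)"
  proof (rule peak_symmetrize[OF i])
    fix \<rho> \<pi> assume \<rho>: "\<rho> permutes Tr i" and \<pi>: "\<pi> \<in> Cl"
    show "?h (cj \<rho> \<pi>) = ?h \<pi>"
      using inv[OF \<rho> \<pi>] good_cj[OF \<rho> permutes_in_image[OF \<rho>]] by simp
  qed auto
  moreover have "EE (\<lambda>\<pi>. W i \<pi> * h \<pi>) = EE (\<lambda>\<pi>. pk i \<pi> * ?h \<pi>) - EE (\<lambda>\<pi>. (1 - fxs (Tr i) \<pi>) / 3 * ?h \<pi>)"
    unfolding EE_diff[symmetric] W_def by (intro EE_cong) (simp add: algebra_simps)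
  ultimately show ?thesis by simp
qed

lemma EE_W: "i \<in> {2..<n} \<Longrightarrow> EE (W i) = 0"
  using W_orthogonal[of i "\<lambda>_. 1"] by simp

lemma EE_W_fxs: "i \<in> {2..<n} \<Longrightarrow> Tr i \<inter> Tr j = {} \<Longrightarrow> EE (\<lambda>\<pi>. W i \<pi> * fxs (Tr j) \<pi>) = 0"
  by (rule W_orthogonal) (simp_all add: fxs_cj_disjoint)

lemma offdiag_card: "finite B \<Longrightarrow> finite (offdiag B) \<and> card (offdiag B) \<le> card B * card B"
proof -
  assume B: "finite B"
  have s: "offdiag B \<subseteq> B \<times> B" by (auto simp: offdiag_def)
  have f: "finite (B \<times> B)" using B by simp
  show ?thesis using finite_subset[OF s f] card_mono[OF f s] by (simp add: card_cartesian_product)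
qed

lemma bad_le_sum:
  assumes "finite B"
  shows "of_bool (\<not> good B \<pi>) \<le> (\<Sum>x\<in>offdiag B. of_bool (\<pi> (fst x) = snd x) :: real)"
proof (cases "good B \<pi>")
  case True thus ?thesis by (auto intro!: sum_nonneg)
next
  case False
  then obtain x where x: "x \<in> B" "\<pi> x \<in> B" "\<pi> x \<noteq> x" unfolding good_def by blast
  hence m: "(x, \<pi> x) \<in> offdiag B" by (auto simp: offdiag_def)
  have "of_bool (\<pi> (fst (x, \<pi> x)) = snd (x, \<pi> x)) \<le> (\<Sum>x\<in>offdiag B. of_bool (\<pi> (fst x) = snd x) :: real)"
    by (rule member_le_sum[OF m]) (use offdiag_card[OF assms] in auto)
  thus ?thesis using False by simp
qed

lemma EE_bad:
  assumes B: "B \<subseteq> {1..n}"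
  shows "EE (\<lambda>\<pi>. of_bool (\<not> good B \<pi>)) \<le> 2 * real (card B) ^ 2 / real n"
proof -
  have fB: "finite B" using B finite_subset by blast
  have "EE (\<lambda>\<pi>. of_bool (\<not> good B \<pi>)) \<le> EE (\<lambda>\<pi>. \<Sum>x\<in>offdiag B. of_bool (\<pi> (fst x) = snd x))"
    by (rule EE_mono) (rule bad_le_sum[OF fB])
  also have "\<dots> = (\<Sum>x\<in>offdiag B. EE (\<lambda>\<pi>. of_bool (\<pi> (fst x) = snd x)))" by (rule EE_sum)
  also have "\<dots> \<le> (\<Sum>x\<in>offdiag B. 2 / real n)"
    by (intro sum_mono EE_value_le) (use B in \<open>auto simp: offdiag_def\<close>)
  also have "\<dots> = real (card (offdiag B)) * (2 / real n)" by simp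
  also have "\<dots> \<le> real (card B * card B) * (2 / real n)"
    using offdiag_card[OF fB] by (intro mult_right_mono) (simp_all only: of_nat_le_iff, auto)
  finally show ?thesis by (simp add: power2_eq_square mult_ac)
qed

lemma EE_bad_Tr:
  assumes i: "i \<in> {2..<n}"
  shows "EE (\<lambda>\<pi>. of_bool (\<not> good (Tr i) \<pi>)) \<le> 18 / real n"
proof -
  have "EE (\<lambda>\<pi>. of_bool (\<not> good (Tr i) \<pi>)) \<le> 2 * real (card (Tr i)) ^ 2 / real n"
    by (rule EE_bad[OF Tr_subset[OF i]])
  also have "\<dots> \<le> 2 * 3 ^ 2 / real n"
    using Tr_card[of i] by (intro divide_right_mono mult_left_mono power_mono) auto
  finally show ?thesis by simp
qed

text \<open>Union bound over at most \<open>9 * 9\<close> choices, each of probability at most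
  \<open>4 / n^2\<close>. The arrows are parameters because the four points get paired in two ways:
  within each triple in \<open>EE_two_bad\<close>, and from one triple to the other in
  \<open>EE_hits_twice\<close>.\<close>

lemma EE_pairs_le:
  assumes A: "A \<subseteq> {1..n}" and B: "B \<subseteq> {1..n}" and AB: "A \<inter> B = {}"
    and c: "card A \<le> 3" "card B \<le> 3" and n6: "n \<ge> 6"
    and f: "\<And>x y. x \<in> offdiag A \<Longrightarrow> y \<in> offdiag B \<Longrightarrow>
      {a x y, b x y, c' x y, d x y} = {fst x, snd x, fst y, snd y} \<and> distinct [a x y, b x y, c' x y, d x y]"
    and h: "\<And>\<pi>. \<pi> \<in> Cl \<Longrightarrow> h \<pi> \<le> (\<Sum>x\<in>offdiag A. \<Sum>y\<in>offdiag B. of_bool (\<pi> (a x y) = b x y \<and> \<pi> (c' x y) = d x y))"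
  shows "EE h \<le> 324 / real n ^ 2"
proof -
  have fA: "finite A" "finite B" using A B finite_subset by blast+
  have "EE h \<le> EE (\<lambda>\<pi>. \<Sum>x\<in>offdiag A. \<Sum>y\<in>offdiag B. of_bool (\<pi> (a x y) = b x y \<and> \<pi> (c' x y) = d x y))"
    by (rule EE_mono[OF h])
  also have "\<dots> = (\<Sum>x\<in>offdiag A. \<Sum>y\<in>offdiag B. EE (\<lambda>\<pi>. of_bool (\<pi> (a x y) = b x y \<and> \<pi> (c' x y) = d x y)))"
    by (simp only: EE_sum)
  also have "\<dots> \<le> (\<Sum>x\<in>offdiag A. \<Sum>y\<in>offdiag B. 4 / real n ^ 2)"
  proof (intro sum_mono EE_two_values_le)
    fix x y assume xy: "x \<in> offdiag A" "y \<in> offdiag B"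
    show "{a x y, b x y, c' x y, d x y} \<subseteq> {1..n}"
      using f[OF xy] xy A B by (auto simp: offdiag_def)
    show "distinct [a x y, b x y, c' x y, d x y]" using f[OF xy] by blast
  qed (rule n6)
  also have "\<dots> = real (card (offdiag A) * card (offdiag B)) * (4 / real n ^ 2)" by simp
  also have "\<dots> \<le> real ((3 * 3) * (3 * 3)) * (4 / real n ^ 2)"
  proof (intro mult_right_mono)
    have "card (offdiag A) \<le> 3 * 3" "card (offdiag B) \<le> 3 * 3"
      using offdiag_card[OF fA(1)] offdiag_card[OF fA(2)] mult_le_mono[OF c(1) c(1)] mult_le_mono[OF c(2) c(2)]
      by linarith+
    thus "real (card (offdiag A) * card (offdiag B)) \<le> real ((3 * 3) * (3 * 3))"
      unfolding of_nat_le_iff by (rule mult_le_mono)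
  qed auto
  finally show ?thesis by simp
qed

lemma EE_two_bad:
  assumes ij: "i \<in> {2..<n}" "j \<in> {2..<n}" "Tr i \<inter> Tr j = {}" and n6: "n \<ge> 6"
  shows "EE (\<lambda>\<pi>. of_bool (\<not> good (Tr i) \<pi>) * of_bool (\<not> good (Tr j) \<pi>)) \<le> 324 / real n ^ 2"
proof (rule EE_pairs_le[OF Tr_subset[OF ij(1)] Tr_subset[OF ij(2)] ij(3) Tr_card Tr_card n6,
      where a = "\<lambda>x y. fst x" and b = "\<lambda>x y. snd x" and c' = "\<lambda>x y. fst y" and d = "\<lambda>x y. snd y"])
  fix \<pi>
  have "of_bool (\<not> good (Tr i) \<pi>) * of_bool (\<not> good (Tr j) \<pi>)
    \<le> (\<Sum>x\<in>offdiag (Tr i). of_bool (\<pi> (fst x) = snd x) :: real) * (\<Sum>y\<in>offdiag (Tr j). of_bool (\<pi> (fst y) = snd y))"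
    using bad_le_sum[OF Tr_finite[of i], of \<pi>] bad_le_sum[OF Tr_finite[of j], of \<pi>]
    by (intro mult_mono) (auto intro!: sum_nonneg)
  also have "\<dots> = (\<Sum>x\<in>offdiag (Tr i). \<Sum>y\<in>offdiag (Tr j). of_bool (\<pi> (fst x) = snd x \<and> \<pi> (fst y) = snd y))"
    unfolding sum_product of_bool_conj ..
  finally show "of_bool (\<not> good (Tr i) \<pi>) * of_bool (\<not> good (Tr j) \<pi>)
    \<le> (\<Sum>x\<in>offdiag (Tr i). \<Sum>y\<in>offdiag (Tr j). of_bool (\<pi> (fst x) = snd x \<and> \<pi> (fst y) = snd y) :: real)" .
next
  fix x y assume "x \<in> offdiag (Tr i)" "y \<in> offdiag (Tr j)"
  thus "{fst x, snd x, fst y, snd y} = {fst x, snd x, fst y, snd y} \<and> distinct [fst x, snd x, fst y, snd y]"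
    using ij(3) by (auto simp: offdiag_def)
qed

lemma EE_hits_twice:
  assumes ij: "i \<in> {2..<n}" "j \<in> {2..<n}" "Tr i \<inter> Tr j = {}" and n6: "n \<ge> 6"
  shows "EE (\<lambda>\<pi>. of_bool (\<not> hits_once i j \<pi>)) \<le> 324 / real n ^ 2"
proof (rule EE_pairs_le[OF Tr_subset[OF ij(1)] Tr_subset[OF ij(2)] ij(3) Tr_card Tr_card n6,
      where a = "\<lambda>x y. fst y" and b = "\<lambda>x y. fst x" and c' = "\<lambda>x y. snd y" and d = "\<lambda>x y. snd x"])
  fix \<pi> assume \<pi>: "\<pi> \<in> Cl"
  let ?g = "\<lambda>x y. of_bool (\<pi> (fst y) = fst x \<and> \<pi> (snd y) = snd x) :: real"
  show "of_bool (\<not> hits_once i j \<pi>) \<le> (\<Sum>x\<in>offdiag (Tr i). \<Sum>y\<in>offdiag (Tr j). ?g x y)"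
  proof (cases "hits_once i j \<pi>")
    case True thus ?thesis by (auto intro!: sum_nonneg)
  next
    case False
    then obtain b b' where b: "b \<in> Tr j" "b' \<in> Tr j" "\<pi> b \<in> Tr i" "\<pi> b' \<in> Tr i" "b \<noteq> b'"
      unfolding hits_once_def by blast
    have "\<pi> b \<noteq> \<pi> b'" using b(5) perms_inverses(2)[OF Cl_perms[OF \<pi>]] by metis
    hence m: "(\<pi> b, \<pi> b') \<in> offdiag (Tr i)" "(b, b') \<in> offdiag (Tr j)" using b by (auto simp: offdiag_def)
    have "?g (\<pi> b, \<pi> b') (b, b') \<le> (\<Sum>y\<in>offdiag (Tr j). ?g (\<pi> b, \<pi> b') y)"
      by (rule member_le_sum[OF m(2)]) (use offdiag_card[OF Tr_finite] in auto)
    also have "\<dots> \<le> (\<Sum>x\<in>offdiag (Tr i). \<Sum>y\<in>offdiag (Tr j). ?g x y)"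
      by (rule member_le_sum[OF m(1)]) (use offdiag_card[OF Tr_finite] in \<open>auto intro!: sum_nonneg\<close>)
    finally show ?thesis using False by simp
  qed
next
  fix x y assume "x \<in> offdiag (Tr i)" "y \<in> offdiag (Tr j)"
  thus "{fst y, fst x, snd y, snd x} = {fst x, snd x, fst y, snd y} \<and> distinct [fst y, fst x, snd y, snd x]"
    using ij(3) by (auto simp: offdiag_def)
qed

text \<open>On \<open>hits_once i j\<close> the factor \<open>W j\<close> is invariant under
  permutations of \<open>Tr i\<close>, so that part is orthogonal to \<open>W i\<close>. The
  complement has probability \<open>O(1/n^2)\<close>.\<close>

lemma EE_W_W:
  assumes ij: "i \<in> {2..<n}" "j \<in> {2..<n}" "Tr i \<inter> Tr j = {}" and n6: "n \<ge> 6"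
  shows "\<bar>EE (\<lambda>\<pi>. W i \<pi> * W j \<pi>)\<bar> \<le> 324 / real n ^ 2"
proof -
  have "EE (\<lambda>\<pi>. W i \<pi> * (W j \<pi> * of_bool (hits_once i j \<pi>))) = 0"
  proof (rule W_orthogonal[OF ij(1)])
    fix \<rho> \<pi> assume \<rho>: "\<rho> permutes Tr i"
    show "W j (cj \<rho> \<pi>) * of_bool (hits_once i j (cj \<rho> \<pi>)) = W j \<pi> * of_bool (hits_once i j \<pi>)"
    proof (cases "hits_once i j \<pi>")
      case True
      have "pk j (cj \<rho> \<pi>) = pk j \<pi>" using pk_cj_disjoint[OF \<rho> ij(3) True] ij(2) by simp
      thus ?thesis unfolding W_def fxs_cj_disjoint[OF \<rho> ij(3)] good_cj_disjoint[OF \<rho> ij(3)]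
          hits_once_cj[OF \<rho> ij(3)] by simp
    next
      case False thus ?thesis by (simp add: hits_once_cj[OF \<rho> ij(3)])
    qed
  qed
  hence "EE (\<lambda>\<pi>. W i \<pi> * W j \<pi>)
    = EE (\<lambda>\<pi>. W i \<pi> * W j \<pi> - W i \<pi> * (W j \<pi> * of_bool (hits_once i j \<pi>)))"
    by (simp add: EE_diff)
  moreover have "\<bar>EE (\<lambda>\<pi>. W i \<pi> * W j \<pi> - W i \<pi> * (W j \<pi> * of_bool (hits_once i j \<pi>)))\<bar>
    \<le> EE (\<lambda>\<pi>. of_bool (\<not> hits_once i j \<pi>))"
  proof (rule EE_abs_le)
    fix \<pi>
    have "\<bar>W i \<pi> * W j \<pi>\<bar> \<le> 1 * 1" unfolding abs_mult using W_bound by (intro mult_mono) auto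
    thus "\<bar>W i \<pi> * W j \<pi> - W i \<pi> * (W j \<pi> * of_bool (hits_once i j \<pi>))\<bar> \<le> of_bool (\<not> hits_once i j \<pi>)"
      by (cases "hits_once i j \<pi>") auto
  qed
  ultimately show ?thesis using EE_hits_twice[OF ij n6] by linarith
qed

end

subsection \<open>Peaks at distance two\<close>

lemma interval4: "{p..p + 3} = {p, p + 1, p + 2, p + (3::nat)}"
  and interval5: "{p..p + 4} = {p, p + 1, p + 2, p + 3, p + (4::nat)}"
  by auto

lemma fxs_mult: "fxs A \<pi> * fxs B \<pi> = fxs (A \<union> B) \<pi>"
  by (auto simp: fxs_def)

lemma few_quadruple:
  assumes "distinct [a, b, c, d]"
  shows "of_bool (few {a, b, c, d} \<pi>) = 1 - (fxs {a, b} \<pi> + fxs {a, c} \<pi> + fxs {a, d} \<pi>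
    + fxs {b, c} \<pi> + fxs {b, d} \<pi> + fxs {c, d} \<pi>)
    + 2 * (fxs {a, b, c} \<pi> + fxs {a, b, d} \<pi> + fxs {a, c, d} \<pi> + fxs {b, c, d} \<pi>)
    - 3 * fxs {a, b, c, d} \<pi>"
  using assms
  by (cases "\<pi> a = a"; cases "\<pi> b = b"; cases "\<pi> c = c"; cases "\<pi> d = d") (simp_all add: few_def fxs_def)

lemma few_quintuple:
  assumes "distinct [a, b, c, d, e]"
  shows "of_bool (few {a, b, c, d, e} \<pi>) = 1 - (fxs {a, b} \<pi> + fxs {a, c} \<pi> + fxs {a, d} \<pi> + fxs {a, e} \<pi>
    + fxs {b, c} \<pi> + fxs {b, d} \<pi> + fxs {b, e} \<pi> + fxs {c, d} \<pi> + fxs {c, e} \<pi> + fxs {d, e} \<pi>)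
    + 2 * (fxs {a, b, c} \<pi> + fxs {a, b, d} \<pi> + fxs {a, b, e} \<pi> + fxs {a, c, d} \<pi> + fxs {a, c, e} \<pi>
      + fxs {a, d, e} \<pi> + fxs {b, c, d} \<pi> + fxs {b, c, e} \<pi> + fxs {b, d, e} \<pi> + fxs {c, d, e} \<pi>)
    - 3 * (fxs {a, b, c, d} \<pi> + fxs {a, b, c, e} \<pi> + fxs {a, b, d, e} \<pi> + fxs {a, c, d, e} \<pi> + fxs {b, c, d, e} \<pi>)
    + 4 * fxs {a, b, c, d, e} \<pi>"
  using assms
  by (cases "\<pi> a = a"; cases "\<pi> b = b"; cases "\<pi> c = c"; cases "\<pi> d = d"; cases "\<pi> e = e")
    (simp_all add: few_def fxs_def)

lemma decr_join:
  assumes "a \<le> b" "b \<le> c"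
  shows "decr {a..b} \<pi> \<and> decr {b..c} \<pi> \<longleftrightarrow> decr {a..c} \<pi>"
proof
  assume d: "decr {a..b} \<pi> \<and> decr {b..c} \<pi>"
  show "decr {a..c} \<pi>" unfolding decr_def
  proof (intro ballI impI)
    fix x y assume xy: "x \<in> {a..c}" "y \<in> {a..c}" "x < y"
    consider "y \<le> b" | "b \<le> x" | "x < b" "b < y" by linarith
    thus "\<pi> y < \<pi> x"
    proof cases
      case 1
      hence "x \<in> {a..b}" "y \<in> {a..b}" using xy by auto
      thus ?thesis using d xy(3) unfolding decr_def by blast
    next
      case 2
      hence "x \<in> {b..c}" "y \<in> {b..c}" using xy by auto
      thus ?thesis using d xy(3) unfolding decr_def by blast
    next
      case 3
      hence "x \<in> {a..b}" "b \<in> {a..b}" "b \<in> {b..c}" "y \<in> {b..c}" using xy by auto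
      hence "\<pi> b < \<pi> x" "\<pi> y < \<pi> b" using d 3 unfolding decr_def by blast+
      thus ?thesis by simp
    qed
  qed
next
  assume d: "decr {a..c} \<pi>"
  have "{a..b} \<subseteq> {a..c}" "{b..c} \<subseteq> {a..c}" using assms by auto
  thus "decr {a..b} \<pi> \<and> decr {b..c} \<pi>" using d unfolding decr_def by blast
qed

context random_conjugate
begin

text \<open>The blocks are symmetrized one after the other. Goodness of the common window
  \<open>J\<close> ensures that values on one block never lie in the other, so permuting one block
  leaves the values on the other untouched.\<close>

lemma symmetrize_two_blocks:
  assumes J: "J \<subseteq> {1..n}" and A: "A \<subseteq> J" "interval_like A" and B: "B \<subseteq> J" "interval_like B"
    and AB: "A \<inter> B = {}"
  shows "fact (card A) * fact (card B)
      * EE (\<lambda>\<pi>. of_bool (decr A \<pi>) * (of_bool (decr B \<pi>) * of_bool (good J \<pi>)))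
    = EE (\<lambda>\<pi>. of_bool (few A \<pi>) * (of_bool (few B \<pi>) * of_bool (good J \<pi>)))"
proof -
  have stay: "cj \<rho> \<pi> b = \<pi> b" if "\<rho> permutes A'" "A' \<inter> B' = {}" "A' \<subseteq> J" "B' \<subseteq> J" "good J \<pi>" "b \<in> B'"
    for A' B' \<rho> \<pi> b
  proof -
    have bA: "b \<notin> A'" using that by blast
    hence "\<pi> b \<notin> A'" using that unfolding good_def by (metis subsetD)
    thus ?thesis using bA permutes_not_in[OF that(1)] permutes_not_in[OF permutes_inv[OF that(1)]]
      by (simp add: cj_def)
  qed
  have g: "good J (cj \<rho> \<pi>) \<longleftrightarrow> good J \<pi>" if "\<rho> permutes A'" "A' \<subseteq> J" for A' \<rho> \<pi>
    by (rule good_cj[OF that(1) permutes_mem_iff_subset[OF that]])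
  have An: "A \<subseteq> {1..n}" "B \<subseteq> {1..n}" using A B J by auto
  have 1: "fact (card A) * EE (\<lambda>\<pi>. of_bool (decr A \<pi>) * (of_bool (decr B \<pi>) * of_bool (good J \<pi>)))
    = EE (\<lambda>\<pi>. of_bool (few A \<pi>) * (of_bool (decr B \<pi>) * of_bool (good J \<pi>)))"
  proof (rule symmetrize_decr[OF An(1) A(2)])
    fix \<rho> \<pi> assume \<rho>: "\<rho> permutes A"
    have "good J \<pi> \<Longrightarrow> decr B (cj \<rho> \<pi>) \<longleftrightarrow> decr B \<pi>"
      using stay[OF \<rho> AB A(1) B(1)] by (simp add: decr_def)
    thus "of_bool (decr B (cj \<rho> \<pi>)) * of_bool (good J (cj \<rho> \<pi>)) = (of_bool (decr B \<pi>) * of_bool (good J \<pi>) :: real)"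
      using g[OF \<rho> A(1), of \<pi>] by (cases "good J \<pi>") simp_all
  qed (use good_subset[OF _ A(1)] in auto)
  have 2: "fact (card B) * EE (\<lambda>\<pi>. of_bool (decr B \<pi>) * (of_bool (few A \<pi>) * of_bool (good J \<pi>)))
    = EE (\<lambda>\<pi>. of_bool (few B \<pi>) * (of_bool (few A \<pi>) * of_bool (good J \<pi>)))"
  proof (rule symmetrize_decr[OF An(2) B(2)])
    fix \<rho> \<pi> assume \<rho>: "\<rho> permutes B"
    have "good J \<pi> \<Longrightarrow> few A (cj \<rho> \<pi>) \<longleftrightarrow> few A \<pi>"
      using stay[OF \<rho> _ B(1) A(1)] AB by (simp add: few_def Int_commute)
    thus "of_bool (few A (cj \<rho> \<pi>)) * of_bool (good J (cj \<rho> \<pi>)) = (of_bool (few A \<pi>) * of_bool (good J \<pi>) :: real)"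
      using g[OF \<rho> B(1), of \<pi>] by (cases "good J \<pi>") simp_all
  qed (use good_subset[OF _ B(1)] in auto)
  have "fact (card A) * fact (card B)
      * EE (\<lambda>\<pi>. of_bool (decr A \<pi>) * (of_bool (decr B \<pi>) * of_bool (good J \<pi>)))
    = fact (card B) * EE (\<lambda>\<pi>. of_bool (few A \<pi>) * (of_bool (decr B \<pi>) * of_bool (good J \<pi>)))"
    unfolding 1[symmetric] by (simp only: mult_ac)
  also have "EE (\<lambda>\<pi>. of_bool (few A \<pi>) * (of_bool (decr B \<pi>) * of_bool (good J \<pi>)))
    = EE (\<lambda>\<pi>. of_bool (decr B \<pi>) * (of_bool (few A \<pi>) * of_bool (good J \<pi>)))"
    by (rule EE_cong) (simp only: mult_ac)
  also note 2
  also have "EE (\<lambda>\<pi>. of_bool (few B \<pi>) * (of_bool (few A \<pi>) * of_bool (good J \<pi>)))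
    = EE (\<lambda>\<pi>. of_bool (few A \<pi>) * (of_bool (few B \<pi>) * of_bool (good J \<pi>)))"
    by (rule EE_cong) (simp only: mult_ac)
  finally show ?thesis .
qed

text \<open>Both peaks are differences of decreasing runs. In their product the runs sharing
  position \<open>p + 2\<close> join to longer ones, so four products of run indicators remain, each
  evaluated on the good window of five positions.\<close>

lemma EE_two_peaks:
  assumes i: "i \<in> {2..<n}" "i + 2 < n"
  shows "\<bar>EE (\<lambda>\<pi>. pk i \<pi> * pk (i + 2) \<pi>) - (2 / 15 - q 3 / 3 + q 5 / 5)\<bar> \<le> 100 / real n"
proof -
  define p where "p = i - 1"
  have ip: "i = p + 1" "p \<ge> 1" "p + 4 \<le> n" using i by (auto simp: p_def)
  let ?J = "{p..p + 4}"
  let ?g = "\<lambda>\<pi>. of_bool (good ?J \<pi>) :: real"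
  let ?A2 = "{p + 1..p + 2}" and ?A3 = "{p..p + 2}" and ?B = "{p + 3..p + 4}"
    and ?A4 = "{p + 1..p + 4}" and ?A5 = "{p..p + 4}"
  let ?f = "\<lambda>A \<pi>. of_bool (few A \<pi>) :: real" and ?d = "\<lambda>A \<pi>. of_bool (decr A \<pi>) :: real"
  have J: "?J \<subseteq> {1..n}" using ip by auto
  \<comment> \<open>The denominators are \<open>2! * 2!\<close>, \<open>3! * 2!\<close>,
    \<open>4!\<close> and \<open>5!\<close>. In the mean of \<open>Z\<close> the terms with
    \<open>q 2\<close> and \<open>q 4\<close> cancel, and
    \<open>1/4 - 1/12 - 1/24 + 1/120 = 2/15\<close>.\<close>
  define Z where "Z \<pi> = ?f ?A2 \<pi> * ?f ?B \<pi> / 4 - ?f ?A3 \<pi> * ?f ?B \<pi> / 12 - ?f ?A4 \<pi> / 24 + ?f ?A5 \<pi> / 120" for \<pi>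
  have Zb: "\<bar>Z \<pi>\<bar> \<le> 1" for \<pi>
  proof -
    have "\<bar>of_bool a * of_bool b / 4 - of_bool c * of_bool b / 12 - of_bool d / 24 + of_bool e / 120\<bar> \<le> (1 :: real)"
      for a b c d e
      by (cases a; cases b; cases c; cases d; cases e) simp_all
    thus ?thesis unfolding Z_def .
  qed
  have sb: "fact (card A) * fact (card B)
      * EE (\<lambda>\<pi>. ?d A \<pi> * (?d B \<pi> * ?g \<pi>)) = EE (\<lambda>\<pi>. ?f A \<pi> * (?f B \<pi> * ?g \<pi>))"
    if "A \<subseteq> ?J" "interval_like A" "B \<subseteq> ?J" "interval_like B" "A \<inter> B = {}" for A B
    by (rule symmetrize_two_blocks[OF J that])
  have fct: "fact 3 = (6::real)" "fact 4 = (24::real)" "fact 5 = (120::real)"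
    by (simp_all add: fact_numeral)
  have crd: "card ?A2 = 2" "card ?A3 = 3" "card ?B = 2" "card ?A4 = 4" "card ?A5 = 5" by simp_all
  have il: "interval_like {}" by (simp add: interval_like_def)
  have e22: "4 * EE (\<lambda>\<pi>. ?d ?A2 \<pi> * (?d ?B \<pi> * ?g \<pi>)) = EE (\<lambda>\<pi>. ?f ?A2 \<pi> * (?f ?B \<pi> * ?g \<pi>))"
    using sb[of ?A2 ?B] unfolding crd by (simp add: interval_like_atLeastAtMost)
  have e32: "12 * EE (\<lambda>\<pi>. ?d ?A3 \<pi> * (?d ?B \<pi> * ?g \<pi>)) = EE (\<lambda>\<pi>. ?f ?A3 \<pi> * (?f ?B \<pi> * ?g \<pi>))"
    using sb[of ?A3 ?B] unfolding crd by (simp add: interval_like_atLeastAtMost fct)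
  \<comment> \<open>An empty second block turns the two-block identity into one for a single
    block.\<close>
  have e4: "24 * EE (\<lambda>\<pi>. ?d ?A4 \<pi> * ?g \<pi>) = EE (\<lambda>\<pi>. ?f ?A4 \<pi> * ?g \<pi>)"
    using sb[of ?A4 "{}"] unfolding crd by (simp add: interval_like_atLeastAtMost fct il decr_def few_def)
  have e5: "120 * EE (\<lambda>\<pi>. ?d ?A5 \<pi> * ?g \<pi>) = EE (\<lambda>\<pi>. ?f ?A5 \<pi> * ?g \<pi>)"
    using sb[of ?A5 "{}"] unfolding crd by (simp add: interval_like_atLeastAtMost fct il decr_def few_def)
  have pkpk: "pk i \<pi> * pk (i + 2) \<pi> = ?d ?A2 \<pi> * ?d ?B \<pi> - ?d ?A3 \<pi> * ?d ?B \<pi> - ?d ?A4 \<pi> + ?d ?A5 \<pi>"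
    if "\<pi> \<in> Cl" for \<pi>
  proof -
    have inj: "inj \<pi>" using perms_bij[OF Cl_perms[OF that]] bij_is_inj by blast
    have e: "p + 1 + 1 = p + 2" "p + 3 + 1 = p + 4" "p + 2 + 1 = p + 3" "p + 2 + 2 = p + 4" "i + 2 = p + 2 + 1"
      using ip by simp_all
    have 1: "pk i \<pi> = ?d ?A2 \<pi> - ?d ?A3 \<pi>"
      using pk_decr[OF inj, of p] unfolding ip(1) e .
    have 2: "pk (i + 2) \<pi> = ?d ?B \<pi> - ?d {p + 2..p + 4} \<pi>"
      using pk_decr[OF inj, of "p + 2"] unfolding e .
    have j: "?d ?A4 \<pi> = ?d ?A2 \<pi> * ?d {p + 2..p + 4} \<pi>" "?d ?A5 \<pi> = ?d ?A3 \<pi> * ?d {p + 2..p + 4} \<pi>"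
      unfolding of_bool_conj[symmetric] by (subst decr_join; simp)+
    show ?thesis unfolding 1 2 j by (simp add: algebra_simps)
  qed
  have lin: "EE (\<lambda>\<pi>. (X \<pi> * Y \<pi> - U \<pi> * Y \<pi> - V \<pi> + R \<pi>) * ?g \<pi>)
    = EE (\<lambda>\<pi>. X \<pi> * (Y \<pi> * ?g \<pi>)) - EE (\<lambda>\<pi>. U \<pi> * (Y \<pi> * ?g \<pi>)) - EE (\<lambda>\<pi>. V \<pi> * ?g \<pi>) + EE (\<lambda>\<pi>. R \<pi> * ?g \<pi>)"
    for X Y U V R
    unfolding EE_diff[symmetric] EE_add[symmetric] by (rule EE_cong) (simp add: algebra_simps)
  have key: "EE (\<lambda>\<pi>. pk i \<pi> * pk (i + 2) \<pi> * ?g \<pi>) = EE (\<lambda>\<pi>. Z \<pi> * ?g \<pi>)"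
  proof -
    have "EE (\<lambda>\<pi>. pk i \<pi> * pk (i + 2) \<pi> * ?g \<pi>)
      = EE (\<lambda>\<pi>. (?d ?A2 \<pi> * ?d ?B \<pi> - ?d ?A3 \<pi> * ?d ?B \<pi> - ?d ?A4 \<pi> + ?d ?A5 \<pi>) * ?g \<pi>)"
      by (rule EE_cong) (simp only: pkpk)
    also have "\<dots> = EE (\<lambda>\<pi>. ?d ?A2 \<pi> * (?d ?B \<pi> * ?g \<pi>)) - EE (\<lambda>\<pi>. ?d ?A3 \<pi> * (?d ?B \<pi> * ?g \<pi>))
      - EE (\<lambda>\<pi>. ?d ?A4 \<pi> * ?g \<pi>) + EE (\<lambda>\<pi>. ?d ?A5 \<pi> * ?g \<pi>)" by (rule lin)
    also have "\<dots> = EE (\<lambda>\<pi>. ?f ?A2 \<pi> * (?f ?B \<pi> * ?g \<pi>)) / 4 - EE (\<lambda>\<pi>. ?f ?A3 \<pi> * (?f ?B \<pi> * ?g \<pi>)) / 12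
      - EE (\<lambda>\<pi>. ?f ?A4 \<pi> * ?g \<pi>) / 24 + EE (\<lambda>\<pi>. ?f ?A5 \<pi> * ?g \<pi>) / 120"
    proof -
      have "x1 - x2 - x3 + x4 = y1 / 4 - y2 / 12 - y3 / 24 + y4 / 120"
        if "4 * x1 = y1" "12 * x2 = y2" "24 * x3 = y3" "120 * x4 = y4" for x1 x2 x3 x4 y1 y2 y3 y4 :: real
        using that by auto
      from this[OF e22 e32 e4 e5] show ?thesis .
    qed
    also have "\<dots> = EE (\<lambda>\<pi>. Z \<pi> * ?g \<pi>)"
      unfolding EE_divide[symmetric] EE_diff[symmetric] EE_add[symmetric] Z_def
      by (rule EE_cong) (simp add: algebra_simps)
    finally show ?thesis .
  qed
  have EEZ: "EE Z = 2 / 15 - q 3 / 3 + q 5 / 5"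
  proof -
    have e: "p + 1 + 1 = p + 2" "p + 1 + 2 = p + 3" "p + 1 + 3 = p + 4" "p + 3 + 1 = p + 4" by simp_all
    have fA2: "?f ?A2 \<pi> = 1 - fxs {p + 1, p + 2} \<pi>" for \<pi> using few2[of "p + 1" \<pi>] unfolding e .
    have fB: "?f ?B \<pi> = 1 - fxs {p + 3, p + 4} \<pi>" for \<pi> using few2[of "p + 3" \<pi>] unfolding e .
    have E: "EE (fxs A) = q (card A)" if "A \<subseteq> ?J" for A using EE_fxs that J by blast
    have 1: "EE (\<lambda>\<pi>. ?f ?A2 \<pi> * ?f ?B \<pi>) = 1 - 2 * q 2 + q 4"
      unfolding fA2 fB
      by (simp add: algebra_simps fxs_mult EE_add EE_diff EE_cmult EE_const E card_insert_if numeral_2_eq_2[symmetric])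
    have 2: "EE (\<lambda>\<pi>. ?f ?A3 \<pi> * ?f ?B \<pi>) = 1 - 4 * q 2 + 2 * q 3 + 3 * q 4 - 2 * q 5"
      unfolding few3 fB
      by (simp add: algebra_simps fxs_mult EE_add EE_diff EE_cmult EE_const E card_insert_if numeral_2_eq_2[symmetric])
    have i4: "?A4 = {p + 1, p + 2, p + 3, p + 4}" using interval4[of "p + 1"] unfolding e .
    have 3: "EE (?f ?A4) = 1 - 6 * q 2 + 8 * q 3 - 3 * q 4"
      unfolding i4 by (subst few_quadruple) (simp_all add: EE_add EE_diff EE_cmult EE_const E card_insert_if numeral_2_eq_2[symmetric])
    have 4: "EE (?f ?A5) = 1 - 10 * q 2 + 20 * q 3 - 15 * q 4 + 4 * q 5"
      unfolding interval5
      by (subst few_quintuple) (simp_all add: EE_add EE_diff EE_cmult EE_const E[unfolded interval5] card_insert_if numeral_2_eq_2[symmetric])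
    have "EE Z = EE (\<lambda>\<pi>. ?f ?A2 \<pi> * ?f ?B \<pi>) / 4 - EE (\<lambda>\<pi>. ?f ?A3 \<pi> * ?f ?B \<pi>) / 12 - EE (?f ?A4) / 24 + EE (?f ?A5) / 120"
      unfolding EE_divide[symmetric] EE_diff[symmetric] EE_add[symmetric] Z_def[abs_def] ..
    thus ?thesis unfolding 1 2 3 4 by (simp add: field_simps)
  qed
  have "EE (\<lambda>\<pi>. pk i \<pi> * pk (i + 2) \<pi>) - EE Z = EE (\<lambda>\<pi>. (pk i \<pi> * pk (i + 2) \<pi> - Z \<pi>) * (1 - ?g \<pi>))"
  proof -
    have "EE (\<lambda>\<pi>. (pk i \<pi> * pk (i + 2) \<pi> - Z \<pi>) * (1 - ?g \<pi>))
      = EE (\<lambda>\<pi>. pk i \<pi> * pk (i + 2) \<pi>) - EE Z - (EE (\<lambda>\<pi>. pk i \<pi> * pk (i + 2) \<pi> * ?g \<pi>) - EE (\<lambda>\<pi>. Z \<pi> * ?g \<pi>))"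
      unfolding EE_diff[symmetric] by (rule EE_cong) (simp add: algebra_simps)
    thus ?thesis using key by simp
  qed
  moreover have "\<bar>EE (\<lambda>\<pi>. (pk i \<pi> * pk (i + 2) \<pi> - Z \<pi>) * (1 - ?g \<pi>))\<bar> \<le> EE (\<lambda>\<pi>. 2 * of_bool (\<not> good ?J \<pi>))"
  proof (rule EE_abs_le)
    fix \<pi>
    have "\<bar>pk i \<pi> * pk (i + 2) \<pi>\<bar> \<le> 1" by (auto simp: pk_def)
    hence "\<bar>pk i \<pi> * pk (i + 2) \<pi> - Z \<pi>\<bar> \<le> 2" using Zb[of \<pi>] by linarith
    thus "\<bar>(pk i \<pi> * pk (i + 2) \<pi> - Z \<pi>) * (1 - ?g \<pi>)\<bar> \<le> 2 * of_bool (\<not> good ?J \<pi>)"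
      by (cases "good ?J \<pi>") simp_all
  qed
  moreover have "EE (\<lambda>\<pi>. of_bool (\<not> good ?J \<pi>)) \<le> 50 / real n"
    using EE_bad[OF J] by simp
  ultimately show ?thesis unfolding EEZ EE_cmult by linarith
qed

end

subsection \<open>Mean and variance\<close>

lemma prod3_diff_le:
  fixes a b c d e f :: real
  assumes "\<bar>b\<bar> \<le> 1" "\<bar>c\<bar> \<le> 1" "\<bar>d\<bar> \<le> 1" "\<bar>e\<bar> \<le> 1"
  shows "\<bar>a * b * c - d * e * f\<bar> \<le> \<bar>a - d\<bar> + \<bar>b - e\<bar> + \<bar>c - f\<bar>"
proof -
  have m: "\<bar>x * y\<bar> \<le> \<bar>x\<bar>" if "\<bar>y\<bar> \<le> 1" for x y :: real
    using mult_left_mono[OF that, of "\<bar>x\<bar>"] by (simp add: abs_mult)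
  have "a * b * c - d * e * f = (a - d) * (b * c) + (b - e) * (d * c) + (c - f) * (d * e)"
    by (simp add: algebra_simps)
  moreover have "\<bar>b * c\<bar> \<le> 1" "\<bar>d * c\<bar> \<le> 1" "\<bar>d * e\<bar> \<le> 1"
    using m[OF assms(2), of b] m[OF assms(2), of d] m[OF assms(4), of d] assms by linarith+
  ultimately show ?thesis
    using m[of "b * c" "a - d"] m[of "d * c" "b - e"] m[of "d * e" "c - f"] by linarith
qed

context random_conjugate
begin

definition al :: real where
  "al = real nfix / real n"

lemma al_bounds: "0 \<le> al" "al \<le> 1"
  using nfix_le n_pos by (auto simp: al_def)

definition y :: "nat \<Rightarrow> real" where
  "y j = (real nfix - real j) / (real n - real j)"

lemma q_Suc: "q (Suc k) = q k * y k"
  by (simp add: q_def y_def)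

text \<open>Exactly, \<open>y j - al = - j * (1 - al) / (n - j)\<close>. The third estimate retains
  the leading term of this, as required for \<open>q6_approx\<close>.\<close>

lemma y_facts:
  assumes n: "n \<ge> 12" and j: "j \<le> 5"
  shows "\<bar>y j\<bar> \<le> 1" "\<bar>y j - al\<bar> \<le> 2 * real j / real n"
    "\<bar>y j - (al - real j * ((1 - al) / real n))\<bar> \<le> 2 * real j ^ 2 / real n ^ 2"
proof -
  have nj: "real n - real j > 0" "real n - real j \<ge> real n / 2" "real n > 0" "real j \<le> real n - real j" using n j by linarith+
  have N: "real nfix \<le> real n" using nfix_le by simp
  show "\<bar>y j\<bar> \<le> 1" unfolding y_def using nj N by (auto simp: abs_le_iff field_simps)
  have d: "y j - al = - (real j * (1 - al) / (real n - real j))"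
    unfolding y_def al_def using nj by (simp add: field_simps)
  have b: "0 \<le> real j * (1 - al)" "real j * (1 - al) \<le> real j"
    using al_bounds by (auto simp: mult_left_le)
  have i: "1 / (real n - real j) \<le> 2 / real n" using nj by (simp add: field_simps)
  have "\<bar>y j - al\<bar> = real j * (1 - al) * (1 / (real n - real j))" unfolding d using b nj by simp
  also have "\<dots> \<le> real j * (2 / real n)" using b i nj by (intro mult_mono) auto
  finally show "\<bar>y j - al\<bar> \<le> 2 * real j / real n" by (simp add: mult.commute)
  have "y j - (al - real j * ((1 - al) / real n)) = - (real j * (1 - al) * (real j / (real n * (real n - real j))))"
  proof -
    have "- (J * c / (N - J)) + J * (c / N) = - (J * c * (J / (N * (N - J))))" if "N > 0" "N - J > 0" for J c N :: real
      using that by (simp add: field_simps)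
    from this[OF nj(3,1), of "1 - al"] show ?thesis using d by linarith
  qed
  hence "\<bar>y j - (al - real j * ((1 - al) / real n))\<bar> = real j * (1 - al) * (real j / real n * (1 / (real n - real j)))"
    using b nj by simp
  also have "\<dots> \<le> real j * (real j / real n * (2 / real n))"
    using b i nj by (intro mult_mono mult_left_mono) auto
  finally show "\<bar>y j - (al - real j * ((1 - al) / real n))\<bar> \<le> 2 * real j ^ 2 / real n ^ 2"
    by (simp add: power2_eq_square mult_ac)
qed

lemma q_approx:
  assumes n: "n \<ge> 12" and k: "k \<le> 6"
  shows "\<bar>q k\<bar> \<le> 1 \<and> \<bar>q k - al ^ k\<bar> \<le> real k ^ 2 / real n"
  using k
proof (induction k)
  case 0 show ?case by (simp add: q_def)
next
  case (Suc k)
  hence IH: "\<bar>q k\<bar> \<le> 1" "\<bar>q k - al ^ k\<bar> \<le> real k ^ 2 / real n" and k: "k \<le> 5" by auto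
  note yf = y_facts[OF n k]
  have 1: "\<bar>q (Suc k)\<bar> \<le> 1" unfolding q_Suc abs_mult using IH(1) yf(1) by (simp add: mult_le_one)
  have "q (Suc k) - al ^ Suc k = q k * (y k - al) + (q k - al ^ k) * al"
    unfolding q_Suc by (simp add: algebra_simps)
  also have "\<bar>\<dots>\<bar> \<le> \<bar>q k\<bar> * \<bar>y k - al\<bar> + \<bar>q k - al ^ k\<bar> * \<bar>al\<bar>"
    by (metis abs_mult abs_triangle_ineq)
  also have "\<dots> \<le> 1 * (2 * real k / real n) + real k ^ 2 / real n * 1"
    using IH yf al_bounds by (intro add_mono mult_mono) auto
  also have "\<dots> \<le> real (Suc k) ^ 2 / real n"
    using n_pos by (simp add: field_simps power2_eq_square)
  finally show ?case using 1 by blast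
qed

text \<open>Negative correlation of fixed points on two disjoint triples. With
  \<open>x = (1 - al) / n\<close>, the factors are \<open>q 3 = y 0 * y 1 * y 2\<close> and
  \<open>q 6 = q 3 * (y 3 * y 4 * y 5)\<close>. To first order in \<open>x\<close> the second
  product is smaller by \<open>(3 + 4 + 5 - 0 - 1 - 2) * al^2 * x = 9 * al^2 * x\<close>, and
  \<open>q 3\<close> is close to \<open>al^3\<close>.\<close>

lemma q6_approx:
  assumes n: "n \<ge> 12"
  shows "\<bar>q 6 - q 3 ^ 2 + 9 * al ^ 5 * (1 - al) / real n\<bar> \<le> 300 / real n ^ 2"
proof -
  define x where "x = (1 - al) / real n"
  have npos: "real n > 0" using n by simp
  have x: "0 \<le> x" "x \<le> 1 / real n" using al_bounds npos by (auto simp: x_def field_simps)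
  have n12: "1 / real n \<le> 1 / 12" using n by (simp add: field_simps)
  have u: "\<bar>al - real j * x\<bar> \<le> 1" if "j \<le> 5" for j
  proof -
    have "real j * x \<le> 5 * (1 / 12)" using that x n12 by (intro mult_mono) auto
    moreover have "0 \<le> real j * x" using x by simp
    ultimately show ?thesis using al_bounds by (auto simp: abs_le_iff)
  qed
  have yf: "\<bar>y j\<bar> \<le> 1" "\<bar>y j - (al - real j * x)\<bar> \<le> 2 * real j ^ 2 / real n ^ 2" if "j \<le> 5" for j
    using y_facts(1,3)[OF n that] unfolding x_def by auto
  have q3: "q 3 = y 0 * y 1 * y 2"
    by (simp add: q_def y_def eval_nat_numeral One_nat_def)
  have q6: "q 6 = q 3 * (y 3 * y 4 * y 5)"
    using q_Suc[of 5] q_Suc[of 4] q_Suc[of 3] by (simp add: eval_nat_numeral One_nat_def)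
  have h: "\<bar>y 3 * y 4 * y 5 - (al - 3 * x) * (al - 4 * x) * (al - 5 * x)\<bar> \<le> 100 / real n ^ 2"
  proof -
    have "\<bar>y 3 * y 4 * y 5 - (al - real 3 * x) * (al - real 4 * x) * (al - real 5 * x)\<bar>
      \<le> \<bar>y 3 - (al - real 3 * x)\<bar> + \<bar>y 4 - (al - real 4 * x)\<bar> + \<bar>y 5 - (al - real 5 * x)\<bar>"
      by (rule prod3_diff_le) (rule yf u, simp)+
    also have "\<dots> \<le> 2 * real 3 ^ 2 / real n ^ 2 + 2 * real 4 ^ 2 / real n ^ 2 + 2 * real 5 ^ 2 / real n ^ 2"
      by (intro add_mono yf) simp_all
    finally show ?thesis by (simp add: add_divide_distrib[symmetric])
  qed
  have l: "\<bar>y 0 * y 1 * y 2 - (al - 0 * x) * (al - 1 * x) * (al - 2 * x)\<bar> \<le> 10 / real n ^ 2"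
  proof -
    have "\<bar>y 0 * y 1 * y 2 - (al - real 0 * x) * (al - real 1 * x) * (al - real 2 * x)\<bar>
      \<le> \<bar>y 0 - (al - real 0 * x)\<bar> + \<bar>y 1 - (al - real 1 * x)\<bar> + \<bar>y 2 - (al - real 2 * x)\<bar>"
      by (rule prod3_diff_le) (rule yf u, simp)+
    also have "\<dots> \<le> 2 * real 0 ^ 2 / real n ^ 2 + 2 * real 1 ^ 2 / real n ^ 2 + 2 * real 2 ^ 2 / real n ^ 2"
      by (intro add_mono yf) simp_all
    finally show ?thesis by (simp add: add_divide_distrib[symmetric])
  qed
  have poly: "(al - 3 * x) * (al - 4 * x) * (al - 5 * x) - (al - 0 * x) * (al - 1 * x) * (al - 2 * x)
    = - 9 * al ^ 2 * x + (45 * al - 60 * x) * x ^ 2"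
    by (simp add: algebra_simps power2_eq_square power3_eq_cube)
  have r: "\<bar>(45 * al - 60 * x) * x ^ 2\<bar> \<le> 45 / real n ^ 2"
  proof -
    have "\<bar>45 * al - 60 * x\<bar> \<le> 45" using al_bounds x n12 by (auto simp: abs_le_iff)
    moreover have "x ^ 2 \<le> (1 / real n) ^ 2" using x by (intro power_mono)
    ultimately have "\<bar>45 * al - 60 * x\<bar> * x ^ 2 \<le> 45 * (1 / real n) ^ 2" by (intro mult_mono) auto
    thus ?thesis by (simp add: abs_mult power_divide)
  qed
  have d: "\<bar>y 3 * y 4 * y 5 - y 0 * y 1 * y 2 + 9 * al ^ 2 * x\<bar> \<le> 155 / real n ^ 2"
  proof -
    have "100 / real n ^ 2 + 10 / real n ^ 2 + 45 / real n ^ 2 = 155 / real n ^ 2"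
      by (simp add: add_divide_distrib[symmetric])
    thus ?thesis using h l r poly by linarith
  qed
  have q3b: "\<bar>q 3\<bar> \<le> 1" "\<bar>al ^ 3 - q 3\<bar> \<le> 9 / real n" using q_approx[OF n, of 3] by (simp_all add: abs_minus_commute)
  have eq: "q 6 - q 3 ^ 2 + 9 * al ^ 5 * (1 - al) / real n
    = q 3 * (y 3 * y 4 * y 5 - y 0 * y 1 * y 2 + 9 * al ^ 2 * x) + (al ^ 3 - q 3) * (9 * al ^ 2 * x)"
  proof -
    have "9 * al ^ 5 * (1 - al) / real n = 9 * al ^ 3 * (al ^ 2 * x)"
      by (simp add: x_def power_add[symmetric] mult.assoc[symmetric])
    moreover have "Q * h - Q * Q + 9 * A * (B * x) = Q * (h - Q + 9 * B * x) + (A - Q) * (9 * B * x)" for Q h A B :: real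
      by (simp add: algebra_simps)
    ultimately show ?thesis unfolding q6 q3[symmetric] power2_eq_square[of "q 3"] by simp
  qed
  have "\<bar>q 3 * (y 3 * y 4 * y 5 - y 0 * y 1 * y 2 + 9 * al ^ 2 * x)\<bar> \<le> 1 * (155 / real n ^ 2)"
    unfolding abs_mult using q3b d by (intro mult_mono) auto
  moreover have "\<bar>(al ^ 3 - q 3) * (9 * al ^ 2 * x)\<bar> \<le> 9 / real n * (9 * 1 * (1 / real n))"
    unfolding abs_mult using q3b x al_bounds npos by (intro mult_mono) (auto simp: power_le_one)
  moreover have "1 * (155 / real n ^ 2) + 9 / real n * (9 * 1 * (1 / real n)) \<le> 300 / real n ^ 2"
    using npos by (simp add: field_simps power2_eq_square)
  ultimately show ?thesis unfolding eq by linarith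
qed

section \<open>Covariance and its perturbation\<close>

definition cov :: "((nat \<Rightarrow> nat) \<Rightarrow> real) \<Rightarrow> ((nat \<Rightarrow> nat) \<Rightarrow> real) \<Rightarrow> real" where
  "cov f g = EE (\<lambda>\<pi>. f \<pi> * g \<pi>) - EE f * EE g"

lemma cov_commute: "cov f g = cov g f"
  by (simp add: cov_def mult.commute)

lemma cov_add_left: "cov (\<lambda>\<pi>. f \<pi> + g \<pi>) h = cov f h + cov g h"
  by (simp add: cov_def distrib_right EE_add)

lemma cov_add_right: "cov h (\<lambda>\<pi>. f \<pi> + g \<pi>) = cov h f + cov h g"
  by (simp add: cov_def distrib_left EE_add)

lemma cov_cmult_left: "cov (\<lambda>\<pi>. c * f \<pi>) h = c * cov f h"
  by (simp add: cov_def mult.assoc EE_cmult right_diff_distrib)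

lemma cov_cmult_right: "cov h (\<lambda>\<pi>. c * f \<pi>) = c * cov h f"
  using cov_cmult_left[of c f h] by (simp only: cov_commute)

lemma cov_sum: "cov (\<lambda>\<pi>. \<Sum>i\<in>I. f i \<pi>) (\<lambda>\<pi>. \<Sum>j\<in>J. g j \<pi>) = (\<Sum>i\<in>I. \<Sum>j\<in>J. cov (f i) (g j))"
  by (simp only: cov_def sum_product EE_sum sum_subtractf)

lemma cov_self_nonneg: "cov f f \<ge> 0"
proof -
  have "0 \<le> EE (\<lambda>\<pi>. (f \<pi> - EE f) * (f \<pi> - EE f))" by (rule EE_nonneg) simp
  also have "\<dots> = EE (\<lambda>\<pi>. f \<pi> * f \<pi> - 2 * EE f * f \<pi> + EE f * EE f)"
    by (rule EE_cong) (simp add: algebra_simps)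
  also have "\<dots> = cov f f" unfolding EE_add EE_diff EE_cmult EE_const cov_def by (simp add: algebra_simps)
  finally show ?thesis .
qed

text \<open>AM-GM instead of Cauchy--Schwarz; applied with \<open>r = sqrt n\<close>.\<close>

lemma cov_perturb:
  fixes r :: real
  assumes r: "r > 0"
  shows "\<bar>cov (\<lambda>\<pi>. f \<pi> + g \<pi>) (\<lambda>\<pi>. f \<pi> + g \<pi>) - cov f f\<bar> \<le> cov f f / r + (r + 1) * cov g g"
proof -
  have e: "cov (\<lambda>\<pi>. f \<pi> + c * g \<pi>) (\<lambda>\<pi>. f \<pi> + c * g \<pi>) = cov f f + 2 * c * cov f g + c * c * cov g g" for c
    unfolding cov_add_left cov_add_right cov_cmult_left cov_cmult_right
    using cov_commute[of g f] by (simp add: algebra_simps)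
  have "0 \<le> cov f f + 2 * r * cov f g + r * r * cov g g" using cov_self_nonneg e[of r] by metis
  moreover have "0 \<le> cov f f - 2 * r * cov f g + r * r * cov g g"
    using cov_self_nonneg[of "\<lambda>\<pi>. f \<pi> + (- r) * g \<pi>"] e[of "- r"] by simp
  ultimately have "\<bar>2 * r * cov f g\<bar> \<le> cov f f + r * r * cov g g" by linarith
  moreover have "\<bar>2 * r * cov f g\<bar> = r * \<bar>2 * cov f g\<bar>" using r by (simp add: abs_mult)
  moreover have "cov f f + r * r * cov g g = r * (cov f f / r + r * cov g g)" using r by (simp add: field_simps)
  ultimately have "r * \<bar>2 * cov f g\<bar> \<le> r * (cov f f / r + r * cov g g)" by simp
  hence "\<bar>2 * cov f g\<bar> \<le> cov f f / r + r * cov g g" using r by simp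
  moreover have "cov (\<lambda>\<pi>. f \<pi> + g \<pi>) (\<lambda>\<pi>. f \<pi> + g \<pi>) - cov f f = 2 * cov f g + cov g g"
    using e[of 1] by simp
  ultimately show ?thesis using cov_self_nonneg[of g] by (simp add: algebra_simps)
qed

end

lemma sum_shift_count:
  "(\<Sum>i\<in>{2..<n}. \<Sum>j\<in>{2..<n}. of_bool (j = i + d)) = real (n - 2 - d)"
proof -
  have "(\<Sum>i\<in>{2..<n}. \<Sum>j\<in>{2..<n}. of_bool (j = i + d) :: real) = (\<Sum>i\<in>{2..<n}. of_bool (i + d < n))"
    by (intro sum.cong refl) (auto simp: of_bool_def sum.delta)
  also have "\<dots> = (\<Sum>i\<in>{2..<n - d}. 1)"
    by (rule sum.mono_neutral_cong_right) auto
  finally show ?thesis by simp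
qed

lemma sum_near_le:
  fixes A B :: real
  assumes AB: "A \<ge> 0" "B \<ge> 0"
  shows "(\<Sum>i\<in>{2..<n}. \<Sum>j\<in>{2..<n}. if i \<le> j + 2 \<and> j \<le> i + 2 then A else B) \<le> real n * (5 * A + real n * B)"
proof -
  have "(\<Sum>j\<in>{2..<n}. if i \<le> j + 2 \<and> j \<le> i + 2 then A else B) \<le> 5 * A + real n * B" for i
  proof -
    have "(\<Sum>j\<in>{2..<n}. if i \<le> j + 2 \<and> j \<le> i + 2 then A else B)
      \<le> (\<Sum>j\<in>{2..<n}. of_bool (j \<in> {i - 2..i + 2}) * A + B)"
      by (intro sum_mono) (use AB in auto)
    also have "\<dots> = (\<Sum>j\<in>{2..<n}. of_bool (j \<in> {i - 2..i + 2})) * A + real (n - 2) * B"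
      by (simp add: sum.distrib sum_distrib_right)
    also have "(\<Sum>j\<in>{2..<n}. of_bool (j \<in> {i - 2..i + 2}) :: real) = real (card ({2..<n} \<inter> {i - 2..i + 2}))"
      by (simp add: of_bool_def sum.If_cases) (rule arg_cong[where f = card], auto)
    also have "real (card ({2..<n} \<inter> {i - 2..i + 2})) * A + real (n - 2) * B \<le> 5 * A + real n * B"
    proof (intro add_mono mult_right_mono)
      have "card ({2..<n} \<inter> {i - 2..i + 2}) \<le> card {i - 2..i + 2}" by (intro card_mono) auto
      also have "\<dots> \<le> 5" by simp
      finally show "real (card ({2..<n} \<inter> {i - 2..i + 2})) \<le> 5" by simp
    qed (use AB in auto)
    finally show ?thesis .
  qed
  hence "(\<Sum>i\<in>{2..<n}. \<Sum>j\<in>{2..<n}. if i \<le> j + 2 \<and> j \<le> i + 2 then A else B)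
    \<le> (\<Sum>i\<in>{2..<n}. 5 * A + real n * B)" by (intro sum_mono)
  also have "\<dots> \<le> real n * (5 * A + real n * B)"
    unfolding sum_constant using AB by (intro mult_right_mono) auto
  finally show ?thesis .
qed

lemma Tr_disjoint: "\<not> (i \<le> j + 2 \<and> j \<le> i + 2) \<Longrightarrow> Tr i \<inter> Tr j = {}"
  by (auto simp: Tr_def)

lemma card_Tr: "i \<ge> 1 \<Longrightarrow> card (Tr i) = 3"
  by (simp add: Tr_def)

section \<open>Covariances of truncated peak indicators and the limit variance\<close>

context random_conjugate
begin

text \<open>\<open>Y i\<close> is the peak indicator away from the bad event, so that \<open>W i\<close> averages to 0 exactly.\<close>

definition Y :: "nat \<Rightarrow> (nat \<Rightarrow> nat) \<Rightarrow> real" where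
  "Y i \<pi> = (1 - fxs (Tr i) \<pi>) / 3 + W i \<pi>"

lemma Y_bounds: "0 \<le> Y i \<pi>" "Y i \<pi> \<le> 1"
  using pk_bounds(1,2)[of i \<pi>] fxs_bounds[of "Tr i" \<pi>] by (auto simp: Y_def W_def of_bool_def)

lemma pk_minus_Y: "\<bar>pk i \<pi> - Y i \<pi>\<bar> \<le> of_bool (\<not> good (Tr i) \<pi>)"
proof -
  have "\<bar>pk i \<pi> - (1 - fxs (Tr i) \<pi>) / 3\<bar> \<le> 1"
    using pk_bounds(1,2)[of i \<pi>] fxs_bounds[of "Tr i" \<pi>] by (auto simp: abs_le_iff field_simps)
  thus ?thesis by (auto simp: Y_def W_def of_bool_def)
qed

lemma EE_fxs_Tr: "i \<in> {2..<n} \<Longrightarrow> EE (fxs (Tr i)) = q 3"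
  using EE_fxs[OF Tr_subset] card_Tr[of i] by simp

lemma EE_Y: "i \<in> {2..<n} \<Longrightarrow> EE (Y i) = (1 - q 3) / 3"
  unfolding Y_def[abs_def] EE_add EE_divide EE_diff EE_const by (simp add: EE_W EE_fxs_Tr)

text \<open>The mixed terms of \<open>W\<close> and \<open>fxs\<close> vanish exactly, and those of
  \<open>W i\<close> and \<open>W j\<close> are \<open>O(1/n^2)\<close>. The fixed points contribute
  \<open>(q 6 - q 3 ^ 2) / 9\<close>, which supplies the main term.\<close>

lemma cov_Y_far:
  assumes ij: "i \<in> {2..<n}" "j \<in> {2..<n}" "\<not> (i \<le> j + 2 \<and> j \<le> i + 2)" and n: "n \<ge> 12"
  shows "\<bar>cov (Y i) (Y j) - (- (al ^ 5 * (1 - al)) / real n)\<bar> \<le> 360 / real n ^ 2"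
proof -
  have dj: "Tr i \<inter> Tr j = {}" "Tr j \<inter> Tr i = {}" using Tr_disjoint[OF ij(3)] by auto
  have c: "card (Tr i \<union> Tr j) = 6"
    using card_Un_disjoint[OF Tr_finite Tr_finite dj(1)] card_Tr[of i] card_Tr[of j] ij by simp
  have F: "EE (\<lambda>\<pi>. fxs (Tr i) \<pi> * fxs (Tr j) \<pi>) = q 6"
    using EE_fxs[of "Tr i \<union> Tr j"] Tr_subset[OF ij(1)] Tr_subset[OF ij(2)] c by (simp add: fxs_mult)
  have wf: "EE (\<lambda>\<pi>. W i \<pi> * fxs (Tr j) \<pi>) = 0" "EE (\<lambda>\<pi>. W j \<pi> * fxs (Tr i) \<pi>) = 0"
    using EE_W_fxs ij dj by blast+
  have "EE (\<lambda>\<pi>. Y i \<pi> * Y j \<pi>) = EE (\<lambda>\<pi>. (1 / 9 + (-1/9) * fxs (Tr i) \<pi> + (-1/9) * fxs (Tr j) \<pi>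
      + (1/9) * (fxs (Tr i) \<pi> * fxs (Tr j) \<pi>)) + ((1/3) * W i \<pi> + (1/3) * W j \<pi>
      + (-1/3) * (W i \<pi> * fxs (Tr j) \<pi>) + (-1/3) * (W j \<pi> * fxs (Tr i) \<pi>)) + W i \<pi> * W j \<pi>)"
    by (rule EE_cong) (simp add: Y_def field_simps)
  also have "\<dots> = (1 - 2 * q 3 + q 6) / 9 + EE (\<lambda>\<pi>. W i \<pi> * W j \<pi>)"
    unfolding EE_add EE_cmult EE_const F wf EE_W[OF ij(1)] EE_W[OF ij(2)] EE_fxs_Tr[OF ij(1)] EE_fxs_Tr[OF ij(2)]
    by (simp add: field_simps)
  finally have YY: "EE (\<lambda>\<pi>. Y i \<pi> * Y j \<pi>) = (1 - 2 * q 3 + q 6) / 9 + EE (\<lambda>\<pi>. W i \<pi> * W j \<pi>)" .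
  have 1: "cov (Y i) (Y j) - (- (al ^ 5 * (1 - al)) / real n)
    = (q 6 - q 3 ^ 2 + 9 * al ^ 5 * (1 - al) / real n) / 9 + EE (\<lambda>\<pi>. W i \<pi> * W j \<pi>)"
  proof -
    have g: "9 * al ^ 5 * (1 - al) / real n = 9 * (al ^ 5 * (1 - al) / real n)"
      "- (al ^ 5 * (1 - al)) / real n = - (al ^ 5 * (1 - al) / real n)" by simp_all
    have "E - (1 - t) / 3 * ((1 - t) / 3) - (- G) = (u - t ^ 2 + 9 * G) / 9 + w"
      if "E = (1 - 2 * t + u) / 9 + w" for E t u w G :: real
      using that by (simp add: field_simps power2_eq_square)
    from this[OF YY] show ?thesis unfolding g cov_def EE_Y[OF ij(1)] EE_Y[OF ij(2)] .
  qed
  have 2: "\<bar>(q 6 - q 3 ^ 2 + 9 * al ^ 5 * (1 - al) / real n) / 9\<bar> \<le> 300 / real n ^ 2 / 9"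
    using q6_approx[OF n] by (simp add: divide_right_mono)
  have 3: "\<bar>EE (\<lambda>\<pi>. W i \<pi> * W j \<pi>)\<bar> \<le> 324 / real n ^ 2" using EE_W_W[OF ij(1,2) dj(1)] n by simp
  have 4: "300 / real n ^ 2 / 9 + 324 / real n ^ 2 \<le> 360 / real n ^ 2"
    using n by (simp add: field_simps)
  have "\<bar>c\<bar> \<le> z" if "c = a + b" "\<bar>a\<bar> \<le> x" "\<bar>b\<bar> \<le> w" "x + w \<le> z" for a b c x w z :: real
    using that by linarith
  from this[OF 1 2 3 4] show ?thesis .
qed

lemma EE_YY_pk:
  assumes ij: "i \<in> {2..<n}" "j \<in> {2..<n}"
  shows "\<bar>EE (\<lambda>\<pi>. Y i \<pi> * Y j \<pi>) - EE (\<lambda>\<pi>. pk i \<pi> * pk j \<pi>)\<bar> \<le> 36 / real n"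
proof -
  have "\<bar>EE (\<lambda>\<pi>. Y i \<pi> * Y j \<pi> - pk i \<pi> * pk j \<pi>)\<bar>
    \<le> EE (\<lambda>\<pi>. of_bool (\<not> good (Tr i) \<pi>) + of_bool (\<not> good (Tr j) \<pi>))"
  proof (rule EE_abs_le)
    fix \<pi>
    have "Y i \<pi> * Y j \<pi> - pk i \<pi> * pk j \<pi> = (Y i \<pi> - pk i \<pi>) * Y j \<pi> + (Y j \<pi> - pk j \<pi>) * pk i \<pi>"
      by (simp add: algebra_simps)
    moreover have "\<bar>(Y i \<pi> - pk i \<pi>) * Y j \<pi>\<bar> \<le> of_bool (\<not> good (Tr i) \<pi>) * 1"
      unfolding abs_mult using pk_minus_Y[of i \<pi>] Y_bounds[of j \<pi>]
      by (intro mult_mono) (auto simp: abs_minus_commute)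
    moreover have "\<bar>(Y j \<pi> - pk j \<pi>) * pk i \<pi>\<bar> \<le> of_bool (\<not> good (Tr j) \<pi>) * 1"
      unfolding abs_mult using pk_minus_Y[of j \<pi>] pk_bounds(1,2)[of i \<pi>]
      by (intro mult_mono) (auto simp: abs_minus_commute)
    ultimately show "\<bar>Y i \<pi> * Y j \<pi> - pk i \<pi> * pk j \<pi>\<bar> \<le> of_bool (\<not> good (Tr i) \<pi>) + of_bool (\<not> good (Tr j) \<pi>)"
      by linarith
  qed
  also have "\<dots> \<le> 18 / real n + 18 / real n"
    unfolding EE_add by (intro add_mono EE_bad_Tr ij)
  finally show ?thesis unfolding EE_diff by simp
qed

lemma EE_pk_approx:
  assumes i: "i \<in> {2..<n}"
  shows "\<bar>EE (pk i) - (1 - q 3) / 3\<bar> \<le> 18 / real n"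
proof -
  have "\<bar>EE (\<lambda>\<pi>. pk i \<pi> - Y i \<pi>)\<bar> \<le> EE (\<lambda>\<pi>. of_bool (\<not> good (Tr i) \<pi>))"
    by (rule EE_abs_le) (rule pk_minus_Y)
  thus ?thesis using EE_bad_Tr[OF i] unfolding EE_diff EE_Y[OF i] by linarith
qed

text \<open>Limits of the covariances of two peaks at distance \<open>d \<le> 2\<close>; at larger distances the covariance is of order \<open>1/n\<close>.\<close>

definition \<kappa> :: "nat \<Rightarrow> real" where
  "\<kappa> d = (if d = 0 then (1 - al ^ 3) / 3 else if d = 1 then 0 else 2 / 15 - al ^ 3 / 3 + al ^ 5 / 5)
    - ((1 - al ^ 3) / 3) ^ 2"

lemma mean_sq_approx:
  assumes n: "n \<ge> 12"
  shows "\<bar>((1 - q 3) / 3) * ((1 - q 3) / 3) - ((1 - al ^ 3) / 3) ^ 2\<bar> \<le> 4 / real n"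
proof -
  have q3: "\<bar>q 3\<bar> \<le> 1" "\<bar>al ^ 3 - q 3\<bar> \<le> 9 / real n"
    using q_approx[OF n, of 3] by (simp_all add: abs_minus_commute)
  have a3: "0 \<le> al ^ 3" "al ^ 3 \<le> 1" using al_bounds by (simp_all add: power_le_one)
  have "((1 - q 3) / 3) * ((1 - q 3) / 3) - ((1 - al ^ 3) / 3) ^ 2 = (al ^ 3 - q 3) * ((2 - q 3 - al ^ 3) / 9)"
    by (simp add: field_simps power2_eq_square)
  moreover have "\<bar>2 - q 3 - al ^ 3\<bar> \<le> 4" using q3(1) a3 by linarith
  hence "\<bar>(al ^ 3 - q 3) * ((2 - q 3 - al ^ 3) / 9)\<bar> \<le> 9 / real n * (4 / 9)"
    unfolding abs_mult using q3 by (intro mult_mono) auto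
  ultimately show ?thesis by simp
qed

lemma cov_Y_0:
  assumes i: "i \<in> {2..<n}" and n: "n \<ge> 12"
  shows "\<bar>cov (Y i) (Y i) - \<kappa> 0\<bar> \<le> 160 / real n"
proof -
  have "EE (\<lambda>\<pi>. pk i \<pi> * pk i \<pi>) = EE (pk i)" by (rule EE_cong) (simp add: pk_def)
  hence 1: "\<bar>EE (\<lambda>\<pi>. Y i \<pi> * Y i \<pi>) - EE (pk i)\<bar> \<le> 36 / real n" using EE_YY_pk[OF i i] by simp
  have 2: "\<bar>(1 - q 3) / 3 - (1 - al ^ 3) / 3\<bar> \<le> 3 / real n"
    using q_approx[OF n, of 3] by (simp add: diff_divide_distrib[symmetric] abs_minus_commute field_simps)
  have s: "36 / real n + 18 / real n + 3 / real n + 4 / real n \<le> 160 / real n"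
    by (simp add: add_divide_distrib[symmetric] divide_right_mono)
  have k: "\<kappa> 0 = (1 - al ^ 3) / 3 - ((1 - al ^ 3) / 3) ^ 2" by (simp add: \<kappa>_def)
  show ?thesis unfolding cov_def EE_Y[OF i] k
    using 1 2 s mean_sq_approx[OF n] EE_pk_approx[OF i] by linarith
qed

text \<open>Adjacent positions are never both peaks, so only the product of the means remains in the
  limit.\<close>

lemma cov_Y_1:
  assumes i: "i \<in> {2..<n}" "i + 1 \<in> {2..<n}" and n: "n \<ge> 12"
  shows "\<bar>cov (Y i) (Y (i + 1)) - \<kappa> 1\<bar> \<le> 160 / real n"
proof -
  have "EE (\<lambda>\<pi>. pk i \<pi> * pk (i + 1) \<pi>) = EE (\<lambda>_. 0)" by (rule EE_cong) (auto simp: pk_def)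
  hence 1: "\<bar>EE (\<lambda>\<pi>. Y i \<pi> * Y (i + 1) \<pi>)\<bar> \<le> 36 / real n" using EE_YY_pk[OF i] by (simp add: EE_const)
  have s: "36 / real n + 4 / real n \<le> 160 / real n"
    by (simp add: add_divide_distrib[symmetric] divide_right_mono)
  have k: "\<kappa> 1 = - (((1 - al ^ 3) / 3) ^ 2)" by (simp add: \<kappa>_def)
  show ?thesis unfolding cov_def EE_Y[OF i(1)] EE_Y[OF i(2)] k
    using 1 s mean_sq_approx[OF n] by linarith
qed

lemma cov_Y_2:
  assumes i: "i \<in> {2..<n}" "i + 2 \<in> {2..<n}" and n: "n \<ge> 12"
  shows "\<bar>cov (Y i) (Y (i + 2)) - \<kappa> 2\<bar> \<le> 160 / real n"
proof -
  have 1: "\<bar>EE (\<lambda>\<pi>. pk i \<pi> * pk (i + 2) \<pi>) - (2 / 15 - q 3 / 3 + q 5 / 5)\<bar> \<le> 100 / real n"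
    by (rule EE_two_peaks) (use i in auto)
  have 2: "\<bar>q 3 / 3 - al ^ 3 / 3\<bar> \<le> 3 / real n" "\<bar>q 5 / 5 - al ^ 5 / 5\<bar> \<le> 5 / real n"
    using q_approx[OF n, of 3] q_approx[OF n, of 5]
    by (simp_all add: diff_divide_distrib[symmetric] abs_minus_commute field_simps)
  have s: "36 / real n + 100 / real n + 3 / real n + 5 / real n + 4 / real n \<le> 160 / real n"
    by (simp add: add_divide_distrib[symmetric] divide_right_mono)
  have k: "\<kappa> 2 = 2 / 15 - al ^ 3 / 3 + al ^ 5 / 5 - ((1 - al ^ 3) / 3) ^ 2" by (simp add: \<kappa>_def)
  show ?thesis unfolding cov_def EE_Y[OF i(1)] EE_Y[OF i(2)] k
    using 1 2 s mean_sq_approx[OF n] EE_YY_pk[OF i] unfolding abs_le_iff by argo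
qed

text \<open>Asymptotic variance per position, twice the coefficient of \<open>s^2\<close> in the
  theorem.\<close>

definition vlim :: real where
  "vlim = 2 / 45 + al ^ 3 / 9 - 3 * al ^ 5 / 5 + 4 * al ^ 6 / 9"

text \<open>The diagonal, the distances 1 and 2 in both orders, and the total effect of about
  \<open>n^2\<close> far pairs with covariance \<open>- al^5 * (1 - al) / n\<close> each.\<close>

lemma vlim_eq: "vlim = \<kappa> 0 + 2 * \<kappa> 1 + 2 * \<kappa> 2 - al ^ 5 * (1 - al)"
proof -
  have c: "al ^ 6 = al ^ 3 * al ^ 3" "al ^ 6 = al ^ 5 * al"
    by (simp_all add: power_add[symmetric] power_Suc2[symmetric])
  have "2 / 45 + A / 9 - 3 * B / 5 + 4 * C / 9 = ((1 - A) / 3 - ((1 - A) / 3) ^ 2) + 2 * (- (((1 - A) / 3) ^ 2))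
    + 2 * (2 / 15 - A / 3 + B / 5 - ((1 - A) / 3) ^ 2) - B * (1 - x)"
    if "C = A * A" "C = B * x" for A B C x :: real
    using that by (simp add: field_simps power2_eq_square)
  from this[OF c] show ?thesis by (simp add: vlim_def \<kappa>_def)
qed

lemma \<kappa>_bound: "\<bar>\<kappa> d\<bar> \<le> 1"
proof -
  have a: "0 \<le> al ^ 3" "al ^ 3 \<le> 1" "0 \<le> al ^ 5" "al ^ 5 \<le> 1" using al_bounds by (simp_all add: power_le_one)
  have "((1 - al ^ 3) / 3) ^ 2 \<le> (1 / 3) ^ 2" using a by (intro power_mono) auto
  moreover have "0 \<le> ((1 - al ^ 3) / 3) ^ 2" by simp
  ultimately have s: "0 \<le> ((1 - al ^ 3) / 3) ^ 2" "((1 - al ^ 3) / 3) ^ 2 \<le> 1 / 9" by (simp_all add: power2_eq_square)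
  have e: "(1 - al ^ 3) / 3 = 1 / 3 - al ^ 3 / 3" by (simp add: diff_divide_distrib)
  consider "d = 0" | "d = 1" | "d > 1" by linarith
  thus ?thesis
  proof cases
    case 1
    hence "\<kappa> d = (1 / 3 - al ^ 3 / 3) - ((1 - al ^ 3) / 3) ^ 2" by (simp add: \<kappa>_def e)
    thus ?thesis using a s by linarith
  next
    case 2
    hence "\<kappa> d = - (((1 - al ^ 3) / 3) ^ 2)" by (simp add: \<kappa>_def)
    thus ?thesis using s by linarith
  next
    case 3
    hence "\<kappa> d = 2 / 15 - al ^ 3 / 3 + al ^ 5 / 5 - ((1 - al ^ 3) / 3) ^ 2" by (simp add: \<kappa>_def)
    thus ?thesis using a s by linarith
  qed
qed

lemma vlim_bound: "\<bar>vlim\<bar> \<le> 2"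
proof -
  have a: "0 \<le> al ^ 3" "al ^ 3 \<le> 1" "0 \<le> al ^ 5" "al ^ 5 \<le> 1" "0 \<le> al ^ 6" "al ^ 6 \<le> 1"
    using al_bounds by (simp_all add: power_le_one)
  show ?thesis unfolding vlim_def using a by linarith
qed

text \<open>The far covariance is charged to all pairs and corrected on the five central diagonals,
  so that the double sum reduces to counting diagonals.\<close>

definition model :: "nat \<Rightarrow> nat \<Rightarrow> real" where
  "model i j = - (al ^ 5 * (1 - al)) / real n
    + (of_bool (j = i + 0) * (\<kappa> 0 + al ^ 5 * (1 - al) / real n)
    + (of_bool (j = i + 1) + of_bool (i = j + 1)) * (\<kappa> 1 + al ^ 5 * (1 - al) / real n)
    + (of_bool (j = i + 2) + of_bool (i = j + 2)) * (\<kappa> 2 + al ^ 5 * (1 - al) / real n))"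

lemma cov_Y_model:
  assumes ij: "i \<in> {2..<n}" "j \<in> {2..<n}" and n: "n \<ge> 12"
  shows "\<bar>cov (Y i) (Y j) - model i j\<bar> \<le> (if i \<le> j + 2 \<and> j \<le> i + 2 then 160 / real n else 360 / real n ^ 2)"
proof -
  consider "j = i" | "j = i + 1" | "i = j + 1" | "j = i + 2" | "i = j + 2" | "\<not> (i \<le> j + 2 \<and> j \<le> i + 2)" by linarith
  thus ?thesis
  proof cases
    case 1
    hence "model i j = \<kappa> 0" by (simp add: model_def)
    thus ?thesis using cov_Y_0[OF ij(1) n] 1 by simp
  next
    case 2
    hence "model i j = \<kappa> 1" by (simp add: model_def)
    thus ?thesis using cov_Y_1[OF ij(1) _ n] ij 2 by simp
  next
    case 3
    hence "model i j = \<kappa> 1" by (simp add: model_def)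
    thus ?thesis using cov_Y_1[OF ij(2) _ n] ij 3 by (simp add: cov_commute[of "Y j"])
  next
    case 4
    hence "model i j = \<kappa> 2" by (simp add: model_def)
    thus ?thesis using cov_Y_2[OF ij(1) _ n] ij 4 by simp
  next
    case 5
    hence "model i j = \<kappa> 2" by (simp add: model_def)
    thus ?thesis using cov_Y_2[OF ij(2) _ n] ij 5 by (simp add: cov_commute[of "Y j"])
  next
    case 6
    hence "model i j = - (al ^ 5 * (1 - al)) / real n" by (auto simp: model_def)
    thus ?thesis unfolding if_not_P[OF 6] using cov_Y_far[OF ij 6 n] by simp
  qed
qed

lemma sum_model:
  assumes n: "n \<ge> 12"
  shows "\<bar>(\<Sum>i\<in>{2..<n}. \<Sum>j\<in>{2..<n}. model i j) - real n * vlim\<bar> \<le> 40"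
proof -
  define g where "g = al ^ 5 * (1 - al)"
  define f where "f = g / real n"
  have npos: "real n > 0" using n by simp
  have g: "0 \<le> g" "g \<le> 1" using al_bounds by (auto simp: g_def power_le_one intro!: mult_le_one)
  have f: "0 \<le> f" "real n * f = g" using g npos by (auto simp: f_def)
  have f1: "f \<le> 1" using g n by (simp add: f_def field_simps)
  have mm: "model i j = (- f) + (of_bool (j = i + 0) * (\<kappa> 0 + f)
    + (of_bool (j = i + 1) + of_bool (i = j + 1)) * (\<kappa> 1 + f)
    + (of_bool (j = i + 2) + of_bool (i = j + 2)) * (\<kappa> 2 + f))" for i j
    by (simp add: model_def f_def g_def)
  have sw: "(\<Sum>i\<in>{2..<n}. \<Sum>j\<in>{2..<n}. of_bool (i = j + d)) = real (n - 2 - d)" for d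
    by (subst sum.swap) (rule sum_shift_count)
  have "(\<Sum>i\<in>{2..<n}. \<Sum>j\<in>{2..<n}. model i j)
    = (\<Sum>i\<in>{2..<n}. \<Sum>j\<in>{2..<n}. - f)
    + ((\<Sum>i\<in>{2..<n}. \<Sum>j\<in>{2..<n}. of_bool (j = i + 0)) * (\<kappa> 0 + f)
    + ((\<Sum>i\<in>{2..<n}. \<Sum>j\<in>{2..<n}. of_bool (j = i + 1)) + (\<Sum>i\<in>{2..<n}. \<Sum>j\<in>{2..<n}. of_bool (i = j + 1))) * (\<kappa> 1 + f)
    + ((\<Sum>i\<in>{2..<n}. \<Sum>j\<in>{2..<n}. of_bool (j = i + 2)) + (\<Sum>i\<in>{2..<n}. \<Sum>j\<in>{2..<n}. of_bool (i = j + 2))) * (\<kappa> 2 + f))"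
    unfolding mm by (simp only: sum.distrib sum_distrib_right distrib_right)
  also have "\<dots> = (real n - 2) * (real n - 2) * (- f) + ((real n - 2) * (\<kappa> 0 + f)
    + (2 * (real n - 3)) * (\<kappa> 1 + f) + (2 * (real n - 4)) * (\<kappa> 2 + f))"
    unfolding sum_shift_count sw using n by (simp add: of_nat_diff)
  \<comment> \<open>Since \<open>n * f = g\<close>, the \<open>(n - 2)^2\<close> background terms
    give \<open>- n * g\<close>, the last part of \<open>n * vlim\<close>, up to bounded
    terms.\<close>
  also have "\<dots> = real n * vlim + (4 * g - 4 * f + 5 * g - 16 * f - 2 * \<kappa> 0 - 6 * \<kappa> 1 - 8 * \<kappa> 2)"
    unfolding vlim_eq g_def[symmetric] f(2)[symmetric] by (simp add: algebra_simps)
  finally have "(\<Sum>i\<in>{2..<n}. \<Sum>j\<in>{2..<n}. model i j) - real n * vlim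
    = 4 * g - 4 * f + 5 * g - 16 * f - 2 * \<kappa> 0 - 6 * \<kappa> 1 - 8 * \<kappa> 2" by simp
  thus ?thesis using g f f1 \<kappa>_bound[of 0] \<kappa>_bound[of 1] \<kappa>_bound[of 2] by linarith
qed

lemma cov_sum_Y:
  assumes n: "n \<ge> 12"
  shows "\<bar>cov (\<lambda>\<pi>. \<Sum>i\<in>{2..<n}. Y i \<pi>) (\<lambda>\<pi>. \<Sum>i\<in>{2..<n}. Y i \<pi>) - real n * vlim\<bar> \<le> 1200"
proof -
  have "\<bar>(\<Sum>i\<in>{2..<n}. \<Sum>j\<in>{2..<n}. cov (Y i) (Y j) - model i j)\<bar>
    \<le> (\<Sum>i\<in>{2..<n}. \<Sum>j\<in>{2..<n}. if i \<le> j + 2 \<and> j \<le> i + 2 then 160 / real n else 360 / real n ^ 2)"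
    by (intro order_trans[OF sum_abs] sum_mono) (intro order_trans[OF sum_abs] sum_mono cov_Y_model n)
  also have "\<dots> \<le> real n * (5 * (160 / real n) + real n * (360 / real n ^ 2))"
    by (rule sum_near_le) auto
  also have "\<dots> = 1160" using n by (simp add: field_simps power2_eq_square)
  finally have "\<bar>cov (\<lambda>\<pi>. \<Sum>i\<in>{2..<n}. Y i \<pi>) (\<lambda>\<pi>. \<Sum>i\<in>{2..<n}. Y i \<pi>)
    - (\<Sum>i\<in>{2..<n}. \<Sum>j\<in>{2..<n}. model i j)\<bar> \<le> 1160"
    unfolding cov_sum by (simp only: sum_subtractf)
  thus ?thesis using sum_model[OF n] by linarith
qed

text \<open>The variance is at most the second moment. At most \<open>5 * n\<close> near pairs cost
  \<open>18 / n\<close> each and at most \<open>n^2\<close> far pairs \<open>324 / n^2\<close> each: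
  \<open>90 + 324 = 414\<close>.\<close>

lemma cov_sum_remainder:
  assumes n: "n \<ge> 12"
  shows "cov (\<lambda>\<pi>. \<Sum>i\<in>{2..<n}. pk i \<pi> - Y i \<pi>) (\<lambda>\<pi>. \<Sum>i\<in>{2..<n}. pk i \<pi> - Y i \<pi>) \<le> 414"
proof -
  let ?R = "\<lambda>i \<pi>. pk i \<pi> - Y i \<pi>"
  let ?b = "\<lambda>i \<pi>. of_bool (\<not> good (Tr i) \<pi>) :: real"
  have "cov (\<lambda>\<pi>. \<Sum>i\<in>{2..<n}. ?R i \<pi>) (\<lambda>\<pi>. \<Sum>i\<in>{2..<n}. ?R i \<pi>)
    \<le> EE (\<lambda>\<pi>. (\<Sum>i\<in>{2..<n}. ?R i \<pi>) * (\<Sum>j\<in>{2..<n}. ?R j \<pi>))"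
    unfolding cov_def by simp
  also have "\<dots> = (\<Sum>i\<in>{2..<n}. \<Sum>j\<in>{2..<n}. EE (\<lambda>\<pi>. ?R i \<pi> * ?R j \<pi>))"
    by (simp only: sum_product EE_sum)
  also have "\<dots> \<le> (\<Sum>i\<in>{2..<n}. \<Sum>j\<in>{2..<n}. if i \<le> j + 2 \<and> j \<le> i + 2 then 18 / real n else 324 / real n ^ 2)"
  proof (intro sum_mono)
    fix i j assume ij: "i \<in> {2..<n}" "j \<in> {2..<n}"
    have 1: "EE (\<lambda>\<pi>. ?R i \<pi> * ?R j \<pi>) \<le> EE (\<lambda>\<pi>. ?b i \<pi> * ?b j \<pi>)"
    proof (rule EE_mono)
      fix \<pi>
      have "\<bar>?R i \<pi> * ?R j \<pi>\<bar> \<le> ?b i \<pi> * ?b j \<pi>"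
        unfolding abs_mult by (intro mult_mono pk_minus_Y) auto
      thus "?R i \<pi> * ?R j \<pi> \<le> ?b i \<pi> * ?b j \<pi>" by linarith
    qed
    have 2: "EE (\<lambda>\<pi>. ?b i \<pi> * ?b j \<pi>) \<le> EE (?b i)" by (rule EE_mono) simp
    have 3: "EE (\<lambda>\<pi>. ?b i \<pi> * ?b j \<pi>) \<le> 324 / real n ^ 2" if "\<not> (i \<le> j + 2 \<and> j \<le> i + 2)"
      using EE_two_bad[OF ij Tr_disjoint[OF that]] n by simp
    show "EE (\<lambda>\<pi>. ?R i \<pi> * ?R j \<pi>)
      \<le> (if i \<le> j + 2 \<and> j \<le> i + 2 then 18 / real n else 324 / real n ^ 2)"
    proof (cases "i \<le> j + 2 \<and> j \<le> i + 2")
      case True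
      show ?thesis unfolding if_P[OF True] by (rule order_trans[OF 1 order_trans[OF 2 EE_bad_Tr[OF ij(1)]]])
    next
      case False
      show ?thesis unfolding if_not_P[OF False] by (rule order_trans[OF 1 3[OF False]])
    qed
  qed
  also have "\<dots> \<le> real n * (5 * (18 / real n) + real n * (324 / real n ^ 2))"
    by (rule sum_near_le) auto
  also have "\<dots> = 414" using n by (simp add: field_simps power2_eq_square)
  finally show ?thesis .
qed

section \<open>Mean and variance of the number of peaks\<close>

lemma EE_pks_bounds: "0 \<le> EE pks" "EE pks \<le> real n"
  using EE_nonneg[of pks] EE_mono[of pks "\<lambda>_. real n"] peaks_le by (simp_all add: EE_const)

text \<open>For small \<open>n\<close> both quantities lie between 0 and \<open>n\<close>. Otherwise
  the error comes from the bad events (18), from \<open>q 3\<close> against \<open>al^3\<close> (3),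
  and from the two end positions (at most 2).\<close>

lemma mean_peaks: "\<bar>EE pks - (1 - al ^ 3) / 3 * real n\<bar> \<le> 25"
proof (cases "n \<ge> 12")
  case False
  have "0 \<le> al ^ 3" "al ^ 3 \<le> 1" using al_bounds by (simp_all add: power_le_one)
  moreover from this have "- (al ^ 3) \<le> 2" by linarith
  ultimately have c: "0 \<le> (1 - al ^ 3) / 3" "(1 - al ^ 3) / 3 \<le> 1" by simp_all
  have "0 \<le> (1 - al ^ 3) / 3 * real n" "(1 - al ^ 3) / 3 * real n \<le> 1 * real n"
    by (rule mult_nonneg_nonneg[OF c(1)], simp, rule mult_right_mono[OF c(2)], simp)
  thus ?thesis using EE_pks_bounds False by linarith
next
  case n: True
  have q3: "\<bar>q 3\<bar> \<le> 1" "\<bar>q 3 - al ^ 3\<bar> \<le> 9 / real n" using q_approx[OF n, of 3] by simp_all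
  have e: "EE pks = (\<Sum>i\<in>{2..<n}. EE (pk i))" unfolding EE_sum[symmetric] by (simp only: peaks_eq_sum)
  have "\<bar>\<Sum>i\<in>{2..<n}. EE (pk i) - (1 - q 3) / 3\<bar> \<le> (\<Sum>i\<in>{2..<n}. 18 / real n)"
    by (intro order_trans[OF sum_abs] sum_mono EE_pk_approx)
  also have "\<dots> = real (n - 2) * (18 / real n)" by simp
  also have "\<dots> \<le> real n * (18 / real n)" by (intro mult_right_mono) auto
  also have "\<dots> = 18" using n by simp
  finally have 1: "\<bar>EE pks - (real n - 2) * ((1 - q 3) / 3)\<bar> \<le> 18"
    using n by (simp add: e sum_subtractf of_nat_diff)
  have "(real n - 2) * ((1 - q 3) / 3) - (1 - al ^ 3) / 3 * real n = - (real n * (q 3 - al ^ 3)) / 3 - 2 * (1 - q 3) / 3"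
    by (simp add: field_simps)
  moreover have "\<bar>real n * (q 3 - al ^ 3)\<bar> \<le> real n * (9 / real n)"
    unfolding abs_mult abs_of_nat by (rule mult_left_mono[OF q3(2)]) simp
  hence "\<bar>real n * (q 3 - al ^ 3)\<bar> \<le> 9" using n by simp
  hence "\<bar>- (real n * (q 3 - al ^ 3)) / 3\<bar> \<le> 3" by simp
  moreover have "\<bar>2 * (1 - q 3) / 3\<bar> \<le> 2" using q3(1) by (auto simp: abs_le_iff)
  ultimately show ?thesis using 1 by linarith
qed

lemma variance_peaks: "\<bar>pvar - real n * vlim\<bar> \<le> 3300 * sqrt (real n)"
proof (cases "n \<ge> 12")
  case False
  have n1: "1 \<le> sqrt (real n)" using n_pos by simp
  have n12: "real n \<le> 12" using False by simp
  have "EE (\<lambda>\<pi>. pks \<pi> * pks \<pi>) \<le> EE (\<lambda>_. real n * real n)"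
    by (intro EE_mono mult_mono peaks_le) auto
  hence 1: "EE (\<lambda>\<pi>. pks \<pi> * pks \<pi>) \<le> real n * real n" by (simp add: EE_const)
  have 2: "0 \<le> EE (\<lambda>\<pi>. pks \<pi> * pks \<pi>)" by (rule EE_nonneg) simp
  have 3: "0 \<le> EE pks * EE pks" "EE pks * EE pks \<le> real n * real n"
    using EE_pks_bounds by (auto intro!: mult_mono)
  have 4: "real n * real n \<le> 12 * 12" using n12 by (intro mult_mono) auto
  have "\<bar>real n * vlim\<bar> \<le> 12 * 2" unfolding abs_mult using vlim_bound n12 by (intro mult_mono) auto
  thus ?thesis unfolding pvar_def using 1 2 3 4 n1 by linarith
next
  case n: True
  \<comment> \<open>With \<open>r = sqrt n\<close> both error terms of \<open>cov_perturb\<close>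
    are \<open>O(sqrt n)\<close>: the variance of the main sum is \<open>O(n)\<close>, that of the
    remainder \<open>O(1)\<close>.\<close>
  define r where "r = sqrt (real n)"
  have r: "r > 0" "r \<ge> 1" "r * r = real n" using n by (auto simp: r_def)
  let ?f = "\<lambda>\<pi>. \<Sum>i\<in>{2..<n}. Y i \<pi>" and ?g = "\<lambda>\<pi>. \<Sum>i\<in>{2..<n}. pk i \<pi> - Y i \<pi>"
  have "pvar = cov (\<lambda>\<pi>. ?f \<pi> + ?g \<pi>) (\<lambda>\<pi>. ?f \<pi> + ?g \<pi>)"
    unfolding pvar_def cov_def by (simp add: peaks_eq_sum sum_subtractf)
  hence d: "\<bar>pvar - cov ?f ?f\<bar> \<le> cov ?f ?f / r + (r + 1) * cov ?g ?g" using cov_perturb[OF r(1), of ?f ?g] by simp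
  have F: "\<bar>cov ?f ?f - real n * vlim\<bar> \<le> 1200" by (rule cov_sum_Y[OF n])
  have "\<bar>real n * vlim\<bar> \<le> real n * 2" unfolding abs_mult using vlim_bound by (intro mult_mono) auto
  hence "cov ?f ?f \<le> r * (2 * r) + 1200" using F r(3) by (simp add: mult_ac)
  also have "\<dots> \<le> r * (2 * r) + r * 1200" using r by simp
  finally have "cov ?f ?f / r \<le> 2 * r + 1200" using r by (simp add: field_simps)
  moreover have "(r + 1) * cov ?g ?g \<le> (r + 1) * 414"
    using cov_sum_remainder[OF n] r by (intro mult_left_mono) auto
  ultimately have "\<bar>pvar - real n * vlim\<bar> \<le> 1200 + (2 * r + 1200) + (r + 1) * 414" using d F by linarith
  also have "\<dots> \<le> 3300 * r" using r by (simp add: algebra_simps)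
  finally show ?thesis by (simp add: r_def)
qed

end

subsection \<open>Cycle types\<close>

text \<open>The rotation \<open>i + 1\<close> modulo \<open>k\<close>, transported to
  \<open>B\<close> by an enumeration.\<close>

lemma exists_cycle_on:
  assumes B: "finite B" "B \<noteq> {}"
  obtains \<gamma> where "\<gamma> permutes B" "\<And>x. x \<in> B \<Longrightarrow> orbit \<gamma> x = B"
proof -
  define k where "k = card B"
  have k: "k > 0" using B by (simp add: k_def card_gt_0_iff)
  obtain h where h: "bij_betw h {0..<k} B" using ex_bij_betw_nat_finite[OF B(1)] by (auto simp: k_def)
  define r where "r i = (i + 1) mod k" for i
  have r: "bij_betw r {0..<k} {0..<k}"
  proof -
    have "inj_on r {0..<k}"
    proof (rule inj_onI)
      fix i j assume "i \<in> {0..<k}" "j \<in> {0..<k}" "r i = r j"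
      thus "i = j" unfolding r_def
        by (cases "i + 1 = k"; cases "j + 1 = k") auto
    qed
    moreover have "r ` {0..<k} \<subseteq> {0..<k}" using k by (auto simp: r_def)
    ultimately show ?thesis by (simp add: bij_betw_def endo_inj_surj)
  qed
  define g where "g = inv_into {0..<k} h"
  have g: "bij_betw g B {0..<k}" unfolding g_def by (rule bij_betw_inv_into[OF h])
  have gh: "g (h i) = i" if "i < k" for i
    using that h by (simp add: g_def bij_betw_def)
  define \<gamma> where "\<gamma> x = (if x \<in> B then h (r (g x)) else x)" for x
  have "bij_betw (h \<circ> (r \<circ> g)) B B" by (rule bij_betw_trans[OF bij_betw_trans[OF g r] h])
  hence "bij_betw \<gamma> B B" by (rule bij_betw_cong[THEN iffD1, rotated]) (simp add: \<gamma>_def)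
  hence p: "\<gamma> permutes B" by (rule bij_imp_permutes) (simp add: \<gamma>_def)
  have hB: "h i \<in> B" if "i < k" for i using that h by (auto simp: bij_betw_def)
  have pow: "(\<gamma> ^^ j) (h i) = h ((i + j) mod k)" if "i < k" for i j
  proof (induction j)
    case 0 thus ?case using that by simp
  next
    case (Suc j)
    have "(i + j) mod k < k" using k by simp
    hence "\<gamma> (h ((i + j) mod k)) = h (r ((i + j) mod k))" using hB gh by (simp add: \<gamma>_def)
    also have "r ((i + j) mod k) = (i + Suc j) mod k" by (simp add: r_def mod_simps One_nat_def)
    finally show ?case using Suc by simp
  qed
  have "orbit \<gamma> x = B" if x: "x \<in> B" for x
  proof
    show "orbit \<gamma> x \<subseteq> B" by (rule permutes_orbit_subset[OF p x])
    show "B \<subseteq> orbit \<gamma> x"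
    proof
      fix z assume "z \<in> B"
      then obtain j where j: "j < k" "z = h j" using h by (auto simp: bij_betw_def)
      obtain i where i: "i < k" "x = h i" using h x by (auto simp: bij_betw_def)
      \<comment> \<open>Adding \<open>k\<close> makes the exponent positive, as membership in an
        orbit demands, and keeps the subtraction of \<open>i\<close> exact.\<close>
      have e: "i + (j + k - i) = j + k" using i by simp
      have "(\<gamma> ^^ (j + k - i)) x = z" using pow[OF i(1), of "j + k - i"] i j unfolding e by simp
      moreover have "j + k - i > 0" using i by simp
      ultimately show "z \<in> orbit \<gamma> x" unfolding orbit_altdef by blast
    qed
  qed
  thus ?thesis using that p by blast
qed

text \<open>Split off one cycle of a length \<open>k\<close> that occurs and apply induction to the
  rest; orbits on the two invariant parts do not interact. The bound \<open>N\<close> on the cycle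
  lengths is kept separate from \<open>card A\<close>, which shrinks during the induction.\<close>

lemma exists_cycle_type:
  assumes "finite A" "(\<Sum>k=1..N. k * m k) = card A"
  shows "\<exists>\<pi>. \<pi> permutes A \<and> (\<forall>k\<in>{1..N}. card {orbit \<pi> x | x. x \<in> A \<and> card (orbit \<pi> x) = k} = m k)"
  using assms
proof (induction "card A" arbitrary: A m rule: less_induct)
  case less
  show ?case
  proof (cases "A = {}")
    case True
    hence m0: "\<forall>k\<in>{1..N}. m k = 0" using less.prems by simp
    have c0: "card {orbit id x | x. x \<in> A \<and> card (orbit id x) = k} = 0" for k
      using True by simp
    show ?thesis
    proof (intro exI[of _ id] conjI ballI permutes_id)
      fix k assume "k \<in> {1..N}"
      thus "card {orbit id x | x. x \<in> A \<and> card (orbit id x) = k} = m k" using m0 unfolding c0 by simp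
    qed
  next
    case False
    hence "(\<Sum>k=1..N. k * m k) \<noteq> 0" using less.prems by simp
    then obtain k where k: "k \<in> {1..N}" "k * m k \<noteq> 0" by (meson sum.neutral)
    hence k1: "k \<ge> 1" "m k \<ge> 1" by auto
    define m' where "m' = m(k := m k - 1)"
    have split: "(\<Sum>i=1..N. i * f i) = k * f k + (\<Sum>i\<in>{1..N} - {k}. i * f i)" for f
      by (rule sum.remove) (use k in auto)
    have "(\<Sum>i\<in>{1..N} - {k}. i * m' i) = (\<Sum>i\<in>{1..N} - {k}. i * m i)"
      by (intro sum.cong) (auto simp: m'_def)
    moreover have "k * m k = k * m' k + k" using k1 by (simp add: m'_def algebra_simps)
    ultimately have sum': "(\<Sum>i=1..N. i * m' i) + k = card A"
      using split[of m] split[of m'] less.prems(2) by linarith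
    obtain B where B: "B \<subseteq> A" "card B = k" using obtain_subset_with_card_n[of k A] sum' by (metis le_add2)
    have fB: "finite B" "B \<noteq> {}" using B less.prems(1) k1 finite_subset by (blast, auto)
    have cAB: "card (A - B) = card A - k" using card_Diff_subset[OF fB(1) B(1)] B by simp
    have "card (A - B) < card A" using cAB k1 sum' by linarith
    moreover have "(\<Sum>i=1..N. i * m' i) = card (A - B)" using cAB sum' by linarith
    ultimately obtain \<pi>' where \<pi>': "\<pi>' permutes (A - B)"
      "\<forall>i\<in>{1..N}. card {orbit \<pi>' x | x. x \<in> A - B \<and> card (orbit \<pi>' x) = i} = m' i"
      using less.hyps[of "A - B" m'] less.prems(1) by blast
    obtain \<gamma> where \<gamma>: "\<gamma> permutes B" "\<And>x. x \<in> B \<Longrightarrow> orbit \<gamma> x = B"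
      using exists_cycle_on[OF fB] by blast
    define \<pi> where "\<pi> = \<gamma> \<circ> \<pi>'"
    have \<pi>: "\<pi> permutes A" unfolding \<pi>_def
      by (intro permutes_compose permutes_subset[OF \<gamma>(1) B(1)] permutes_subset[OF \<pi>'(1)]) auto
    have on_B: "\<pi> x = \<gamma> x" if "x \<in> B" for x
      using that permutes_not_in[OF \<pi>'(1), of x] by (simp add: \<pi>_def)
    have on_AB: "\<pi> x = \<pi>' x" if "x \<in> A - B" for x
      using that permutes_in_image[OF \<pi>'(1), of x] permutes_not_in[OF \<gamma>(1), of "\<pi>' x"] by (simp add: \<pi>_def)
    have oB: "orbit \<pi> x = B" if x: "x \<in> B" for x
      using orbit_cong[of x \<gamma> \<pi>] \<gamma>(2)[OF x] x on_B by simp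
    have self': "x \<in> orbit \<pi>' x" for x
      by (rule permutation_self_in_orbit) (use \<pi>'(1) less.prems(1) in \<open>auto simp: permutation_permutes\<close>)
    have oAB: "orbit \<pi> x = orbit \<pi>' x" if x: "x \<in> A - B" for x
      using orbit_cong[OF self'] on_AB permutes_orbit_subset[OF \<pi>'(1) x] by blast
    have "card {orbit \<pi> x | x. x \<in> A \<and> card (orbit \<pi> x) = i} = m i" if i: "i \<in> {1..N}" for i
    proof -
      let ?S = "{orbit \<pi>' x | x. x \<in> A - B \<and> card (orbit \<pi>' x) = i}"
      have S: "?S \<subseteq> Pow (A - B)" using permutes_orbit_subset[OF \<pi>'(1)] by blast
      have fS: "finite ?S" using finite_subset[OF S] less.prems(1) by simp
      have BS: "B \<notin> ?S" using S fB by blast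
      have "{orbit \<pi> x | x. x \<in> A \<and> card (orbit \<pi> x) = i}
        = {orbit \<pi> x | x. x \<in> A - B \<and> card (orbit \<pi> x) = i} \<union> {orbit \<pi> x | x. x \<in> B \<and> card (orbit \<pi> x) = i}"
        using B(1) by blast
      also have "{orbit \<pi> x | x. x \<in> A - B \<and> card (orbit \<pi> x) = i} = ?S"
        using oAB by (metis (no_types, lifting))
      also have "{orbit \<pi> x | x. x \<in> B \<and> card (orbit \<pi> x) = i} = (if i = k then {B} else {})"
        using oB B(2) fB(2) by auto
      finally have eq: "{orbit \<pi> x | x. x \<in> A \<and> card (orbit \<pi> x) = i} = ?S \<union> (if i = k then {B} else {})" .
      have "card (S \<union> (if i = k then {B} else {})) = card S + (if i = k then 1 else 0)"
        if "finite S" "B \<notin> S" for S using that by simp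
      from this[OF fS BS]
      have "card {orbit \<pi> x | x. x \<in> A \<and> card (orbit \<pi> x) = i} = card ?S + (if i = k then 1 else 0)"
        unfolding eq .
      also have "\<dots> = m i" using \<pi>'(2) i k1 by (auto simp: m'_def)
      finally show ?thesis .
    qed
    thus ?thesis using \<pi> by blast
  qed
qed

text \<open>For an empty class \<open>unif_expect\<close> would be 0, which is not a value of
  \<open>exp\<close>.\<close>

lemma conj_class_nonempty:
  assumes "is_partition_mult n m"
  shows "conj_class n m \<noteq> {}"
proof -
  have "(\<Sum>k=1..n. k * m k) = card {1..n}" using assms by (simp add: is_partition_mult_def)
  then obtain \<pi> where \<pi>: "\<pi> permutes {1..n}"
    "\<forall>k\<in>{1..n}. card {orbit \<pi> x | x. x \<in> {1..n} \<and> card (orbit \<pi> x) = k} = m k"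
    using exists_cycle_type[where A = "{1..n}" and N = n and m = m] by blast
  have "num_cycles n \<pi> k = m k" if "k \<ge> 1" for k
  proof (cases "k \<le> n")
    case True thus ?thesis using \<pi>(2) that by (simp add: num_cycles_def)
  next
    case False
    have "card (orbit \<pi> x) \<le> n" if "x \<in> {1..n}" for x
      using card_mono[OF _ permutes_orbit_subset[OF \<pi>(1) that]] by simp
    hence "{orbit \<pi> x | x. x \<in> {1..n} \<and> card (orbit \<pi> x) = k} = {}" using False by blast
    hence "num_cycles n \<pi> k = card ({} :: nat set set)" unfolding num_cycles_def by (rule arg_cong)
    thus ?thesis using assms False by (simp add: is_partition_mult_def)
  qed
  thus ?thesis using \<pi>(1) unfolding conj_class_def by blast
qed

lemma num_cycles_1:
  assumes \<pi>: "\<pi> permutes {1..n}"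
  shows "num_cycles n \<pi> 1 = card {x \<in> {1..n}. \<pi> x = x}"
proof -
  have self: "x \<in> orbit \<pi> x" for x
    by (rule permutation_self_in_orbit) (use \<pi> in \<open>auto simp: permutation_permutes\<close>)
  have iff: "card (orbit \<pi> x) = 1 \<longleftrightarrow> \<pi> x = x" for x
  proof -
    have "card (orbit \<pi> x) = 1 \<longleftrightarrow> orbit \<pi> x = {x}"
      using self[of x] by (auto simp: card_1_singleton_iff One_nat_def)
    thus ?thesis by (simp add: orbit_eq_singleton_iff)
  qed
  have "{orbit \<pi> x | x. x \<in> {1..n} \<and> card (orbit \<pi> x) = 1} = (\<lambda>x. {x}) ` {x \<in> {1..n}. \<pi> x = x}"
  proof -
    have "orbit \<pi> x = {x}" if "\<pi> x = x" for x using that by (simp add: orbit_eq_singleton_iff)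
    thus ?thesis unfolding iff by blast
  qed
  thus ?thesis unfolding num_cycles_def by (simp add: card_image)
qed

lemma num_cycles_cj:
  assumes \<rho>: "\<rho> permutes {1..n}" and \<pi>: "\<pi> permutes {1..n}"
  shows "num_cycles n (cj \<rho> \<pi>) k = num_cycles n \<pi> k"
proof -
  have inj: "inj \<rho>" by (rule permutes_inj[OF \<rho>])
  have self: "x \<in> orbit \<pi> x" for x
    by (rule permutation_self_in_orbit) (use \<pi> in \<open>auto simp: permutation_permutes\<close>)
  have o: "orbit (cj \<rho> \<pi>) (\<rho> x) = \<rho> ` orbit \<pi> x" for x
    by (rule orbit_inverse[symmetric, OF self]) (rule cj_apply[OF inj])
  have c: "card (\<rho> ` orbit \<pi> x) = card (orbit \<pi> x)" for x
    by (rule card_image) (rule inj_on_subset[OF inj], simp)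
  have "{orbit (cj \<rho> \<pi>) x | x. x \<in> {1..n} \<and> card (orbit (cj \<rho> \<pi>) x) = k}
    = image \<rho> ` {orbit \<pi> x | x. x \<in> {1..n} \<and> card (orbit \<pi> x) = k}" (is "?L = ?R")
  proof (intro equalityI subsetI)
    fix S assume "S \<in> ?L"
    then obtain x where x: "S = orbit (cj \<rho> \<pi>) x" "x \<in> {1..n}" "card S = k" by blast
    obtain z where z: "x = \<rho> z" "z \<in> {1..n}" using x(2) permutes_image[OF \<rho>] by blast
    have "S = \<rho> ` orbit \<pi> z" using x z o by simp
    moreover have "card (orbit \<pi> z) = k" using calculation x c by simp
    ultimately show "S \<in> ?R" using z by blast
  next
    fix S assume "S \<in> ?R"
    then obtain x where x: "S = \<rho> ` orbit \<pi> x" "x \<in> {1..n}" "card (orbit \<pi> x) = k" by blast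
    have "S = orbit (cj \<rho> \<pi>) (\<rho> x)" "\<rho> x \<in> {1..n}" "card S = k"
      using x o c permutes_in_image[OF \<rho>] by simp_all
    thus "S \<in> ?L" by blast
  qed
  moreover have "inj_on (image \<rho>) X" for X using inj by (simp add: inj_on_def inj_image_eq_iff)
  ultimately show ?thesis unfolding num_cycles_def by (simp add: card_image)
qed

section \<open>Averaging over the conjugacy class and conclusion\<close>

lemma conj_class_perms: "\<pi> \<in> conj_class n m \<Longrightarrow> \<pi> \<in> perms n"
  by (simp add: conj_class_def perms_def)

lemma conj_class_cj:
  assumes "\<rho> \<in> perms n"
  shows "cj \<rho> \<pi> \<in> conj_class n m \<longleftrightarrow> \<pi> \<in> conj_class n m"
proof -
  have *: "cj \<rho> \<pi> \<in> conj_class n m" if "\<rho> \<in> perms n" "\<pi> \<in> conj_class n m" for \<rho> \<pi>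
    using that num_cycles_cj[of \<rho> n \<pi>] cj_permutes[of \<rho> "{1..n}" \<pi>]
    unfolding conj_class_def perms_def by simp
  show ?thesis
    using *[OF assms, of \<pi>] *[OF perms_inv[OF assms], of "cj \<rho> \<pi>"] cj_inv_cj[OF permsD[OF assms]] by auto
qed

lemma finite_conj_class: "finite (conj_class n m)"
  by (rule finite_subset[OF _ finite_permutations[of "{1..n}"]]) (auto simp: conj_class_def)

text \<open>Conjugation by a fixed \<open>\<rho>\<close> permutes the class, so an additional
  average over \<open>\<rho>\<close> does not alter the mean. This transfers bounds on
  \<open>EE\<close> that are uniform in the starting permutation to the class.\<close>

lemma conj_class_mean:
  assumes n: "n \<ge> 1"
  shows "unif_expect (conj_class n m) f = unif_expect (conj_class n m) (\<lambda>\<pi>. random_conjugate.EE n \<pi> f)"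
proof (cases "conj_class n m = {}")
  case True thus ?thesis by (simp add: unif_expect_def)
next
  case False
  let ?C = "conj_class n m" and ?P = "perms n"
  obtain \<pi>1 where "\<pi>1 \<in> ?C" using False by blast
  then interpret random_conjugate n \<pi>1 using n conj_class_perms by unfold_locales auto
  have 1: "(\<Sum>\<pi>\<in>?C. f (cj \<rho> \<pi>)) = (\<Sum>\<pi>\<in>?C. f \<pi>)" if \<rho>: "\<rho> \<in> ?P" for \<rho>
  proof (rule sum.reindex_bij_witness[of _ "cj (inv \<rho>)" "cj \<rho>"])
    fix \<pi> assume \<pi>: "\<pi> \<in> ?C"
    show "cj (inv \<rho>) (cj \<rho> \<pi>) = \<pi>" by (rule cj_inv_cj[OF permsD[OF \<rho>]])
    show "cj \<rho> (cj (inv \<rho>) \<pi>) = \<pi>"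
      using cj_inv_cj[OF permutes_inv[OF permsD[OF \<rho>]], of \<pi>] by (simp add: permutes_inv_inv[OF permsD[OF \<rho>]])
    show "cj \<rho> \<pi> \<in> ?C" "cj (inv \<rho>) \<pi> \<in> ?C" using conj_class_cj \<rho> perms_inv[OF \<rho>] \<pi> by blast+
  qed simp
  have "(\<Sum>\<pi>\<in>?C. random_conjugate.EE n \<pi> f) = (\<Sum>\<pi>\<in>?C. (\<Sum>\<rho>\<in>?P. f (cj \<rho> \<pi>)) / real (card ?P))"
  proof (rule sum.cong[OF refl])
    fix \<pi> assume "\<pi> \<in> ?C"
    then interpret r: random_conjugate n \<pi> using n conj_class_perms by unfold_locales auto
    show "random_conjugate.EE n \<pi> f = (\<Sum>\<rho>\<in>?P. f (cj \<rho> \<pi>)) / real (card ?P)" by (rule r.EE_alt)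
  qed
  also have "\<dots> = (\<Sum>\<rho>\<in>?P. \<Sum>\<pi>\<in>?C. f (cj \<rho> \<pi>)) / real (card ?P)"
    unfolding sum_divide_distrib[symmetric] by (subst sum.swap) (rule refl)
  also have "\<dots> = (\<Sum>\<rho>\<in>?P. \<Sum>\<pi>\<in>?C. f \<pi>) / real (card ?P)"
    by (simp only: sum.cong[OF refl 1])
  also have "\<dots> = (\<Sum>\<pi>\<in>?C. f \<pi>)" using card_perms_pos by simp
  finally show ?thesis by (simp add: unif_expect_def)
qed

text \<open>Put \<open>t = s / sqrt n\<close>. The three errors are \<open>n * t^3\<close>,
  \<open>t\<close> times the error of the mean, and \<open>t^2 / 2\<close> times the
  \<open>O(sqrt n)\<close> error of the variance; each is \<open>O(1 / sqrt n)\<close>.\<close>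

lemma (in random_conjugate) log_laplace_expansion:
  fixes s :: real
  assumes s: "s > 0"
  shows "\<bar>ln (EE (\<lambda>\<pi>. exp (- s * real (peaks n \<pi>) / sqrt (real n))))
      - (- (1 - al ^ 3) / 3 * s * sqrt (real n)
        + (1/45 + al ^ 3 / 18 - 3 * al ^ 5 / 10 + 2 * al ^ 6 / 9) * s ^ 2)\<bar>
    \<le> (tilt_const s * s ^ 3 + 25 * s + 1650 * s ^ 2) / sqrt (real n)"
proof -
  define r where "r = sqrt (real n)"
  have r: "r \<ge> 1" "r * r = real n" using n_pos by (auto simp: r_def)
  have rp: "r > 0" using r by simp
  define t where "t = s / r"
  have t: "0 \<le> t" "t \<le> s" using s r rp by (auto simp: t_def field_simps)
  have e: "(\<lambda>\<pi>. exp (- s * real (peaks n \<pi>) / r)) = tilt t"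
    by (rule ext) (simp add: tilt_def t_def)
  have 1: "\<bar>ln (EE (tilt t)) + t * EE pks - t^2 * pvar / 2\<bar> \<le> tilt_const s * s ^ 3 / r"
  proof -
    have "real n * tilt_const s * t^3 = tilt_const s * s ^ 3 / r"
      unfolding t_def r(2)[symmetric] using rp by (simp add: field_simps power3_eq_cube)
    thus ?thesis using log_laplace_peaks[OF t] by simp
  qed
  have 2: "\<bar>t * EE pks - (1 - al ^ 3) / 3 * s * r\<bar> \<le> 25 * s / r"
  proof -
    have "t * EE pks - (1 - al ^ 3) / 3 * s * r = t * (EE pks - (1 - al ^ 3) / 3 * real n)"
      unfolding t_def r(2)[symmetric] using rp by (simp add: field_simps)
    moreover have "\<bar>t * (EE pks - (1 - al ^ 3) / 3 * real n)\<bar> \<le> t * 25"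
      unfolding abs_mult using mult_left_mono[OF mean_peaks t(1)] t(1) by simp
    ultimately show ?thesis by (simp add: t_def mult.commute)
  qed
  have 3: "\<bar>t^2 * pvar / 2 - vlim / 2 * s ^ 2\<bar> \<le> 1650 * s ^ 2 / r"
  proof -
    have "t^2 * pvar / 2 - vlim / 2 * s ^ 2 = s^2 / (2 * real n) * (pvar - real n * vlim)"
      unfolding t_def r(2)[symmetric] using rp by (simp add: field_simps power2_eq_square)
    moreover have "\<bar>s^2 / (2 * real n) * (pvar - real n * vlim)\<bar> \<le> s^2 / (2 * real n) * (3300 * r)"
      unfolding abs_mult r_def using mult_left_mono[OF variance_peaks, of "s^2 / (2 * real n)"] by simp
    moreover have "s^2 / (2 * real n) * (3300 * r) = 1650 * s ^ 2 / r"
      unfolding r(2)[symmetric] using rp by (simp add: field_simps)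
    ultimately show ?thesis by simp
  qed
  have v: "(1/45 + al ^ 3 / 18 - 3 * al ^ 5 / 10 + 2 * al ^ 6 / 9) * s ^ 2 = vlim / 2 * s ^ 2"
    by (simp add: vlim_def add_divide_distrib diff_divide_distrib)
  have u: "- (1 - al ^ 3) / 3 * s * r = - ((1 - al ^ 3) / 3 * s * r)"
    unfolding minus_divide_left[symmetric] minus_mult_left ..
  have d: "(tilt_const s * s ^ 3 + 25 * s + 1650 * s ^ 2) / r = tilt_const s * s ^ 3 / r + 25 * s / r + 1650 * s ^ 2 / r"
    by (simp add: add_divide_distrib)
  have "\<bar>l - (- x + w)\<bar> \<le> p1 + p2 + p3"
    if "\<bar>l + y - z\<bar> \<le> p1" "\<bar>y - x\<bar> \<le> p2" "\<bar>z - w\<bar> \<le> p3" for l y z x w p1 p2 p3 :: real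
    using that by linarith
  from this[OF 1 2 3] show ?thesis unfolding r_def[symmetric] v u d e .
qed

theorem theorem1p2:
  fixes s :: real
  assumes "s > 0"
  shows "\<exists>C>0. \<forall>(n::nat) m. n \<ge> 1 \<longrightarrow> is_partition_mult n m \<longrightarrow>
    (let a = real (m 1) / real n in
     \<exists>E. unif_expect (conj_class n m) (\<lambda>\<pi>. exp (- s * real (peaks n \<pi>) / sqrt (real n))) =
        exp (- (1 - a ^ 3) / 3 * s * sqrt (real n)
             + (1/45 + a ^ 3 / 18 - 3 * a ^ 5 / 10 + 2 * a ^ 6 / 9) * s ^ 2 + E)
      \<and> \<bar>E\<bar> \<le> C * real n powr (-1/4))"
proof -
  define C where "C = tilt_const s * s ^ 3 + 25 * s + 1650 * s ^ 2"
  have C: "C > 0" unfolding C_def tilt_const_def using assms by (intro add_nonneg_pos add_pos_pos) auto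
  have "\<exists>E. unif_expect (conj_class n m) (\<lambda>\<pi>. exp (- s * real (peaks n \<pi>) / sqrt (real n))) =
        exp (- (1 - a ^ 3) / 3 * s * sqrt (real n)
             + (1/45 + a ^ 3 / 18 - 3 * a ^ 5 / 10 + 2 * a ^ 6 / 9) * s ^ 2 + E)
      \<and> \<bar>E\<bar> \<le> C * real n powr (-1/4)"
    if n: "n \<ge> 1" and m: "is_partition_mult n m" and a: "a = real (m 1) / real n" for n m a
  proof -
    let ?C = "conj_class n m" and ?f = "\<lambda>\<pi>. exp (- s * real (peaks n \<pi>) / sqrt (real n))"
    define b where "b = - (1 - a ^ 3) / 3 * s * sqrt (real n)
      + (1/45 + a ^ 3 / 18 - 3 * a ^ 5 / 10 + 2 * a ^ 6 / 9) * s ^ 2"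
    define \<delta> where "\<delta> = C / sqrt (real n)"
    \<comment> \<open>The bounds depend on \<open>\<pi>\<close> only through its number
      \<open>m 1\<close> of fixed points, so they are the same for the whole class and survive
      averaging.\<close>
    have bd: "exp (b - \<delta>) \<le> random_conjugate.EE n \<pi> ?f \<and> random_conjugate.EE n \<pi> ?f \<le> exp (b + \<delta>)"
      if \<pi>: "\<pi> \<in> ?C" for \<pi>
    proof -
      interpret random_conjugate n \<pi> using n conj_class_perms[OF \<pi>] by unfold_locales auto
      have "num_cycles n \<pi> 1 = m 1" using \<pi> by (simp add: conj_class_def)
      hence "al = a" unfolding al_def nfix_def a using num_cycles_1[OF permsD[OF conj_class_perms[OF \<pi>]]] by simp
      hence l: "\<bar>ln (EE ?f) - b\<bar> \<le> \<delta>" using log_laplace_expansion[OF assms] unfolding b_def \<delta>_def C_def by simp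
      have pos: "EE ?f > 0" by (rule EE_pos) simp
      have "b - \<delta> \<le> ln (EE ?f)" "ln (EE ?f) \<le> b + \<delta>" using l by linarith+
      thus ?thesis using pos by (metis exp_le_cancel_iff exp_ln)
    qed
    have fin: "finite ?C" by (rule finite_conj_class)
    have ne: "real (card ?C) > 0" using conj_class_nonempty[OF m] fin by (simp add: card_gt_0_iff)
    let ?u = "unif_expect ?C ?f"
    have u: "?u = (\<Sum>\<pi>\<in>?C. random_conjugate.EE n \<pi> ?f) / real (card ?C)"
      unfolding conj_class_mean[OF n, of m ?f] by (simp only: unif_expect_def)
    have "(\<Sum>\<pi>\<in>?C. exp (b - \<delta>)) \<le> (\<Sum>\<pi>\<in>?C. random_conjugate.EE n \<pi> ?f)" by (intro sum_mono) (use bd in blast)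
    hence lo: "exp (b - \<delta>) \<le> ?u" unfolding u using ne by (simp add: field_simps)
    have "(\<Sum>\<pi>\<in>?C. random_conjugate.EE n \<pi> ?f) \<le> (\<Sum>\<pi>\<in>?C. exp (b + \<delta>))" by (intro sum_mono) (use bd in blast)
    hence hi: "?u \<le> exp (b + \<delta>)" unfolding u using ne by (simp add: field_simps)
    have pos: "?u > 0" using lo exp_gt_zero[of "b - \<delta>"] by linarith
    define E where "E = ln ?u - b"
    have "b - \<delta> \<le> ln ?u" "ln ?u \<le> b + \<delta>"
      using lo hi pos exp_le_cancel_iff[of _ "ln ?u"] exp_le_cancel_iff[of "ln ?u"] by simp_all
    hence "\<bar>E\<bar> \<le> \<delta>" unfolding E_def by linarith
    \<comment> \<open>The argument yields the exponent \<open>-1/2\<close>; for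
      \<open>n \<ge> 1\<close> this implies the stated \<open>-1/4\<close>.\<close>
    also have "\<delta> = C * real n powr (-1/2)"
      unfolding \<delta>_def using n by (simp add: powr_minus_divide powr_half_sqrt)
    also have "\<dots> \<le> C * real n powr (-1/4)" using C n by (intro mult_left_mono powr_mono) auto
    finally have "\<bar>E\<bar> \<le> C * real n powr (-1/4)" .
    moreover have "?u = exp (b + E)" unfolding E_def using pos by simp
    ultimately show ?thesis unfolding b_def by blast
  qed
  thus ?thesis unfolding Let_def using C by blast
qed

end
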